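(* Let $n$ be a positive integer. The total number of non-equivalent $n$-fold coverings over $\mathcal{B}_1$, equivalently the number $c_{\pi_1(\mathcal{B}_1)}(n)$ of conjugacy classes of subgroups of index $n$ in $\pi_1(\mathcal{B}_1)$, is $$c_{\pi_1(\mathcal{B}_1)}(n)=\frac1n\sum_{\substack{l\mid n\\ lm=n}}\Bigg(\varphi_3(l)\sum_{2k\mid m}\sigma_1(k)k+\sum_{d\mid l}\mu\!\left(\frac ld\right)(2,d)\,d^2\cdot\sum_{k\mid m}\Big(\sigma_1\!\left(\frac mk\right)-\sigma_1\!\left(\frac m{2k}\right)\Big)k+\varphi_2(l)\sum_{2k\mid m}\Big(\sigma_1\!\left(\frac m{2k}\right)-\sigma_1\!\left(\frac m{4k}\right)\Big)2k\Bigg).$$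
   Context: $\mathcal{B}_1$ (first amphicosm) is the closed flat non-orientable 3-manifold $\mathcal{K}\times S^1$, $\mathcal{K}$ the Klein bottle; $\pi_1(\mathcal{B}_1)=\langle a,b,c : cac^{-1}a^{-1}=cbc^{-1}b^{-1}=1,\ aba^{-1}b=1\rangle$. Coverings are by connected manifolds; two coverings $\rho:\mathcal{N}\to\mathcal{M}$ and $\rho':\mathcal{N}'\to\mathcal{M}$ are equivalent if there is a homeomorphism $\eta:\mathcal{N}\to\mathcal{N}'$ with $\rho=\rho'\circ\eta$. $\sigma_1(x)=\sum_{k\mid x}k$ if $x$ is a positive integer and $\sigma_1(x)=0$ otherwise. $\mu$ is the Möbius function, $(2,d)$ is the greatest common divisor of $2$ and $d$, and $\varphi_j(l)=\sum_{d\mid l}\mu(l/d)d^j$ ($j=2,3$) are the Jordan totient functions. In the outer sum $l$ runs over positive divisors of $n$ and $m=n/l$. A sum $\sum_{2k\mid m}$ runs over all positive integers $k$ with $2k$ dividing $m$, and is $0$ if there are none. *)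

theory Defs
  imports
    "HOL-Analysis.Analysis"
    "HOL-Algebra.Coset"
    "HOL-Computational_Algebra.Squarefree"
begin

section \<open>Manifolds and coverings\<close>

definition topological_manifold :: "nat \<Rightarrow> 'a topology \<Rightarrow> bool" where
  "topological_manifold n X \<longleftrightarrow>
     Hausdorff_space X \<and> second_countable X \<and>
     (\<forall>x\<in>topspace X. \<exists>U V. openin X U \<and> x \<in> U \<and> openin (Euclidean_space n) V \<and>
        subtopology X U homeomorphic_space subtopology (Euclidean_space n) V)"

text \<open>The counterpart of \<^const>\<open>covering_space\<close> for \<^typ>\<open>'a topology\<close>.\<close>

definition covering_map :: "'a topology \<Rightarrow> ('a \<Rightarrow> 'b) \<Rightarrow> 'b topology \<Rightarrow> bool" where
  "covering_map N p M \<longleftrightarrow>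
     continuous_map N M p \<and> p ` topspace N = topspace M \<and>
     (\<forall>x\<in>topspace M. \<exists>T. x \<in> T \<and> openin M T \<and>
        (\<exists>\<V>. \<Union>\<V> = {y \<in> topspace N. p y \<in> T} \<and>
             (\<forall>V\<in>\<V>. openin N V) \<and>
             pairwise disjnt \<V> \<and>
             (\<forall>V\<in>\<V>. homeomorphic_map (subtopology N V) (subtopology M T) p)))"

definition fold_coverings :: "nat \<Rightarrow> 'b topology \<Rightarrow> nat \<Rightarrow> ('a topology \<times> ('a \<Rightarrow> 'b)) set" where
  "fold_coverings k M n =
     {(N, p). topological_manifold k N \<and> connected_space N \<and> covering_map N p M \<and>
        (\<forall>x\<in>topspace M. finite {y \<in> topspace N. p y = x} \<and> card {y \<in> topspace N. p y = x} = n)}"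

text \<open>
  Covering maps are only compared on the underlying sets of the topologies, so the arbitrary values
  of a HOL function outside the space do not matter.
\<close>

definition equivalent_coverings ::
  "'a topology \<times> ('a \<Rightarrow> 'b) \<Rightarrow> 'a topology \<times> ('a \<Rightarrow> 'b) \<Rightarrow> bool" where
  "equivalent_coverings C C' \<longleftrightarrow>
     (\<exists>\<eta>. homeomorphic_map (fst C) (fst C') \<eta> \<and> (\<forall>y\<in>topspace (fst C). snd C y = snd C' (\<eta> y)))"

text \<open>
  The total spaces are topologies on subsets of \<^typ>\<open>'a\<close>. A connected manifold has at most the
  cardinality of the continuum, so any \<^typ>\<open>'a\<close> with at least that many elements sees all
  coverings up to equivalence.
\<close>

definition num_coverings :: "'a itself \<Rightarrow> nat \<Rightarrow> 'b topology \<Rightarrow> nat \<Rightarrow> nat" where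
  "num_coverings _ k M n =
     card ((fold_coverings k M n :: ('a topology \<times> ('a \<Rightarrow> 'b)) set) //
       {(C, C'). C \<in> fold_coverings k M n \<and> C' \<in> fold_coverings k M n \<and>
                 equivalent_coverings C C'})"

section \<open>The first amphicosm\<close>

definition quotient_topology :: "'a topology \<Rightarrow> ('a \<Rightarrow> 'b) \<Rightarrow> 'b topology" where
  "quotient_topology X q =
     topology (\<lambda>U. U \<subseteq> q ` topspace X \<and> openin X {x \<in> topspace X. q x \<in> U})"

lemma openin_quotient_topology:
  "openin (quotient_topology X q) U \<longleftrightarrow>
     U \<subseteq> q ` topspace X \<and> openin X {x \<in> topspace X. q x \<in> U}"
proof -
  let ?P = "\<lambda>U. U \<subseteq> q ` topspace X \<and> openin X {x \<in> topspace X. q x \<in> U}"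
  have "?P (S \<inter> T)" if S: "?P S" and T: "?P T" for S T
  proof -
    have "{x \<in> topspace X. q x \<in> S \<inter> T} =
        {x \<in> topspace X. q x \<in> S} \<inter> {x \<in> topspace X. q x \<in> T}" by blast
    moreover have "openin X \<dots>"
      using S T by (intro openin_Int) simp_all
    ultimately show ?thesis using S by auto
  qed
  moreover have "?P (\<Union>\<K>)" if K: "\<forall>K\<in>\<K>. ?P K" for \<K>
  proof -
    have "{x \<in> topspace X. q x \<in> \<Union>\<K>} = \<Union>((\<lambda>K. {x \<in> topspace X. q x \<in> K}) ` \<K>)" by blast
    moreover have "openin X \<dots>"
      using K by (intro openin_Union) blast
    ultimately show ?thesis using K by (simp add: Sup_le_iff)
  qed
  ultimately have "istopology ?P"
    unfolding istopology_def by blast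
  then show ?thesis
    by (simp add: quotient_topology_def topology_inverse')
qed

text \<open>
  The Klein bottle is the quotient of the plane by the group of isometries generated by the glide
  reflection \<open>(x, y) \<mapsto> (x + 1, -y)\<close> and the translation \<open>(x, y) \<mapsto> (x, y + 1)\<close>; its points are the
  orbits.
\<close>

definition klein_orbit :: "real \<times> real \<Rightarrow> (real \<times> real) set" where
  "klein_orbit = (\<lambda>(x, y).
     {(x + of_int i, (if even i then y else - y) + of_int j) | i j :: int. True})"

definition klein_bottle :: "(real \<times> real) set topology" where
  "klein_bottle = quotient_topology euclidean klein_orbit"

definition first_amphicosm :: "((real \<times> real) set \<times> complex) topology" where
  "first_amphicosm = prod_topology klein_bottle (top_of_set (sphere 0 1))"

section \<open>Groups given by a presentation\<close>

text \<open>
  A word is a list of letters; \<open>(x, True)\<close> stands for the generator \<open>x\<close> and \<open>(x, False)\<close> for its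
  inverse. Two words are identified if they differ by insertions and deletions of relators and of
  subwords \<open>x x\<inverse>\<close>, \<open>x\<inverse> x\<close>.
\<close>

type_synonym 'g word = "('g \<times> bool) list"

inductive word_eq :: "'g word set \<Rightarrow> 'g word \<Rightarrow> 'g word \<Rightarrow> bool" for R where
  refl: "word_eq R w w"
| sym: "word_eq R v w \<Longrightarrow> word_eq R w v"
| trans: "word_eq R u v \<Longrightarrow> word_eq R v w \<Longrightarrow> word_eq R u w"
| cancel: "word_eq R (u @ [(x, e), (x, \<not> e)] @ v) (u @ v)"
| relator: "r \<in> R \<Longrightarrow> word_eq R (u @ r @ v) (u @ v)"

definition word_class :: "'g word set \<Rightarrow> 'g word \<Rightarrow> 'g word set" where
  "word_class R w = {v. word_eq R w v}"

text \<open>All elements of the type \<^typ>\<open>'g\<close> are generators.\<close>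

definition presented_group :: "'g word set \<Rightarrow> 'g word set monoid" where
  "presented_group R =
     \<lparr>carrier = range (word_class R),
      mult = (\<lambda>A B. \<Union>u\<in>A. \<Union>v\<in>B. word_class R (u @ v)),
      one = word_class R []\<rparr>"

datatype amphicosm_gen = Gen_a | Gen_b | Gen_c

definition pi1_first_amphicosm :: "amphicosm_gen word set monoid" where
  "pi1_first_amphicosm = presented_group
     {[(Gen_c, True), (Gen_a, True), (Gen_c, False), (Gen_a, False)],
      [(Gen_c, True), (Gen_b, True), (Gen_c, False), (Gen_b, False)],
      [(Gen_a, True), (Gen_b, True), (Gen_a, False), (Gen_b, True)]}"

section \<open>Conjugacy classes of subgroups\<close>

definition subgroups_of_index :: "('a, 'b) monoid_scheme \<Rightarrow> nat \<Rightarrow> 'a set set" where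
  "subgroups_of_index G n =
     {H. subgroup H G \<and> finite (rcosets\<^bsub>G\<^esub> H) \<and> card (rcosets\<^bsub>G\<^esub> H) = n}"

definition conjugate_sets :: "('a, 'b) monoid_scheme \<Rightarrow> 'a set \<Rightarrow> 'a set \<Rightarrow> bool" where
  "conjugate_sets G H K \<longleftrightarrow>
     (\<exists>g\<in>carrier G. K = (\<lambda>h. g \<otimes>\<^bsub>G\<^esub> h \<otimes>\<^bsub>G\<^esub> inv\<^bsub>G\<^esub> g) ` H)"

definition num_subgroup_classes :: "('a, 'b) monoid_scheme \<Rightarrow> nat \<Rightarrow> nat" where
  "num_subgroup_classes G n =
     card (subgroups_of_index G n //
       {(H, K). H \<in> subgroups_of_index G n \<and> K \<in> subgroups_of_index G n \<and> conjugate_sets G H K})"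

section \<open>Arithmetic functions\<close>

definition sigma1 :: "rat \<Rightarrow> int" where
  "sigma1 x = (if x \<in> \<nat> \<and> x > 0 then \<Sum>k | k dvd nat \<lfloor>x\<rfloor>. int k else 0)"

definition moebius_mu :: "nat \<Rightarrow> int" where
  "moebius_mu n = (if squarefree n then (- 1) ^ card (prime_factors n) else 0)"

definition jordan_totient :: "nat \<Rightarrow> nat \<Rightarrow> int" where
  "jordan_totient j l = (\<Sum>d | d dvd l. moebius_mu (l div d) * int d ^ j)"

end

(*
  Subgroups. Counting pairs (H, Hx) with H of index n and x in the normalizer of H gives n times the
  number of conjugacy classes of subgroups of index n. The group is isomorphic to the set of triples
  of integers with the product (i,j,k)(i',j',k') = (i+i', j+(-1)^i j', k+k'), whose subgroups of
  finite index have a Hermite normal form with diagonal entries p, q, s and index pqs. In terms of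
  this form the normalizer condition is a system of congruences modulo s, so the pairs can be counted
  explicitly. With * for Dirichlet convolution and D for the shift (D f)(2n) = f(n), (D f)(2n+1) = 0, both
  the resulting sum over pqs = n and the stated sum equal (1 - D)(1 + 6D)(id * id * id^2) + D(id * id^2 * id^3).

  Coverings. The group acts on R^3 by isometries, nontrivial elements move points by at least 1, and the quotient is
  the first amphicosm. By compactness a covering of the quotient has sections over the images of all
  balls of one fixed radius, so the projection of R^3 lifts to every covering. The stabilizer of a lift is a
  subgroup whose index is the number of sheets; changing the lift conjugates it, it determines the
  covering, and every subgroup of finite index arises from the quotient of R^3 by it.
*)
theory Submission
  imports Defs
begin

text \<open>Pairs are counted because a class of conjugate subgroups of index n has [G : N(H)]
  members, each with [N(H) : H] cosets in its normalizer, so every class contributes exactly n. An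
  element normalizes a Hermite form through its sign of reflection only, so for fixed p, q, s all
  conditions come down to 2 x = 2 b modulo s, with gcd 2 s solutions. For odd p this restricts
  \<gamma> and the second coordinate of x; for even p and a reflecting x it restricts \<alpha> and
  \<gamma>. Both cases give q^2 s (gcd 2 s)^2, times p/2 or p. Hence D: p/2 for even and p for odd p
  is (1 - D) id, and s (gcd 2 s)^2 is (1 + 6 D) id. For even p a non-reflecting x is unrestricted,
  which gives the remaining term D(id * id^2 * id^3). For coverings, the fibres of a lift are the
  orbits of its stabilizer, and everything is read off from this; no loops or homotopies occur. The
  constant 1 of the minimal displacement is used through balls of radius 1/2, any two points of
  which are less than 1 apart.\<close>

section \<open>Dirichlet convolution\<close>

text \<open>At n = 0 the set of divisors is infinite and the sum takes its default value 0, so the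
  algebraic laws below are equations between functions, without a side condition on the
  argument.\<close>

definition dconv :: "(nat \<Rightarrow> int) \<Rightarrow> (nat \<Rightarrow> int) \<Rightarrow> nat \<Rightarrow> int" where
  "dconv f g n = (\<Sum>d | d dvd n. f d * g (n div d))"

lemma dconv_0 [simp]: "dconv f g 0 = 0"
  by (simp add: dconv_def)

lemma finite_mult_eq: "n > 0 \<Longrightarrow> finite {(a, b). a * b = (n::nat)}"
  by (rule finite_subset[of _ "{..n} \<times> {..n}"]) (auto simp: Suc_leI)

lemma dconv_pairs:
  assumes "n > 0"
  shows "dconv f g n = (\<Sum>(a, b) | a * b = n. f a * g b)"
  unfolding dconv_def
  by (rule sum.reindex_bij_witness[of _ fst "\<lambda>d. (d, n div d)"]) (use assms in auto)

lemma dconv_commute: "dconv f g = dconv g f"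
proof
  fix n
  show "dconv f g n = dconv g f n"
  proof (cases "n = 0")
    case False
    then show ?thesis
      by (simp add: dconv_pairs,
          intro sum.reindex_bij_witness[of _ "\<lambda>(a, b). (b, a)" "\<lambda>(a, b). (b, a)"])
         (auto simp: mult.commute)
  qed simp
qed

text \<open>Factorisations \<open>a * b * c = n\<close> treat the three factors alike. Left
  commutativity thus becomes a permutation of the index set, and associativity follows from it by
  commutativity.\<close>

lemma dconv_triples:
  assumes "n > 0"
  shows "dconv f (dconv g h) n = (\<Sum>(a, b, c) | a * b * c = n. f a * g b * h c)"
proof -
  have "dconv f (dconv g h) n =
      (\<Sum>(a, m) | a * m = n. \<Sum>(b, c) | b * c = m. f a * (g b * h c))"
    unfolding dconv_pairs[OF assms]
    by (rule sum.cong) (use assms in \<open>auto simp: dconv_pairs sum_distrib_left case_prod_unfold\<close>)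
  also have "\<dots> = (\<Sum>(x, y) \<in> (SIGMA x : {(a, m). a * m = n}. {(b, c). b * c = snd x}).
      f (fst x) * (g (fst y) * h (snd y)))"
    unfolding case_prod_unfold
    by (subst sum.Sigma)
       (use assms finite_mult_eq in \<open>auto simp: case_prod_unfold\<close>)
  also have "\<dots> = (\<Sum>(a, b, c) | a * b * c = n. f a * g b * h c)"
    by (rule sum.reindex_bij_witness[of _ "\<lambda>(a, b, c). ((a, b * c), (b, c))"
          "\<lambda>((a, m), (b, c)). (a, b, c)"]) (auto simp: mult.assoc)
  finally show ?thesis .
qed

lemma dconv_left_commute: "dconv f (dconv g h) = dconv g (dconv f h)"
proof
  fix n
  show "dconv f (dconv g h) n = dconv g (dconv f h) n"
  proof (cases "n = 0")
    case False
    then show ?thesis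
      by (simp add: dconv_triples,
          intro sum.reindex_bij_witness[of _ "\<lambda>(a, b, c). (b, a, c)" "\<lambda>(a, b, c). (b, a, c)"])
         (auto simp: mult_ac)
  qed simp
qed

lemma dconv_assoc: "dconv (dconv f g) h = dconv f (dconv g h)"
  by (metis dconv_commute dconv_left_commute)

lemmas dconv_ac = dconv_assoc dconv_commute dconv_left_commute

lemma dconv_add: "dconv (\<lambda>n. f n + g n) h = (\<lambda>n. dconv f h n + dconv g h n)"
  by (auto simp: dconv_def sum.distrib algebra_simps)

lemma dconv_diff: "dconv (\<lambda>n. f n - g n) h = (\<lambda>n. dconv f h n - dconv g h n)"
  by (auto simp: dconv_def sum_subtractf algebra_simps)

lemma dconv_cmult: "dconv (\<lambda>n. c * f n) h = (\<lambda>n. c * dconv f h n)"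
  by (auto simp: dconv_def sum_distrib_left algebra_simps)

text \<open>Convolution with the indicator of k is a shift: k = 2 gives the operator D, and k = 1
  the identity on functions that vanish at 0.\<close>

lemma dconv_delta:
  "dconv (\<lambda>d. if d = k then 1 else 0) f n = (if k dvd n \<and> n > 0 then f (n div k) else 0)"
proof (cases "n = 0")
  case False
  then have "dconv (\<lambda>d. if d = k then 1 else 0) f n = (\<Sum>d | d dvd n. if d = k then f (n div k) else 0)"
    unfolding dconv_def by (intro sum.cong) auto
  with False show ?thesis by (simp add: sum.delta)
qed simp

section \<open>Moebius inversion and Jordan totients\<close>

lemma moebius_mu_prime_mult:
  assumes "prime p" "\<not> p dvd d"
  shows "moebius_mu (p * d) = - moebius_mu d"
proof -
  have d: "d \<noteq> 0" using assms(2) by (intro notI) simp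
  have "squarefree (p * d) \<longleftrightarrow> squarefree d"
    using assms prime_imp_coprime[OF assms] squarefree_prime[of p]
    by (blast intro: squarefree_mult_coprime dest: squarefree_multD)
  moreover have "prime_factors (p * d) = insert p (prime_factors d)"
    using assms d by (simp add: prime_factors_product prime_factorization_prime not_prime_0)
  moreover have "p \<notin> prime_factors d"
    using assms(2) by auto
  ultimately show ?thesis
    by (simp add: moebius_mu_def)
qed

text \<open>Fix a prime p dividing n. Divisors prime to p cancel against their p-fold multiples, and
  multiples of p^2 contribute 0.\<close>

lemma sum_moebius_mu: "n > 1 \<Longrightarrow> (\<Sum>d | d dvd n. moebius_mu d) = 0"
proof -
  assume n: "n > 1"
  then obtain p where p: "prime p" "p dvd n"
    by (metis less_irrefl prime_factor_nat)
  let ?A = "{d. d dvd n \<and> \<not> p dvd d}"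
  let ?B = "{d. p * d dvd n \<and> \<not> p dvd d}"
  have fin: "finite {d. d dvd n}" using n by simp
  have zero: "moebius_mu (p * (p * d)) = 0" for d
  proof -
    have "\<not> squarefree (p * (p * d))"
      using p(1) by (auto simp: squarefree_def power2_eq_square intro!: exI[of _ p])
    then show ?thesis by (simp add: moebius_mu_def)
  qed
  have AB: "?A = ?B"
  proof -
    have "p * d dvd n" if "d dvd n" "\<not> p dvd d" for d
      using that p prime_imp_coprime[OF p(1) that(2)] by (simp add: divides_mult)
    then show ?thesis by (auto dest: dvd_mult_right)
  qed
  have "(\<Sum>d | d dvd n. moebius_mu d) = sum moebius_mu ?A + (\<Sum>d | d dvd n \<and> p dvd d. moebius_mu d)"
    using fin by (subst sum.union_disjoint[symmetric]) (auto intro!: sum.cong)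
  also have "(\<Sum>d | d dvd n \<and> p dvd d. moebius_mu d) = (\<Sum>d | p * d dvd n. moebius_mu (p * d))"
    using p(1) by (intro sum.reindex_bij_witness[of _ "\<lambda>d. p * d" "\<lambda>d. d div p"])
      (auto simp: prime_gt_0_nat)
  also have "\<dots> = (\<Sum>d\<in>?B. moebius_mu (p * d))"
  proof (rule sum.mono_neutral_right)
    show "finite {d. p * d dvd n}"
      using fin by (rule finite_subset[rotated]) (auto dest: dvd_mult_right)
  qed (auto elim!: dvdE simp: zero)
  also have "\<dots> = - sum moebius_mu ?A"
    unfolding AB using p(1) by (simp add: moebius_mu_prime_mult sum_negf)
  finally show ?thesis by simp
qed

text \<open>Convolution of \<open>moebius_mu\<close> with the constant 1 is the unit. The assumption
  on \<open>f 0\<close> is forced by the default value of \<open>dconv\<close> at 0.\<close>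

lemma moebius_inversion:
  assumes "f 0 = 0"
  shows "dconv (dconv f moebius_mu) (\<lambda>_. 1) = f"
proof -
  have "dconv moebius_mu (\<lambda>_. 1) = (\<lambda>n. if n = 1 then 1 else 0)"
  proof
    fix n show "dconv moebius_mu (\<lambda>_. 1) n = (if n = 1 then 1 else 0)"
      using sum_moebius_mu[of n]
      by (cases "n = 0"; cases "n = 1") (auto simp: dconv_def moebius_mu_def)
  qed
  then have "dconv (dconv f moebius_mu) (\<lambda>_. 1) = dconv (\<lambda>n. if n = 1 then 1 else 0) f"
    by (metis dconv_assoc dconv_commute)
  also have "\<dots> = f"
    using assms by (auto simp: fun_eq_iff dconv_delta)
  finally show ?thesis .
qed

lemma jordan_totient_dconv: "jordan_totient j = dconv (\<lambda>d. int d ^ j) moebius_mu"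
  by (auto simp: jordan_totient_def dconv_def mult.commute fun_eq_iff)

lemma jordan_totient_dconv_one: "j > 0 \<Longrightarrow> dconv (jordan_totient j) (\<lambda>_. 1) = (\<lambda>d. int d ^ j)"
  by (simp add: jordan_totient_dconv moebius_inversion)

section \<open>The stated sum in terms of Dirichlet convolutions\<close>

lemma sigma1_of_nat: "sigma1 (of_nat n) = dconv (\<lambda>_. 1) int n"
proof (cases "n = 0")
  case False
  then have "sigma1 (of_nat n) = (\<Sum>k | k dvd n. int k)"
    by (simp add: sigma1_def)
  also have "\<dots> = dconv int (\<lambda>_. 1) n"
    by (simp add: dconv_def)
  finally show ?thesis by (simp add: dconv_commute)
qed (simp add: sigma1_def)

lemma sigma1_divide:
  assumes "k > 0" "m > 0"
  shows "sigma1 (of_nat m / of_nat k) = (if k dvd m then sigma1 (of_nat (m div k)) else 0)"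
proof (cases "k dvd m")
  case True
  then show ?thesis using assms by (auto elim!: dvdE)
next
  case False
  have "(of_nat m / of_nat k :: rat) \<notin> \<nat>"
  proof
    assume "(of_nat m / of_nat k :: rat) \<in> \<nat>"
    then obtain j where "(of_nat m / of_nat k :: rat) = of_nat j" by (auto elim: Nats_cases)
    then have "(of_nat m :: rat) = of_nat (j * k)" using assms by (simp add: field_simps)
    then show False using False by (metis dvd_triv_right of_nat_eq_iff)
  qed
  with False show ?thesis by (simp add: sigma1_def)
qed

abbreviation (input) sigma_diff :: "nat \<Rightarrow> int" where
  "sigma_diff \<equiv> \<lambda>r. dconv (\<lambda>_. 1) int r - dconv (\<lambda>d. if d = 2 then 1 else 0) (dconv (\<lambda>_. 1) int) r"

text \<open>The two divisor sums merge into the single function (1 - D) sigma_1 of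
  \<open>m div k\<close>; this turns the inner sums of the formula into convolutions.\<close>

lemma sigma1_diff:
  assumes "k > 0" "m > 0" "k dvd m"
  shows "sigma1 (of_nat m / of_nat k) - sigma1 (of_nat m / of_nat (2 * k)) = sigma_diff (m div k)"
proof -
  have *: "2 * k dvd m \<longleftrightarrow> 2 dvd m div k" "m div (2 * k) = m div k div 2"
    using assms by (auto elim!: dvdE)
  show ?thesis
    using assms unfolding dconv_delta
    by (subst (1 2) sigma1_divide) (auto simp: * sigma1_of_nat)
qed

text \<open>The Jordan totients absorb the constant function E inside sigma_1, by J2 * E = id^2 and
  J3 * E = id^3. The three summands become D(id * id^2 * id^3), (1 + 4 D)(1 - D)(id * id * id^2) and
  2 D(1 - D)(id * id * id^2).\<close>

lemma coverings_sum:
  assumes "n > 0"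
  shows "(\<Sum>l | l dvd n. let m = n div l in
          jordan_totient 3 l * (\<Sum>k | k > 0 \<and> 2 * k dvd m. sigma1 (of_nat k) * int k)
        + (\<Sum>d | d dvd l. moebius_mu (l div d) * int (gcd 2 d) * (int d)\<^sup>2)
          * (\<Sum>k | k dvd m.
              (sigma1 (of_nat m / of_nat k) - sigma1 (of_nat m / of_nat (2 * k))) * int k)
        + jordan_totient 2 l
          * (\<Sum>k | k > 0 \<and> 2 * k dvd m.
              (sigma1 (of_nat m / of_nat (2 * k)) - sigma1 (of_nat m / of_nat (4 * k)))
              * (2 * int k)))
    = (\<Sum>(q, p, s) | q * p * s = n. int (q ^ 2) *
         int ((if even p then p div 2 * s ^ 3 else 0) +
              (if even p then p div 2 else p) * s * (gcd 2 s) ^ 2))"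
  (is "?L = ?R")
proof -
  define D where "D = (\<lambda>d::nat. if d = 2 then 1 else (0::int))"
  define E where "E = (\<lambda>_::nat. 1 :: int)"
  define I2 where "I2 = (\<lambda>d. int d ^ 2)"
  define I3 where "I3 = (\<lambda>d. int d ^ 3)"
  define I where "I = int"
  define A where "A = (\<lambda>r. dconv E I r - dconv D (dconv E I) r)"
  define X where "X = (\<lambda>m. \<Sum>k | k > 0 \<and> 2 * k dvd m. sigma1 (of_nat k) * int k)"
  define Y where "Y = (\<lambda>m. \<Sum>k | k dvd m.
              (sigma1 (of_nat m / of_nat k) - sigma1 (of_nat m / of_nat (2 * k))) * int k)"
  define Z where "Z = (\<lambda>m. \<Sum>k | k > 0 \<and> 2 * k dvd m.
              (sigma1 (of_nat m / of_nat (2 * k)) - sigma1 (of_nat m / of_nat (4 * k))) * (2 * int k))"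
  define J2 where "J2 = jordan_totient 2"
  define J3 where "J3 = jordan_totient 3"
  define P where "P = (\<lambda>l. \<Sum>d | d dvd l. moebius_mu (l div d) * int (gcd 2 d) * (int d)\<^sup>2)"
  have dD: "dconv D f m = (if even m \<and> m > 0 then f (m div 2) else 0)" for f m
    by (simp add: D_def dconv_delta)
  have sig: "sigma1 (of_nat k) = dconv E I k" for k
    by (simp add: E_def I_def sigma1_of_nat)
  have A: "sigma1 (of_nat m / of_nat k) - sigma1 (of_nat m / of_nat (2 * k)) = A (m div k)"
    if "k > 0" "m > 0" "k dvd m" for m k
    using sigma1_diff[OF that] by (simp add: A_def D_def E_def I_def)
  \<comment> \<open>Pointwise multiplication by the identity function is compatible with Dirichlet
    convolution, so it turns E into I and I into I2.\<close>
  have ii2: "dconv E I k * int k = dconv I I2 k" for k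
  proof -
    have "dconv I E k * int k = dconv I2 I k"
      unfolding dconv_def I_def I2_def E_def
      by (auto simp: sum_distrib_right power2_eq_square intro!: sum.cong elim!: dvdE)
    then show ?thesis by (simp add: dconv_commute)
  qed
  \<comment> \<open>The condition 2 k | m amounts to k | m/2 for even m, which is a convolution with
    D.\<close>
  have double: "(\<Sum>k | k > 0 \<and> 2 * k dvd m. h k) = (if even m then \<Sum>k | k dvd m div 2. h k else 0)"
    if "m > 0" for m and h :: "nat \<Rightarrow> int"
  proof (cases "even m")
    case True
    then obtain c where "m = 2 * c" by (elim evenE)
    then have "{k. k > 0 \<and> 2 * k dvd m} = {k. k dvd m div 2}"
      using that by (auto intro: Nat.gr0I)
    with True show ?thesis by simp
  next
    case False
    then have "{k. k > 0 \<and> 2 * k dvd m} = {}" by (auto dest: dvd_mult_left)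
    with False show ?thesis by (simp only: sum.empty if_False)
  qed
  have X: "X m = dconv D (dconv (dconv I I2) E) m" if "m > 0" for m
  proof -
    have "dconv (dconv I I2) E k = (\<Sum>d | d dvd k. dconv I I2 d)" for k
      unfolding dconv_def[of "dconv I I2"] E_def by simp
    with that show ?thesis
      by (simp only: X_def double[OF that] dD sig ii2 simp_thms)
  qed
  have Y: "Y m = dconv I A m" if "m > 0" for m
    unfolding Y_def dconv_def
  proof (rule sum.cong[OF HOL.refl])
    fix k assume "k \<in> {k. k dvd m}"
    with that have k: "k > 0" "k dvd m" by (auto intro: Nat.gr0I)
    show "(sigma1 (of_nat m / of_nat k) - sigma1 (of_nat m / of_nat (2 * k))) * int k = I k * A (m div k)"
      unfolding A[OF k(1) that k(2)] I_def by (rule mult.commute)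
  qed
  have Z: "Z m = dconv D (dconv (\<lambda>k. 2 * I k) A) m" if "m > 0" for m
  proof -
    have "Z m = (if even m then \<Sum>k | k dvd m div 2. 2 * I k * A (m div 2 div k) else 0)"
      unfolding Z_def double[OF that]
    proof (intro if_cong HOL.refl sum.cong)
      \<comment> \<open>The difference with 2 k and 4 k is the one treated in \<open>A\<close>,
        taken at 2 k.\<close>
      fix k assume "even m" "k \<in> {k. k dvd m div 2}"
      then obtain c where c: "m = 2 * (k * c)" by (metis dvd_div_mult_self dvd_mult_div_cancel mem_Collect_eq)
      with that have "2 * k > 0" "2 * k dvd m" "m div 2 div k = m div (2 * k)"
        by (auto simp: div_mult2_eq)
      with A[OF this(1) that this(2)]
      show "(sigma1 (of_nat m / of_nat (2 * k)) - sigma1 (of_nat m / of_nat (4 * k))) * (2 * int k) =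
          2 * I k * A (m div 2 div k)"
        by (simp add: I_def)
    qed
    also have "\<dots> = (if even m then dconv (\<lambda>k. 2 * I k) A (m div 2) else 0)"
      by (simp only: dconv_def)
    finally show ?thesis using that by (simp only: dD simp_thms)
  qed
  \<comment> \<open>For even d, 2 d^2 = d^2 + 4 (d/2)^2; this is the origin of the factor 1 + 4
    D.\<close>
  have g: "int (gcd 2 d) * (int d)\<^sup>2 = I2 d + 4 * dconv D I2 d" for d
    unfolding dD by (cases "even d") (auto simp: I2_def power_mult_distrib elim!: evenE)
  have "P = dconv (\<lambda>d. int (gcd 2 d) * (int d)\<^sup>2) moebius_mu"
    by (auto simp: P_def dconv_def mult_ac)
  then have P: "P = (\<lambda>n. J2 n + 4 * dconv D J2 n)"
    unfolding g dconv_add dconv_cmult dconv_assoc by (simp add: J2_def I2_def jordan_totient_dconv)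
  have j2: "dconv J2 (dconv E f) = dconv I2 f" "dconv E (dconv J2 f) = dconv I2 f" for f
    using jordan_totient_dconv_one[of 2] dconv_assoc[of J2 E f] dconv_left_commute[of J2 E f]
    by (simp_all add: J2_def E_def I2_def)
  have j3: "dconv E J3 = I3"
    using jordan_totient_dconv_one[of 3] dconv_commute[of E J3]
    by (simp add: J3_def E_def I3_def)
  have c2: "dconv f (\<lambda>n. c * h n) = (\<lambda>n. c * dconv f h n)" for f h c
    by (simp add: dconv_commute[of f] dconv_cmult)
  have a2: "dconv h (\<lambda>n. f n + g n) = (\<lambda>n. dconv h f n + dconv h g n)" for f g h
    by (simp add: dconv_commute[of h] dconv_add)
  have d2: "dconv h (\<lambda>n. f n - g n) = (\<lambda>n. dconv h f n - dconv h g n)" for f g h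
    by (simp add: dconv_commute[of h] dconv_diff)
  note lin = dconv_add dconv_cmult dconv_diff c2 a2 d2
  have "?L = (\<Sum>l | l dvd n. J3 l * X (n div l) + P l * Y (n div l) + J2 l * Z (n div l))"
    by (simp add: Let_def X_def Y_def Z_def P_def J2_def J3_def)
  also have "\<dots> = (\<Sum>l | l dvd n. J3 l * dconv D (dconv (dconv I I2) E) (n div l)
      + P l * dconv I A (n div l) + J2 l * dconv D (dconv (\<lambda>k. 2 * I k) A) (n div l))"
    using assms by (intro sum.cong HOL.refl) (auto simp: X Y Z elim!: dvdE)
  also have "\<dots> = dconv J3 (dconv D (dconv (dconv I I2) E)) n
      + dconv P (dconv I A) n + dconv J2 (dconv D (dconv (\<lambda>k. 2 * I k) A)) n"
    by (simp add: dconv_def sum.distrib)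
  also have "dconv J3 (dconv D (dconv (dconv I I2) E)) = dconv D (dconv I (dconv I2 (dconv E J3)))"
    by (simp only: dconv_ac)
  also have "dconv E J3 = I3" by (rule j3)
  also have "dconv P (dconv I A) = (\<lambda>n. dconv I (dconv I I2) n + 3 * dconv D (dconv I (dconv I I2)) n
         - 4 * dconv D (dconv D (dconv I (dconv I I2))) n)"
  proof -
    have "dconv J2 (dconv I A) = (\<lambda>n. dconv (dconv J2 E) (dconv I I) n - dconv D (dconv (dconv J2 E) (dconv I I)) n)"
      unfolding A_def lin by (simp only: dconv_ac)
    then have 1: "dconv J2 (dconv I A) = (\<lambda>n. dconv I (dconv I I2) n - dconv D (dconv I (dconv I I2)) n)"
      unfolding dconv_assoc j2 by (simp only: dconv_ac)
    show ?thesis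
      unfolding P dconv_add dconv_cmult dconv_assoc 1 lin by (simp add: algebra_simps)
  qed
  also have "dconv J2 (dconv D (dconv (\<lambda>k. 2 * I k) A)) =
      (\<lambda>n. 2 * dconv D (dconv I (dconv I I2)) n - 2 * dconv D (dconv D (dconv I (dconv I I2))) n)"
  proof -
    have "dconv J2 (dconv D (dconv (\<lambda>k. 2 * I k) A)) =
      (\<lambda>n. 2 * (dconv D (dconv (dconv J2 E) (dconv I I)) n - dconv D (dconv D (dconv (dconv J2 E) (dconv I I))) n))"
      unfolding A_def lin by (simp only: dconv_ac)
    then show ?thesis
      unfolding dconv_assoc j2 right_diff_distrib by (simp only: dconv_ac)
  qed
  \<comment> \<open>The terms in id * id * id^2 add up to 1 + 5 D - 6 D^2 = (1 - D)(1 + 6 D); the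
    first factor is given to p and the second to s.\<close>
  also have "dconv D (dconv I (dconv I2 I3)) n +
      (dconv I (dconv I I2) n + 3 * dconv D (dconv I (dconv I I2)) n
         - 4 * dconv D (dconv D (dconv I (dconv I I2))) n) +
      (2 * dconv D (dconv I (dconv I I2)) n - 2 * dconv D (dconv D (dconv I (dconv I I2))) n)
    = dconv I2 (\<lambda>n. dconv (dconv D I) I3 n +
        dconv (\<lambda>p. I p - dconv D I p) (\<lambda>s. I s + 6 * dconv D I s) n) n"
    unfolding lin by (simp add: dconv_ac)
  also have "dconv (dconv D I) I3 = dconv (\<lambda>p. if even p then int (p div 2) else 0) I3"
    by (rule arg_cong[of _ _ "\<lambda>f. dconv f I3"]) (auto simp: dD I_def)
  also have "(\<lambda>p. I p - dconv D I p) = (\<lambda>p. int (if even p then p div 2 else p))"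
    by (auto simp: dD I_def fun_eq_iff elim!: evenE)
  \<comment> \<open>For even s, 4 s = s + 6 (s/2).\<close>
  also have "(\<lambda>s. I s + 6 * dconv D I s) = (\<lambda>s. int (s * (gcd 2 s) ^ 2))"
  proof
    fix s show "I s + 6 * dconv D I s = int (s * (gcd 2 s) ^ 2)"
      unfolding dD I_def by (cases "even s") (auto elim!: evenE)
  qed
  also have "dconv I2 (\<lambda>n. dconv (\<lambda>p. if even p then int (p div 2) else 0) I3 n +
        dconv (\<lambda>p. int (if even p then p div 2 else p)) (\<lambda>s. int (s * (gcd 2 s) ^ 2)) n) n = ?R"
    unfolding a2 dconv_triples[OF assms] sum.distrib[symmetric] I2_def I3_def
    by (intro sum.cong HOL.refl) (auto simp: algebra_simps)
  finally show ?thesis .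
qed

section \<open>Conjugacy classes of subgroups\<close>

text \<open>The correspondence is a relation since it need not be single-valued: a covering has many
  lifts, hence many stabilizers. The condition \<open>compat\<close> yields at once that the induced
  map of classes is well defined and that it is injective.\<close>

lemma card_quotient_eq:
  assumes R: "equiv A R" and S: "equiv B S"
    and left: "\<And>a. a \<in> A \<Longrightarrow> \<exists>b\<in>B. Z a b"
    and right: "\<And>b. b \<in> B \<Longrightarrow> \<exists>a\<in>A. Z a b"
    and compat: "\<And>a b a' b'. \<lbrakk>a \<in> A; a' \<in> A; b \<in> B; b' \<in> B; Z a b; Z a' b'\<rbrakk> \<Longrightarrow>
      (a, a') \<in> R \<longleftrightarrow> (b, b') \<in> S"
  shows "card (A // R) = card (B // S)"
proof -
  obtain f where f: "\<And>a. a \<in> A \<Longrightarrow> f a \<in> B \<and> Z a (f a)"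
    using left by metis
  define F where "F = (\<lambda>X. S `` {f (SOME a. a \<in> X)})"
  have F: "F (R `` {a}) = S `` {f a}" if "a \<in> A" for a
  proof -
    define c where "c = (SOME x. x \<in> R `` {a})"
    have "a \<in> R `` {a}" using R that by (rule equiv_class_self)
    then have "c \<in> R `` {a}" unfolding c_def by (rule someI)
    then have "(a, c) \<in> R" by simp
    then have "c \<in> A" using equiv_type[OF R] by blast
    with \<open>(a, c) \<in> R\<close> have "(f a, f c) \<in> S"
      using compat[OF that \<open>c \<in> A\<close>] f that by blast
    then show ?thesis
      using equiv_class_eq[OF S] by (simp add: F_def c_def)
  qed
  have "bij_betw F (A // R) (B // S)"
    unfolding bij_betw_def
  proof
    show "inj_on F (A // R)"
    proof (rule inj_onI)
      fix X Y assume "X \<in> A // R" "Y \<in> A // R" and eq: "F X = F Y"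
      then obtain a b where ab: "a \<in> A" "b \<in> A" "X = R `` {a}" "Y = R `` {b}"
        by (auto elim!: quotientE)
      with eq F have "S `` {f a} = S `` {f b}" by simp
      then have "(f a, f b) \<in> S" using eq_equiv_class[OF _ S] f ab by blast
      then have "(a, b) \<in> R" using compat f ab by blast
      then show "X = Y" using equiv_class_eq[OF R] ab by simp
    qed
    show "F ` (A // R) = B // S"
    proof
      show "F ` (A // R) \<subseteq> B // S"
        using f by (auto elim!: quotientE simp: F intro!: quotientI)
      show "B // S \<subseteq> F ` (A // R)"
      proof
        fix Y assume "Y \<in> B // S"
        then obtain b where b: "b \<in> B" "Y = S `` {b}" by (auto elim!: quotientE)
        then obtain a where a: "a \<in> A" "Z a b" using right by blast
        have "(a, a) \<in> R" using R a by (auto simp: equiv_def refl_on_def)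
        then have "(f a, b) \<in> S" using compat[OF a(1) a(1)] f[OF a(1)] a b by blast
        then have "Y = F (R `` {a})" using equiv_class_eq[OF S] a b F by simp
        then show "Y \<in> F ` (A // R)" using a by (auto intro: quotientI)
      qed
    qed
  qed
  then show ?thesis by (rule bij_betw_same_card)
qed

definition conjugate :: "('a, 'b) monoid_scheme \<Rightarrow> 'a \<Rightarrow> 'a set \<Rightarrow> 'a set" where
  "conjugate G g H = (\<lambda>h. g \<otimes>\<^bsub>G\<^esub> h \<otimes>\<^bsub>G\<^esub> inv\<^bsub>G\<^esub> g) ` H"

lemma conjugate_sets_iff: "conjugate_sets G H K \<longleftrightarrow> (\<exists>g\<in>carrier G. K = conjugate G g H)"
  by (simp add: conjugate_sets_def conjugate_def)

abbreviation conjugacy_on_index :: "('a, 'b) monoid_scheme \<Rightarrow> nat \<Rightarrow> ('a set \<times> 'a set) set" where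
  "conjugacy_on_index G n \<equiv>
     {(H, K). H \<in> subgroups_of_index G n \<and> K \<in> subgroups_of_index G n \<and> conjugate_sets G H K}"

lemma iso_image_r_coset:
  assumes "\<phi> \<in> iso G G'" "H \<subseteq> carrier G" "x \<in> carrier G"
  shows "(\<phi> ` H) #>\<^bsub>G'\<^esub> \<phi> x = \<phi> ` (H #>\<^bsub>G\<^esub> x)"
proof -
  have "\<phi> (h \<otimes>\<^bsub>G\<^esub> x) = \<phi> h \<otimes>\<^bsub>G'\<^esub> \<phi> x" if "h \<in> H" for h
    using assms that by (auto simp: iso_def intro: hom_mult)
  then show ?thesis unfolding r_coset_def by (simp add: image_UN)
qed

lemma iso_image_subgroups_of_index:
  assumes "group G" "group G'" and \<phi>: "\<phi> \<in> iso G G'" and H: "H \<in> subgroups_of_index G n"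
  shows "\<phi> ` H \<in> subgroups_of_index G' n"
proof -
  have sub: "subgroup H G" and HG: "H \<subseteq> carrier G"
    using H by (auto simp: subgroups_of_index_def subgroup.subset)
  have bij: "bij_betw \<phi> (carrier G) (carrier G')"
    using \<phi> by (simp add: iso_def)
  have hom: "group_hom G G' \<phi>"
    using assms(1,2) \<phi> by (simp add: group_hom_def group_hom_axioms_def iso_def)
  have "rcosets\<^bsub>G'\<^esub> (\<phi> ` H) = (`) \<phi> ` (rcosets\<^bsub>G\<^esub> H)"
    unfolding RCOSETS_def using bij_betw_imp_surj_on[OF bij, symmetric]
    by (auto simp: iso_image_r_coset[OF \<phi> HG] image_iff)
  moreover have "inj_on ((`) \<phi>) (rcosets\<^bsub>G\<^esub> H)"
  proof (rule inj_on_subset)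
    show "inj_on ((`) \<phi>) (Pow (carrier G))"
      using bij by (simp add: inj_on_image_Pow bij_betw_def)
    show "rcosets\<^bsub>G\<^esub> H \<subseteq> Pow (carrier G)"
      using group.rcosets_subset_PowG[OF assms(1) sub] .
  qed
  moreover have "subgroup (\<phi> ` H) G'"
    using hom sub by (rule group_hom.subgroup_img_is_subgroup)
  ultimately show ?thesis
    using H by (simp add: subgroups_of_index_def card_image)
qed

section \<open>Conjugation, normalizers and the count of conjugacy classes\<close>

context group
begin

lemma inv_mult_cancel [simp]:
  assumes "x \<in> carrier G" "y \<in> carrier G"
  shows "inv x \<otimes> (x \<otimes> y) = y" "x \<otimes> (inv x \<otimes> y) = y"
  using assms by (simp_all add: m_assoc[symmetric])

lemma conjugation_iso:
  assumes "g \<in> carrier G"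
  shows "(\<lambda>h. g \<otimes> h \<otimes> inv g) \<in> iso G G"
proof (rule isoI)
  show "(\<lambda>h. g \<otimes> h \<otimes> inv g) \<in> hom G G"
    using assms by (auto simp: hom_def m_assoc)
  show "bij_betw (\<lambda>h. g \<otimes> h \<otimes> inv g) (carrier G) (carrier G)"
    by (rule bij_betw_byWitness[of _ "\<lambda>h. inv g \<otimes> h \<otimes> g"])
       (use assms in \<open>auto simp: m_assoc\<close>)
qed

lemma conjugate_subgroups_of_index:
  assumes "H \<in> subgroups_of_index G n" "g \<in> carrier G"
  shows "conjugate G g H \<in> subgroups_of_index G n"
  using is_group is_group conjugation_iso[OF assms(2)] assms(1)
  unfolding conjugate_def by (rule iso_image_subgroups_of_index)

lemma conjugate_one: "H \<subseteq> carrier G \<Longrightarrow> conjugate G \<one> H = H"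
  using image_cong[of H H "\<lambda>h. \<one> \<otimes> h \<otimes> inv \<one>" "\<lambda>h. h"] by (simp add: conjugate_def subset_iff)

lemma conjugate_mult:
  assumes "H \<subseteq> carrier G" "g \<in> carrier G" "k \<in> carrier G"
  shows "conjugate G g (conjugate G k H) = conjugate G (g \<otimes> k) H"
  unfolding conjugate_def image_image
proof (rule image_cong[OF HOL.refl])
  fix h assume "h \<in> H"
  with assms have "h \<in> carrier G" by blast
  with assms show "g \<otimes> (k \<otimes> h \<otimes> inv k) \<otimes> inv g = g \<otimes> k \<otimes> h \<otimes> inv (g \<otimes> k)"
    by (simp add: inv_mult_group m_assoc)
qed

lemma conjugate_subset: "H \<subseteq> carrier G \<Longrightarrow> g \<in> carrier G \<Longrightarrow> conjugate G g H \<subseteq> carrier G"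
  by (auto simp: conjugate_def)

lemma conjugate_inv:
  assumes "H \<subseteq> carrier G" "g \<in> carrier G"
  shows "conjugate G (inv g) (conjugate G g H) = H"
  using assms conjugate_mult[of H "inv g" g] conjugate_one[of H] by (simp only: inv_closed l_inv)

text \<open>The inclusion for h, combined with the one for its inverse, gives equality.\<close>

lemma conjugate_self:
  assumes sub: "subgroup H G" and "h \<in> H"
  shows "conjugate G h H = H"
proof -
  have HG: "H \<subseteq> carrier G" using sub by (rule subgroup.subset)
  have h: "h \<in> carrier G" using assms(2) HG by blast
  have "conjugate G k H \<subseteq> H" if "k \<in> H" for k
    unfolding conjugate_def using sub that by (auto intro!: subgroup.m_closed subgroup.m_inv_closed)
  from this[OF assms(2)] this[OF subgroup.m_inv_closed[OF sub assms(2)]]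
  have "conjugate G h H \<subseteq> H" "conjugate G h (conjugate G (inv h) H) \<subseteq> conjugate G h H"
    by (simp_all add: conjugate_def image_mono)
  moreover have "conjugate G h (conjugate G (inv h) H) = H"
    using conjugate_mult[OF HG h inv_closed[OF h]] conjugate_one[OF HG] h by (simp only: r_inv)
  ultimately show ?thesis by blast
  qed

lemma equiv_conjugacy_on_index: "equiv (subgroups_of_index G n) (conjugacy_on_index G n)"
proof (rule equivI)
  have sub: "H \<subseteq> carrier G" if "H \<in> subgroups_of_index G n" for H
    using that by (auto simp: subgroups_of_index_def subgroup_def)
  show "conjugacy_on_index G n \<subseteq> subgroups_of_index G n \<times> subgroups_of_index G n"
    by auto
  have "conjugate_sets G H H" if "H \<in> subgroups_of_index G n" for H
    unfolding conjugate_sets_iff using conjugate_one[OF sub[OF that]] by (metis one_closed)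
  then show "refl_on (subgroups_of_index G n) (conjugacy_on_index G n)"
    by (simp add: refl_on_def)
  show "Relation.sym (conjugacy_on_index G n)"
  proof (rule symI)
    fix H K assume HK: "(H, K) \<in> conjugacy_on_index G n"
    then obtain g where "g \<in> carrier G" "K = conjugate G g H"
      by (auto simp: conjugate_sets_iff)
    then have "H = conjugate G (inv g) K"
      using conjugate_inv[of H g] sub HK by simp
    then show "(K, H) \<in> conjugacy_on_index G n"
      using HK inv_closed[OF \<open>g \<in> carrier G\<close>] unfolding conjugate_sets_iff
        by (simp only: mem_Collect_eq case_prod_conv) blast
  qed
  show "Relation.trans (conjugacy_on_index G n)"
  proof (rule transI)
    fix H K L assume HKL: "(H, K) \<in> conjugacy_on_index G n" "(K, L) \<in> conjugacy_on_index G n"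
    then obtain g k where gk: "g \<in> carrier G" "K = conjugate G g H" "k \<in> carrier G" "L = conjugate G k K"
      by (auto simp: conjugate_sets_iff)
    then have "L = conjugate G (k \<otimes> g) H"
      using conjugate_mult[of H k g] sub HKL by simp
    moreover have "k \<otimes> g \<in> carrier G" using gk by simp
    ultimately show "(H, L) \<in> conjugacy_on_index G n"
      using HKL unfolding conjugate_sets_iff
        by (simp only: mem_Collect_eq case_prod_conv) blast
  qed
qed

text \<open>The quotient N(H)/H as a bare set; only its cardinality enters.\<close>

definition normalizer_cosets :: "'a set \<Rightarrow> 'a set set" where
  "normalizer_cosets H = {H #> x | x. x \<in> carrier G \<and> conjugate G x H = H}"

lemma r_coset_eq_iff:
  assumes "subgroup H G" "x \<in> carrier G" "y \<in> carrier G"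
  shows "H #> x = H #> y \<longleftrightarrow> x \<otimes> inv y \<in> H"
  by (metis assms coset_join1 coset_join2 coset_mult_inv1 coset_mult_inv2 group.inv_closed is_group m_closed subgroup.subset)

text \<open>Send the coset H x to the conjugate of H by the inverse of x. This maps the n cosets
  onto the conjugacy class, and the fibre over K is a left translate of N(K)/K.\<close>

lemma sum_normalizer_cosets_conjugates:
  assumes H: "H \<in> subgroups_of_index G n" and "n > 0"
  shows "(\<Sum>K\<in>conjugacy_on_index G n `` {H}. card (normalizer_cosets K)) = n"
proof -
  have sub: "subgroup H G" and fin: "finite (rcosets H)" and card: "card (rcosets H) = n"
    using H by (auto simp: subgroups_of_index_def)
  then have HG: "H \<subseteq> carrier G" by (simp add: subgroup.subset)
  \<comment> \<open>The union avoids a choice of representative: all members of one right coset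
    contribute the same conjugate.\<close>
  define f where "f = (\<lambda>X. \<Union>x\<in>X. conjugate G (inv x) H)"
  note conj_H = conjugate_self[OF sub]
  have f: "f (H #> x) = conjugate G (inv x) H" if x: "x \<in> carrier G" for x
  proof -
    have "conjugate G (inv (h \<otimes> x)) H = conjugate G (inv x) H" if "h \<in> H" for h
    proof -
      have "h \<in> carrier G" using that HG by blast
      then have "conjugate G (inv (h \<otimes> x)) H = conjugate G (inv x) (conjugate G (inv h) H)"
        using x HG by (simp only: conjugate_mult inv_mult_group inv_closed)
      then show ?thesis using conj_H[OF subgroup.m_inv_closed[OF sub that]] by simp
    qed
    moreover have "H \<noteq> {}" using sub subgroup.one_closed by auto
    ultimately show ?thesis
      unfolding f_def r_coset_def by auto
  qed
  have image: "f ` (rcosets H) = conjugacy_on_index G n `` {H}"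
  proof (intro equalityI subsetI)
    fix K assume "K \<in> f ` (rcosets H)"
    then obtain x where "x \<in> carrier G" "K = conjugate G (inv x) H"
      using f by (auto simp: RCOSETS_def)
    then show "K \<in> conjugacy_on_index G n `` {H}"
      using H conjugate_subgroups_of_index[OF H, of "inv x"] by (auto simp: conjugate_sets_iff)
  next
    fix K assume "K \<in> conjugacy_on_index G n `` {H}"
    then obtain x where "x \<in> carrier G" "K = conjugate G x H"
      by (auto simp: conjugate_sets_iff)
    then have "K = f (H #> inv x)" "H #> inv x \<in> rcosets H"
      using HG by (simp_all add: f rcosetsI)
    then show "K \<in> f ` (rcosets H)" by blast
  qed
  have fiber: "card {X \<in> rcosets H. f X = K} = card (normalizer_cosets K)"
    if "K \<in> f ` (rcosets H)" for K
  proof -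
    obtain g where g: "g \<in> carrier G" and K: "K = conjugate G (inv g) H"
    proof -
      obtain g where "g \<in> carrier G" "K = f (H #> g)"
        using \<open>K \<in> f ` (rcosets H)\<close> by (auto simp: RCOSETS_def)
      then show ?thesis using f that by simp
    qed
    \<comment> \<open>As K arises from H by conjugation with \<open>inv g\<close>, left translation
      by \<open>inv g\<close> carries the coset of H through \<open>g \<otimes> x\<close> to the
      coset of K through x.\<close>
    let ?t = "\<lambda>X. (\<lambda>y. inv g \<otimes> y) ` X"
    have KG: "K \<subseteq> carrier G" using K HG g by (simp add: conjugate_subset)
    have K_coset: "K #> x = ?t (H #> (g \<otimes> x))" if "x \<in> carrier G" for x
    proof -
      have "inv g \<otimes> h \<otimes> inv (inv g) \<otimes> x = inv g \<otimes> (h \<otimes> (g \<otimes> x))" if "h \<in> H" for h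
        using that HG g \<open>x \<in> carrier G\<close> by (auto simp: m_assoc)
      then show ?thesis unfolding K r_coset_def conjugate_def by (auto simp: image_iff)
    qed
    have fK: "f (H #> (g \<otimes> x)) = K \<longleftrightarrow> conjugate G x K = K" if x: "x \<in> carrier G" for x
    proof -
      have "f (H #> (g \<otimes> x)) = conjugate G (inv x) K"
        using x g HG by (simp only: f m_closed K conjugate_mult inv_mult_group inv_closed)
      moreover have "conjugate G (inv x) (conjugate G x K) = K" "conjugate G x (conjugate G (inv x) K) = K"
        using x KG conjugate_inv[of K x] conjugate_inv[of K "inv x"] by simp_all
      ultimately show ?thesis by metis
    qed
    have "normalizer_cosets K = ?t ` {X \<in> rcosets H. f X = K}"
    proof (intro equalityI subsetI)
      fix Y assume "Y \<in> normalizer_cosets K"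
      then obtain x where x: "Y = K #> x" "x \<in> carrier G" "conjugate G x K = K"
        unfolding normalizer_cosets_def by blast
      then have "H #> (g \<otimes> x) \<in> rcosets H" "f (H #> (g \<otimes> x)) = K"
        using fK g HG by (simp_all add: rcosetsI)
      then show "Y \<in> ?t ` {X \<in> rcosets H. f X = K}"
        using K_coset x by blast
    next
      fix Y assume "Y \<in> ?t ` {X \<in> rcosets H. f X = K}"
      then obtain z where z: "z \<in> carrier G" "Y = ?t (H #> z)" "f (H #> z) = K"
        by (auto simp: RCOSETS_def)
      define x where "x = inv g \<otimes> z"
      have "x \<in> carrier G" "z = g \<otimes> x"
        using z g by (auto simp: x_def m_assoc[symmetric])
      then show "Y \<in> normalizer_cosets K"
        using z fK K_coset unfolding normalizer_cosets_def by blast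
    qed
    moreover have "inj_on ?t {X \<in> rcosets H. f X = K}"
    proof (rule inj_on_subset)
      show "inj_on ?t (Pow (carrier G))"
        using g by (intro inj_on_image_Pow inj_onI) simp
      show "{X \<in> rcosets H. f X = K} \<subseteq> Pow (carrier G)"
        using HG by (auto simp: RCOSETS_def dest: r_coset_subset_G[THEN subsetD])
    qed
    ultimately show ?thesis by (simp add: card_image)
  qed
  have "n = (\<Sum>X\<in>rcosets H. 1)" using card by simp
  also have "\<dots> = (\<Sum>K\<in>f ` (rcosets H). \<Sum>X | X \<in> rcosets H \<and> f X = K. 1)"
    using fin by (rule sum.image_gen)
  also have "\<dots> = (\<Sum>K\<in>f ` (rcosets H). card (normalizer_cosets K))"
    using fiber by (intro sum.cong) auto
  finally show ?thesis by (simp add: image)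
qed

text \<open>Orbit counting: the sum over all subgroups splits into classes, each of which
  contributes n.\<close>

lemma card_conjugacy_classes:
  assumes "n > 0" "finite (subgroups_of_index G n)"
  shows "n * num_subgroup_classes G n = (\<Sum>H\<in>subgroups_of_index G n. card (normalizer_cosets H))"
proof -
  let ?A = "subgroups_of_index G n" and ?R = "conjugacy_on_index G n"
  have eq: "equiv ?A ?R" by (rule equiv_conjugacy_on_index)
  have "(\<Sum>H\<in>?A. card (normalizer_cosets H)) = (\<Sum>H\<in>\<Union>(?A // ?R). card (normalizer_cosets H))"
    using Union_quotient[OF eq] by simp
  also have "\<dots> = (\<Sum>C\<in>?A // ?R. \<Sum>H\<in>C. card (normalizer_cosets H))"
    using assms(2) quotient_disj[OF eq] finite_equiv_class[OF assms(2)] eq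
    by (subst sum.Union_disjoint) (auto dest: equiv_type)
  also have "\<dots> = (\<Sum>C\<in>?A // ?R. n)"
    using sum_normalizer_cosets_conjugates[OF _ assms(1)] by (intro sum.cong) (auto elim!: quotientE)
  also have "\<dots> = n * num_subgroup_classes G n"
    by (simp add: num_subgroup_classes_def)
  finally show ?thesis by simp
qed

end

section \<open>Transport of conjugacy classes along an isomorphism\<close>

lemma iso_image_conjugate:
  assumes "group G" "group G'" "\<phi> \<in> iso G G'" "H \<subseteq> carrier G" "g \<in> carrier G"
  shows "\<phi> ` conjugate G g H = conjugate G' (\<phi> g) (\<phi> ` H)"
proof -
  interpret group_hom G G' \<phi>
    using assms by (simp add: group_hom_def group_hom_axioms_def iso_def)
  show ?thesis
    unfolding conjugate_def image_image
    by (rule image_cong[OF HOL.refl]) (use assms in \<open>simp add: subset_iff\<close>)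
qed

lemma iso_num_subgroup_classes:
  assumes G: "group G" and G': "group G'" and \<phi>: "\<phi> \<in> iso G G'"
  shows "num_subgroup_classes G n = num_subgroup_classes G' n"
  unfolding num_subgroup_classes_def
proof (rule card_quotient_eq[where Z = "\<lambda>H K. K = \<phi> ` H"])
  show "equiv (subgroups_of_index G n) (conjugacy_on_index G n)"
    "equiv (subgroups_of_index G' n) (conjugacy_on_index G' n)"
    using G G' by (simp_all add: group.equiv_conjugacy_on_index)
  show "\<exists>K\<in>subgroups_of_index G' n. K = \<phi> ` H" if "H \<in> subgroups_of_index G n" for H
    using iso_image_subgroups_of_index[OF G G' \<phi> that] by simp
  have bij: "bij_betw \<phi> (carrier G) (carrier G')"
    using \<phi> by (simp add: iso_def)
  have sub: "H \<subseteq> carrier G" if "H \<in> subgroups_of_index G n" for H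
    using that by (auto simp: subgroups_of_index_def subgroup_def)
  show "\<exists>H\<in>subgroups_of_index G n. K = \<phi> ` H" if K: "K \<in> subgroups_of_index G' n" for K
  proof
    show "inv_into (carrier G) \<phi> ` K \<in> subgroups_of_index G n"
      using iso_image_subgroups_of_index[OF G' G group.iso_set_sym[OF G \<phi>] K] .
    have "K \<subseteq> \<phi> ` carrier G"
      using K bij by (auto simp: subgroups_of_index_def subgroup_def bij_betw_def)
    then show "K = \<phi> ` inv_into (carrier G) \<phi> ` K"
      by (simp add: image_inv_into_cancel)
  qed
  fix H K H' K'
  assume *: "H \<in> subgroups_of_index G n" "H' \<in> subgroups_of_index G n"
    "K \<in> subgroups_of_index G' n" "K' \<in> subgroups_of_index G' n" "K = \<phi> ` H" "K' = \<phi> ` H'"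
  have "H' = conjugate G g H \<longleftrightarrow> K' = conjugate G' (\<phi> g) K" if g: "g \<in> carrier G" for g
  proof -
    have "K' = conjugate G' (\<phi> g) K \<longleftrightarrow> \<phi> ` H' = \<phi> ` conjugate G g H"
      using iso_image_conjugate[OF G G' \<phi> sub[OF *(1)] g] * by simp
    also have "\<dots> \<longleftrightarrow> H' = conjugate G g H"
      using bij sub * g by (intro inj_on_image_eq_iff[of _ "carrier G"])
        (auto simp: bij_betw_def group.conjugate_subset[OF G])
    finally show ?thesis by simp
  qed
  moreover have "carrier G' = \<phi> ` carrier G"
    using bij by (simp add: bij_betw_def)
  ultimately have "conjugate_sets G H H' \<longleftrightarrow> conjugate_sets G' K K'"
    by (simp add: conjugate_sets_iff)
  with * show "(H, H') \<in> conjugacy_on_index G n \<longleftrightarrow> (K, K') \<in> conjugacy_on_index G' n"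
    by simp
qed

section \<open>The group of the first amphicosm\<close>

text \<open>The sign by which conjugation with a^i acts on the powers of b, since the third relator
  says that a b a^-1 = b^-1.\<close>

definition sg :: "int \<Rightarrow> int" where
  "sg i = (if even i then 1 else - 1)"

lemma sg_simps [simp]: "sg 0 = 1" "sg 1 = - 1" "sg (- i) = sg i" "sg i * sg i = 1" "sg i * (sg i * j) = j"
  by (auto simp: sg_def)

lemma sg_add: "sg (i + j) = sg i * sg j"
  by (auto simp: sg_def)

text \<open>The triple \<open>(i, j, k)\<close> stands for \<open>b\<^sup>j a\<^sup>i c\<^sup>k\<close>.\<close>

definition amphi_group :: "(int \<times> int \<times> int) monoid" where
  "amphi_group = \<lparr>carrier = UNIV,
     mult = (\<lambda>(i, j, k) (i', j', k'). (i + i', j + sg i * j', k + k')),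
     one = (0, 0, 0)\<rparr>"

lemma amphi_group_simps [simp]:
  "carrier amphi_group = UNIV"
  "(i, j, k) \<otimes>\<^bsub>amphi_group\<^esub> (i', j', k') = (i + i', j + sg i * j', k + k')"
  "\<one>\<^bsub>amphi_group\<^esub> = (0, 0, 0)"
  by (simp_all add: amphi_group_def)

lemma amphi_is_group: "group amphi_group"
proof (rule groupI)
  fix x y z :: "int \<times> int \<times> int"
  show "x \<otimes>\<^bsub>amphi_group\<^esub> y \<otimes>\<^bsub>amphi_group\<^esub> z = x \<otimes>\<^bsub>amphi_group\<^esub> (y \<otimes>\<^bsub>amphi_group\<^esub> z)"
    by (cases x; cases y; cases z) (simp add: sg_add algebra_simps)
  show "\<exists>y\<in>carrier amphi_group. y \<otimes>\<^bsub>amphi_group\<^esub> x = \<one>\<^bsub>amphi_group\<^esub>"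
  proof (cases x)
    case (fields i j k)
    then show ?thesis by (intro bexI[of _ "(- i, - sg i * j, - k)"]) auto
  qed
qed auto

interpretation amphi: group amphi_group
  by (rule amphi_is_group)

lemma amphi_inv [simp]: "inv\<^bsub>amphi_group\<^esub> (i, j, k) = (- i, - sg i * j, - k)"
  by (rule amphi.inv_equality) auto

section \<open>Normal forms of words\<close>

lemma word_eq_cong:
  assumes "word_eq R u v"
  shows "word_eq R (x @ u @ y) (x @ v @ y)"
  using assms
proof induction
  case (cancel u g e v)
  then show ?case using word_eq.cancel[of R "x @ u" g e "v @ y"] by simp
next
  case (relator r u v)
  then show ?case using word_eq.relator[of r R "x @ u" "v @ y"] by simp
qed (auto intro: word_eq.intros)

declare word_eq.trans [trans]

text \<open>The relation x y = z x says that x conjugates y to z. The conclusions are the same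
  relation for the inverses of y and z, and for the inverse of x.\<close>

lemma word_eq_swap:
  assumes "word_eq R [(x, e), (y, f)] [(z, g), (x, e)]"
  shows "word_eq R [(x, e), (y, \<not> f)] [(z, \<not> g), (x, e)]"
    and "word_eq R [(x, \<not> e), (z, g)] [(y, f), (x, \<not> e)]"
proof -
  have "word_eq R [(x, e), (y, \<not> f)] [(z, \<not> g), (z, g), (x, e), (y, \<not> f)]"
    using word_eq.cancel[of R "[]" z "\<not> g" "[(x, e), (y, \<not> f)]"] by (auto intro: word_eq.sym)
  also have "word_eq R \<dots> [(z, \<not> g), (x, e), (y, f), (y, \<not> f)]"
    using word_eq_cong[OF word_eq.sym[OF assms], of "[(z, \<not> g)]" "[(y, \<not> f)]"] by simp
  also have "word_eq R \<dots> [(z, \<not> g), (x, e)]"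
    using word_eq.cancel[of R "[(z, \<not> g), (x, e)]" y f "[]"] by simp
  finally show "word_eq R [(x, e), (y, \<not> f)] [(z, \<not> g), (x, e)]" .
  have "word_eq R [(x, \<not> e), (z, g)] [(x, \<not> e), (z, g), (x, e), (x, \<not> e)]"
    using word_eq.cancel[of R "[(x, \<not> e), (z, g)]" x e "[]"] by (auto intro: word_eq.sym)
  also have "word_eq R \<dots> [(x, \<not> e), (x, e), (y, f), (x, \<not> e)]"
    using word_eq_cong[OF word_eq.sym[OF assms], of "[(x, \<not> e)]" "[(x, \<not> e)]"] by simp
  also have "word_eq R \<dots> [(y, f), (x, \<not> e)]"
    using word_eq.cancel[of R "[]" x "\<not> e" "[(y, f), (x, \<not> e)]"] by simp
  finally show "word_eq R [(x, \<not> e), (z, g)] [(y, f), (x, \<not> e)]" .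
qed

lemma word_eq_swap_replicate:
  assumes "word_eq R [x, y] [z, x]"
  shows "word_eq R (x # replicate m y) (replicate m z @ [x])"
proof (induction m)
  case 0
  show ?case by (auto intro: word_eq.refl)
next
  case (Suc m)
  have "word_eq R (x # replicate (Suc m) y) ([z] @ x # replicate m y)"
    using word_eq_cong[OF assms, of "[]" "replicate m y"] by simp
  also have "word_eq R \<dots> ([z] @ replicate m z @ [x])"
    using word_eq_cong[OF Suc, of "[z]" "[]"] by simp
  finally show ?case by simp
qed

definition letter_power :: "'g \<Rightarrow> int \<Rightarrow> 'g word" where
  "letter_power g n = replicate (nat \<bar>n\<bar>) (g, n \<ge> 0)"

lemma word_eq_Cons_letter_power:
  "word_eq R ((g, e) # letter_power g n) (letter_power g (if e then n + 1 else n - 1))"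
proof (cases "n = 0")
  case True
  then show ?thesis by (auto simp: letter_power_def intro: word_eq.refl)
next
  case False
  show ?thesis
  proof (cases "e \<longleftrightarrow> n \<ge> 0")
    case True
    with False have "nat \<bar>if e then n + 1 else n - 1\<bar> = Suc (nat \<bar>n\<bar>)" by auto
    with True False show ?thesis by (auto simp: letter_power_def intro: word_eq.refl)
  next
    case e: False
    with False obtain m where m: "nat \<bar>n\<bar> = Suc m" "nat \<bar>if e then n + 1 else n - 1\<bar> = m"
      by (intro that[of "nat \<bar>n\<bar> - 1"]) auto
    have "letter_power g (if e then n + 1 else n - 1) = replicate m (g, \<not> e)"
    proof (cases "m = 0")
      case True
      with m show ?thesis by (simp add: letter_power_def)
    next
      case False
      with m e show ?thesis by (auto simp: letter_power_def)
    qed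
    moreover have "letter_power g n = (g, \<not> e) # replicate m (g, \<not> e)"
      using m(1) e by (auto simp: letter_power_def)
    ultimately show ?thesis
      using word_eq.cancel[of R "[]" g e "replicate m (g, \<not> e)"] by simp
  qed
qed

lemma word_eq_swap_letter_power:
  assumes "word_eq R [(x, e), (y, True)] [(y, f), (x, e)]"
  shows "word_eq R ((x, e) # letter_power y n) (letter_power y (if f then n else - n) @ [(x, e)])"
proof -
  have "word_eq R [(x, e), (y, b)] [(y, if f then b else \<not> b), (x, e)]" for b
    using assms word_eq_swap(1)[OF assms] by (cases b; cases f) auto
  from word_eq_swap_replicate[OF this[of "n \<ge> 0"], of "nat \<bar>n\<bar>"]
  have *: "word_eq R ((x, e) # replicate (nat \<bar>n\<bar>) (y, n \<ge> 0))
      (replicate (nat \<bar>n\<bar>) (y, if f then n \<ge> 0 else \<not> n \<ge> 0) @ [(x, e)])" .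
  \<comment> \<open>At n = 0 the Boolean of \<open>letter_power y (- n)\<close> is not the negation
    of that of \<open>letter_power y n\<close>, but both words are empty.\<close>
  show ?thesis
  proof (cases "n = 0")
    case True
    then show ?thesis by (simp add: letter_power_def word_eq.refl)
  next
    case False
    then have "(- n \<ge> 0) = (\<not> n \<ge> 0)" by auto
    with * show ?thesis by (cases f) (simp_all add: letter_power_def)
  qed
qed

abbreviation amphi_relators :: "amphicosm_gen word set" where
  "amphi_relators \<equiv>
     {[(Gen_c, True), (Gen_a, True), (Gen_c, False), (Gen_a, False)],
      [(Gen_c, True), (Gen_b, True), (Gen_c, False), (Gen_b, False)],
      [(Gen_a, True), (Gen_b, True), (Gen_a, False), (Gen_b, True)]}"

text \<open>All three relators have this shape: \<open>f\<close> is \<open>True\<close> for the two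
  commutation relators and \<open>False\<close> for the one that inverts b.\<close>

lemma word_eq_relator_swap:
  assumes "[(x, True), (y, True), (x, False), (y, \<not> f)] \<in> R"
  shows "word_eq R [(x, e), (y, True)] [(y, f), (x, e)]"
proof -
  have "word_eq R [(x, True), (y, True)] [(x, True), (y, True), (x, False), (x, True)]"
    using word_eq.cancel[of R "[(x, True), (y, True)]" x False "[]"] by (auto intro: word_eq.sym)
  also have "word_eq R \<dots> [(x, True), (y, True), (x, False), (y, \<not> f), (y, f), (x, True)]"
    using word_eq.cancel[of R "[(x, True), (y, True), (x, False)]" y "\<not> f" "[(x, True)]"]
    by (auto intro: word_eq.sym)
  also have "word_eq R \<dots> [(y, f), (x, True)]"
    using word_eq.relator[OF assms, of "[]" "[(y, f), (x, True)]"] by simp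
  finally have *: "word_eq R [(x, True), (y, True)] [(y, f), (x, True)]" .
  show ?thesis
  proof (cases e)
    case False
    show ?thesis
    proof (cases f)
      case True
      with word_eq_swap(2)[OF *] False show ?thesis by simp
    next
      case f: False
      \<comment> \<open>Applied directly, the rule for the inverse of x would move the inverse of y;
        inverting y beforehand leaves y itself to be moved.\<close>
      with word_eq_swap(2)[OF word_eq_swap(1)[OF *]] False show ?thesis by simp
    qed
  qed (use * in simp)
qed

section \<open>Evaluation of words in the group of triples\<close>

fun letter_value :: "amphicosm_gen \<times> bool \<Rightarrow> int \<times> int \<times> int" where
  "letter_value (Gen_a, e) = (if e then 1 else - 1, 0, 0)"
| "letter_value (Gen_b, e) = (0, if e then 1 else - 1, 0)"
| "letter_value (Gen_c, e) = (0, 0, if e then 1 else - 1)"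

definition word_value :: "amphicosm_gen word \<Rightarrow> int \<times> int \<times> int" where
  "word_value w = foldr (\<lambda>l t. letter_value l \<otimes>\<^bsub>amphi_group\<^esub> t) w (0, 0, 0)"

lemma word_value_simps [simp]:
  "word_value [] = (0, 0, 0)"
  "word_value (l # w) = letter_value l \<otimes>\<^bsub>amphi_group\<^esub> word_value w"
  by (simp_all add: word_value_def)

lemma word_value_append: "word_value (u @ v) = word_value u \<otimes>\<^bsub>amphi_group\<^esub> word_value v"
  by (induction u) (simp_all add: amphi.m_assoc split: prod.splits)

lemma word_value_insert:
  assumes "word_value r = (0, 0, 0)"
  shows "word_value (u @ r @ v) = word_value (u @ v)"
  unfolding word_value_append using assms by (cases "word_value v") simp

fun normal_word :: "int \<times> int \<times> int \<Rightarrow> amphicosm_gen word" where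
  "normal_word (i, j, k) = letter_power Gen_b j @ letter_power Gen_a i @ letter_power Gen_c k"

text \<open>A letter is pushed to the right until it meets its own block: b is there already, a
  crosses the block of b and reverses its exponent, c crosses both blocks unchanged.\<close>

lemma word_eq_Cons_normal_word:
  "word_eq amphi_relators ((g, e) # normal_word t) (normal_word (letter_value (g, e) \<otimes>\<^bsub>amphi_group\<^esub> t))"
proof (cases t)
  case t: (fields i j k)
  let ?eq = "word_eq amphi_relators"
  have ca: "?eq ((Gen_c, e) # letter_power Gen_a i) (letter_power Gen_a i @ [(Gen_c, e)])" for i
    using word_eq_swap_letter_power[OF word_eq_relator_swap[of Gen_c Gen_a True]] by simp
  have cb: "?eq ((Gen_c, e) # letter_power Gen_b j) (letter_power Gen_b j @ [(Gen_c, e)])" for j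
    using word_eq_swap_letter_power[OF word_eq_relator_swap[of Gen_c Gen_b True]] by simp
  have ab: "?eq ((Gen_a, e) # letter_power Gen_b j) (letter_power Gen_b (- j) @ [(Gen_a, e)])" for j
    using word_eq_swap_letter_power[OF word_eq_relator_swap[of Gen_a Gen_b False]] by simp
  show ?thesis
  proof (cases g)
    case Gen_a
    have "?eq ((Gen_a, e) # normal_word t)
        (letter_power Gen_b (- j) @ ((Gen_a, e) # letter_power Gen_a i) @ letter_power Gen_c k)"
      using word_eq_cong[OF ab, of "[]"] by (simp add: t)
    also have "?eq \<dots> (letter_power Gen_b (- j) @ letter_power Gen_a (if e then i + 1 else i - 1) @ letter_power Gen_c k)"
      by (rule word_eq_cong[OF word_eq_Cons_letter_power])
    finally show ?thesis by (cases e) (simp_all add: Gen_a t sg_def add.commute)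
  next
    case Gen_b
    have "?eq ((Gen_b, e) # normal_word t)
        (letter_power Gen_b (if e then j + 1 else j - 1) @ letter_power Gen_a i @ letter_power Gen_c k)"
      using word_eq_cong[OF word_eq_Cons_letter_power[of amphi_relators Gen_b e j],
          of "[]" "letter_power Gen_a i @ letter_power Gen_c k"] by (cases e) (simp_all add: t)
    then show ?thesis by (cases e) (simp_all add: Gen_b t add.commute)
  next
    case Gen_c
    have "?eq ((Gen_c, e) # normal_word t)
        (letter_power Gen_b j @ ((Gen_c, e) # letter_power Gen_a i) @ letter_power Gen_c k)"
      using word_eq_cong[OF cb, of "[]"] by (simp add: t)
    also have "?eq \<dots> (letter_power Gen_b j @ (letter_power Gen_a i @ [(Gen_c, e)]) @ letter_power Gen_c k)"
      by (rule word_eq_cong[OF ca])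
    also have "?eq \<dots> ((letter_power Gen_b j @ letter_power Gen_a i) @ letter_power Gen_c (if e then k + 1 else k - 1))"
      using word_eq_cong[OF word_eq_Cons_letter_power, of _ "letter_power Gen_b j @ letter_power Gen_a i" Gen_c e k "[]"]
      by simp
    finally show ?thesis by (cases e) (simp_all add: Gen_c t add.commute)
  qed
qed

lemma word_eq_normal_word: "word_eq amphi_relators w (normal_word (word_value w))"
proof (induction w)
  case Nil
  show ?case by (simp add: letter_power_def word_eq.refl)
next
  case (Cons l w)
  obtain g e where l: "l = (g, e)" by (cases l)
  have "word_eq amphi_relators (l # w) (l # normal_word (word_value w))"
    using word_eq_cong[OF Cons, of "[l]" "[]"] by simp
  also have "word_eq amphi_relators \<dots> (normal_word (word_value (l # w)))"
    using word_eq_Cons_normal_word by (simp add: l)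
  finally show ?case .
qed

lemma word_value_eq:
  assumes "word_eq amphi_relators u v"
  shows "word_value u = word_value v"
  using assms
proof induction
  case (cancel u g e v)
  have "word_value [(g, e), (g, \<not> e)] = (0, 0, 0)"
    by (cases g) (auto simp: sg_def)
  from word_value_insert[OF this] show ?case by simp
next
  case (relator r u v)
  then have "word_value r = (0, 0, 0)"
    by (auto simp: sg_def)
  from word_value_insert[OF this] show ?case by simp
qed simp_all

text \<open>Words of equal value have a common normal form; conversely, relators and cancelling
  pairs have value 1, so the value is an invariant.\<close>

lemma word_eq_iff_word_value: "word_eq amphi_relators u v \<longleftrightarrow> word_value u = word_value v"
proof
  assume "word_value u = word_value v"
  then show "word_eq amphi_relators u v"
    using word_eq_normal_word[of u] word_eq.sym[OF word_eq_normal_word[of v]]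
    by (auto intro: word_eq.trans)
qed (rule word_value_eq)

lemma word_value_letter_power:
  "word_value (letter_power Gen_a n) = (n, 0, 0)"
  "word_value (letter_power Gen_b n) = (0, n, 0)"
  "word_value (letter_power Gen_c n) = (0, 0, n)"
proof -
  have "word_value (replicate m (Gen_a, e)) = (if e then int m else - int m, 0, 0)"
    "word_value (replicate m (Gen_b, e)) = (0, if e then int m else - int m, 0)"
    "word_value (replicate m (Gen_c, e)) = (0, 0, if e then int m else - int m)" for m e
    by (induction m) auto
  then show "word_value (letter_power Gen_a n) = (n, 0, 0)"
    "word_value (letter_power Gen_b n) = (0, n, 0)"
    "word_value (letter_power Gen_c n) = (0, 0, n)"
    by (auto simp: letter_power_def)
qed

lemma word_value_normal_word: "word_value (normal_word t) = t"
  by (cases t) (simp add: word_value_append word_value_letter_power)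

text \<open>The classes of words are the fibres of \<open>word_value\<close>, so a triple is sent to
  its fibre. That the presented structure is a group is then inherited along this bijection.\<close>

lemma amphi_group_iso: "(\<lambda>t. {w. word_value w = t}) \<in> iso amphi_group pi1_first_amphicosm"
    (is "?h \<in> _")
  and pi1_first_amphicosm_is_group: "group pi1_first_amphicosm"
proof -
  have wc: "word_class amphi_relators w = ?h (word_value w)" for w
    by (auto simp: word_class_def word_eq_iff_word_value)
  have ne: "normal_word t \<in> ?h t" for t
    by (simp add: word_value_normal_word)
  have h: "?h t = word_class amphi_relators (normal_word t)" for t
    by (simp add: wc word_value_normal_word)
  show iso: "?h \<in> iso amphi_group pi1_first_amphicosm"
  proof (rule isoI)
    show "?h \<in> hom amphi_group pi1_first_amphicosm"
    proof (rule homI)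
      fix s t
      show "?h s \<in> carrier pi1_first_amphicosm"
        unfolding h by (simp add: pi1_first_amphicosm_def presented_group_def)
      have "?h s \<otimes>\<^bsub>pi1_first_amphicosm\<^esub> ?h t =
          (\<Union>u\<in>?h s. \<Union>v\<in>?h t. word_class amphi_relators (u @ v))"
        by (simp add: pi1_first_amphicosm_def presented_group_def)
      also have "\<dots> = (\<Union>u\<in>?h s. \<Union>v\<in>?h t. ?h (s \<otimes>\<^bsub>amphi_group\<^esub> t))"
        by (intro SUP_cong HOL.refl) (simp only: wc word_value_append mem_Collect_eq)
      also have "\<dots> = ?h (s \<otimes>\<^bsub>amphi_group\<^esub> t)"
        using ne[of s] ne[of t] by blast
      finally show "?h (s \<otimes>\<^bsub>amphi_group\<^esub> t) = ?h s \<otimes>\<^bsub>pi1_first_amphicosm\<^esub> ?h t" by simp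
    qed
    have "inj ?h"
    proof (rule injI)
      fix s t assume "?h s = ?h t"
      with ne[of s] show "s = t" by (simp add: word_value_normal_word)
    qed
    moreover have "range ?h = carrier pi1_first_amphicosm"
    proof -
      have "range ?h = range (word_class amphi_relators)"
      proof (intro equalityI image_subsetI)
        show "?h t \<in> range (word_class amphi_relators)" for t
          unfolding h by (rule rangeI)
        show "word_class amphi_relators w \<in> range ?h" for w
          unfolding wc by (rule rangeI)
      qed
      then show ?thesis by (simp add: pi1_first_amphicosm_def presented_group_def)
    qed
    ultimately show "bij_betw ?h (carrier amphi_group) (carrier pi1_first_amphicosm)"
      by (simp add: bij_betw_def)
  qed
  have "?h \<one>\<^bsub>amphi_group\<^esub> = \<one>\<^bsub>pi1_first_amphicosm\<^esub>"
    by (simp add: pi1_first_amphicosm_def presented_group_def wc)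
  then show "group pi1_first_amphicosm"
    using amphi.iso_imp_img_group[OF iso] by simp
qed

lemma num_subgroup_classes_pi1_first_amphicosm:
  "num_subgroup_classes pi1_first_amphicosm n = num_subgroup_classes amphi_group n"
  using iso_num_subgroup_classes[OF amphi_is_group pi1_first_amphicosm_is_group amphi_group_iso] by simp

section \<open>Subgroups of finite index\<close>

text \<open>The generator is the least positive element: a remainder modulo it lies in S again and
  is smaller.\<close>

lemma int_subgroup_eq_multiples:
  fixes S :: "int set"
  assumes diff: "\<And>x y. x \<in> S \<Longrightarrow> y \<in> S \<Longrightarrow> x - y \<in> S" and pos: "\<exists>x\<in>S. x > 0"
  obtains d where "d > 0" "S = {x. d dvd x}"
proof -
  define n where "n = (LEAST n. n > 0 \<and> int n \<in> S)"
  obtain m where "m > 0 \<and> int m \<in> S"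
    using pos by (metis pos_int_cases of_nat_0_less_iff)
  then have n: "n > 0 \<and> int n \<in> S"
    unfolding n_def by (rule LeastI)
  have zero: "0 \<in> S" using diff n by fastforce
  have neg: "- x \<in> S" if "x \<in> S" for x
    using diff[OF zero that] by simp
  have add: "x + y \<in> S" if "x \<in> S" "y \<in> S" for x y
    using diff[OF that(1) neg[OF that(2)]] by simp
  have mult: "k * int n \<in> S" for k
  proof (induction k rule: int_induct[of _ 0])
    case (step1 i)
    then have "i * int n + int n \<in> S" using add n by blast
    then show ?case by (simp add: distrib_right)
  next
    case (step2 i)
    then have "i * int n - int n \<in> S" using diff n by blast
    then show ?case by (simp add: left_diff_distrib)
  qed (use zero in simp)
  have "int n dvd x" if "x \<in> S" for x
  proof -
    have "x - (x div int n) * int n \<in> S" using diff[OF that mult] .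
    then have mem: "int (nat (x mod int n)) \<in> S" using n by (simp add: minus_div_mult_eq_mod)
    have "\<not> nat (x mod int n) > 0"
    proof
      assume "nat (x mod int n) > 0"
      with mem have "n \<le> nat (x mod int n)" unfolding n_def by (intro Least_le conjI)
      moreover have "x mod int n < int n" using n by simp
      ultimately show False using n by linarith
    qed
    moreover have "x mod int n \<ge> 0" using n by simp
    ultimately show ?thesis by (simp add: dvd_eq_mod_eq_0)
  qed
  moreover have "x \<in> S" if dvd: "int n dvd x" for x
  proof -
    obtain k where "x = int n * k" using dvd by (rule dvdE)
    then show ?thesis using mult[of k] by (simp add: mult.commute)
  qed
  ultimately have "S = {x. int n dvd x}" by blast
  then show ?thesis using that[of "int n"] n by simp
qed

section \<open>Subgroups in Hermite normal form\<close>

text \<open>The second coordinate of \<open>(p, \<alpha>, r)\<^sup>x\<close>.\<close>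

definition power_offset :: "int \<Rightarrow> int \<Rightarrow> int \<Rightarrow> int" where
  "power_offset p \<alpha> x = (if even p then x * \<alpha> else if odd x then \<alpha> else 0)"

lemma power_offset_0 [simp]: "power_offset p \<alpha> 0 = 0"
  and power_offset_1 [simp]: "power_offset p \<alpha> 1 = \<alpha>"
  by (simp_all add: power_offset_def)

text \<open>This is the cocycle identity that the product of triples imposes on the second
  coordinates of powers.\<close>

lemma power_offset_add: "power_offset p \<alpha> (x + y) = power_offset p \<alpha> x + sg (p * x) * power_offset p \<alpha> y"
  by (auto simp: power_offset_def sg_def algebra_simps)

lemma power_offset_minus: "power_offset p \<alpha> (- x) = - sg (p * x) * power_offset p \<alpha> x"
  by (auto simp: power_offset_def sg_def)

text \<open>
  The set \<open>hermite_subgroup p q s r \<alpha> \<gamma>\<close> consists of the products of powers of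
  \<open>(p, \<alpha>, r)\<close>, \<open>(0, \<gamma>, q)\<close> and \<open>(0, s, 0)\<close>; this is a Hermite normal form.
\<close>

definition hermite_subgroup :: "int \<Rightarrow> int \<Rightarrow> int \<Rightarrow> int \<Rightarrow> int \<Rightarrow> int \<Rightarrow> (int \<times> int \<times> int) set" where
  "hermite_subgroup p q s r \<alpha> \<gamma> =
     {(p * x, j, r * x + q * y) | x y j. s dvd j - power_offset p \<alpha> x - y * \<gamma>}"

text \<open>The condition for odd p is forced: multiplying \<open>(p, \<alpha>, r)\<close> and
  \<open>(0, \<gamma>, q)\<close> in both orders gives second coordinates that differ by 2 \<gamma>,
  while the other coordinates agree. For even p the two products coincide.\<close>

locale hermite =
  fixes p q s r \<alpha> \<gamma> :: int
  assumes pos: "p > 0" "q > 0" "s > 0"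
    and odd_p: "odd p \<Longrightarrow> s dvd 2 * \<gamma>"
begin

abbreviation "H \<equiv> hermite_subgroup p q s r \<alpha> \<gamma>"

text \<open>As p and q are nonzero, x and y are determined by the outer coordinates, so the
  existential quantifiers disappear and membership is one congruence modulo s.\<close>

lemma mem_iff: "(p * x, j, r * x + q * y) \<in> H \<longleftrightarrow> s dvd j - power_offset p \<alpha> x - y * \<gamma>"
  using pos by (auto simp: hermite_subgroup_def)

lemma memE:
  assumes "g \<in> H"
  obtains x y j where "g = (p * x, j, r * x + q * y)" "s dvd j - power_offset p \<alpha> x - y * \<gamma>"
  using assms by (auto simp: hermite_subgroup_def)

text \<open>Multiplication may reverse the sign of a multiple of \<gamma>; modulo s this change is
  invisible.\<close>

lemma sg_dvd: "s dvd (sg (p * x) - 1) * \<gamma>"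
  using odd_p by (cases "even (p * x)") (auto simp: sg_def)

lemma subgroup: "subgroup H amphi_group"
proof (rule amphi.subgroupI)
  have "(p * 0, 0, r * 0 + q * 0) \<in> H" unfolding mem_iff by simp
  then show "H \<noteq> {}" by blast
next
  fix g h assume "g \<in> H" "h \<in> H"
  then obtain x y j x' y' j' where g: "g = (p * x, j, r * x + q * y)" "s dvd j - power_offset p \<alpha> x - y * \<gamma>"
    and h: "h = (p * x', j', r * x' + q * y')" "s dvd j' - power_offset p \<alpha> x' - y' * \<gamma>"
    by (elim memE) blast
  have "j + sg (p * x) * j' - power_offset p \<alpha> (x + x') - (y + y') * \<gamma> =
      (j - power_offset p \<alpha> x - y * \<gamma>) + sg (p * x) * (j' - power_offset p \<alpha> x' - y' * \<gamma>)
      + y' * ((sg (p * x) - 1) * \<gamma>)"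
    unfolding power_offset_add by (simp add: algebra_simps)
  also have "s dvd \<dots>"
    by (rule dvd_add[OF dvd_add[OF g(2) dvd_mult[OF h(2)]] dvd_mult[OF sg_dvd]])
  finally show "g \<otimes>\<^bsub>amphi_group\<^esub> h \<in> H"
    using mem_iff[of "x + x'" "j + sg (p * x) * j'" "y + y'"] by (simp add: g(1) h(1) algebra_simps)
next
  fix g assume "g \<in> H"
  then obtain x y j where g: "g = (p * x, j, r * x + q * y)" "s dvd j - power_offset p \<alpha> x - y * \<gamma>"
    by (elim memE) blast
  have "- sg (p * x) * j - power_offset p \<alpha> (- x) - (- y) * \<gamma> =
      - sg (p * x) * (j - power_offset p \<alpha> x - y * \<gamma>) - y * ((sg (p * x) - 1) * \<gamma>)"
    by (simp add: power_offset_minus algebra_simps)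
  also have "s dvd \<dots>" by (rule dvd_diff[OF dvd_mult[OF g(2)] dvd_mult[OF sg_dvd]])
  finally show "inv\<^bsub>amphi_group\<^esub> g \<in> H"
    using mem_iff[of "- x" "- sg (p * x) * j" "- y"] by (simp add: g(1) algebra_simps)
qed simp

lemma generator_mem: "(p, \<alpha>, r) \<in> H" "(0, \<gamma>, q) \<in> H" "(0, s, 0) \<in> H"
  using mem_iff[of 1 \<alpha> 0] mem_iff[of 0 \<gamma> 1] mem_iff[of 0 s 0] by simp_all

text \<open>A box of coset representatives; its p s q points give the index.\<close>

definition reps :: "(int \<times> int \<times> int) set" where
  "reps = {0..<p} \<times> {0..<s} \<times> {0..<q}"

lemma r_coset_eq_iff:
  "H #>\<^bsub>amphi_group\<^esub> (i, j, k) = H #>\<^bsub>amphi_group\<^esub> (i', j', k') \<longleftrightarrow>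
     (i - i', j - sg (i - i') * j', k - k') \<in> H"
proof -
  have "sg i * sg i' = sg (i - i')" by (auto simp: sg_def)
  then show ?thesis
    by (subst amphi.r_coset_eq_iff[OF subgroup]) (simp_all add: mult.assoc[symmetric])
qed

lemma inj_on_reps: "inj_on (\<lambda>x. H #>\<^bsub>amphi_group\<^esub> x) reps"
proof (rule inj_onI)
  fix x x' assume x: "x \<in> reps" "x' \<in> reps" and eq: "H #>\<^bsub>amphi_group\<^esub> x = H #>\<^bsub>amphi_group\<^esub> x'"
  obtain i j k i' j' k' where [simp]: "x = (i, j, k)" "x' = (i', j', k')"
    by (cases x; cases x')
  have lt: "\<bar>i - i'\<bar> < p" "\<bar>j - j'\<bar> < s" "\<bar>k - k'\<bar> < q"
    using x by (auto simp: reps_def)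
  have mem: "(i - i', j - sg (i - i') * j', k - k') \<in> H"
    using eq by (simp add: r_coset_eq_iff)
  then obtain a b where ab: "i - i' = p * a" "k - k' = r * a + q * b"
      "s dvd j - sg (i - i') * j' - power_offset p \<alpha> a - b * \<gamma>"
    by (elim memE) auto
  have "p dvd i - i'" using ab(1) by simp
  then have i: "i = i'" using zdvd_imp_le[of p "\<bar>i - i'\<bar>"] lt(1) by (cases "i = i'") auto
  with ab pos have a: "a = 0" by simp
  then have "q dvd k - k'" using ab(2) by simp
  then have k: "k = k'" using zdvd_imp_le[of q "\<bar>k - k'\<bar>"] lt(3) by (cases "k = k'") auto
  with a ab pos have "b = 0" by simp
  then have "s dvd j - j'" using ab(3) a i by simp
  then have "j = j'" using zdvd_imp_le[of s "\<bar>j - j'\<bar>"] lt(2) by (cases "j = j'") auto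
  with i k show "x = x'" by simp
qed

lemma ex_rep: "\<exists>x\<in>reps. H #>\<^bsub>amphi_group\<^esub> g = H #>\<^bsub>amphi_group\<^esub> x"
proof -
  obtain i j k where g: "g = (i, j, k)" by (cases g)
  define a where "a = i div p"
  define b where "b = (k - r * a) div q"
  \<comment> \<open>The sign appears because right division by \<open>(i mod p, d, _)\<close>
    subtracts \<open>sg (p * a) * d\<close> from the second coordinate, not d.\<close>
  define d where "d = sg (p * a) * (j - power_offset p \<alpha> a - b * \<gamma>) mod s"
  have i: "i - i mod p = p * a" and k: "k - (k - r * a) mod q = r * a + q * b"
    using div_mult_mod_eq[of i p] div_mult_mod_eq[of "k - r * a" q] by (simp_all add: a_def b_def algebra_simps)
  have "s dvd sg (p * a) * (j - power_offset p \<alpha> a - b * \<gamma>) - d"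
    by (simp add: d_def)
  then have "s dvd sg (p * a) * (sg (p * a) * (j - power_offset p \<alpha> a - b * \<gamma>) - d)"
    by (rule dvd_mult)
  also have "sg (p * a) * (sg (p * a) * (j - power_offset p \<alpha> a - b * \<gamma>) - d) =
      (j - sg (p * a) * d) - power_offset p \<alpha> a - b * \<gamma>"
    by (simp add: right_diff_distrib)
  finally have "(p * a, j - sg (p * a) * d, r * a + q * b) \<in> H"
    by (simp add: mem_iff)
  then have "H #>\<^bsub>amphi_group\<^esub> g = H #>\<^bsub>amphi_group\<^esub> (i mod p, d, (k - r * a) mod q)"
    unfolding g r_coset_eq_iff i k .
  moreover have "(i mod p, d, (k - r * a) mod q) \<in> reps"
    using pos by (simp add: reps_def d_def)
  ultimately show ?thesis by blast
qed

lemma rcosets_eq: "rcosets\<^bsub>amphi_group\<^esub> H = (\<lambda>x. H #>\<^bsub>amphi_group\<^esub> x) ` reps"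
proof -
  have "H #>\<^bsub>amphi_group\<^esub> g \<in> (\<lambda>x. H #>\<^bsub>amphi_group\<^esub> x) ` reps" for g
    using ex_rep[of g] by blast
  then show ?thesis by (auto simp: RCOSETS_def)
qed

lemma card_rcosets: "finite (rcosets\<^bsub>amphi_group\<^esub> H)" "card (rcosets\<^bsub>amphi_group\<^esub> H) = nat p * nat s * nat q"
  unfolding rcosets_eq card_image[OF inj_on_reps] by (simp_all add: reps_def card_cartesian_product)

text \<open>Conjugation preserves the outer coordinates, so only the congruence for the second one
  can fail. The two conditions say that the images of \<open>(0, \<gamma>, q)\<close> and
  \<open>(p, \<alpha>, r)\<close> stay in H; \<kappa> is absent because c is central.\<close>

lemma conjugate_eq_iff:
  "conjugate amphi_group (w, \<delta>, \<kappa>) H = H \<longleftrightarrow>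
     s dvd (sg w - 1) * \<gamma> \<and> s dvd \<delta> * (1 - sg p) + (sg w - 1) * \<alpha>"
proof -
  define cj where "cj = (\<lambda>h. (w, \<delta>, \<kappa>) \<otimes>\<^bsub>amphi_group\<^esub> h \<otimes>\<^bsub>amphi_group\<^esub> inv\<^bsub>amphi_group\<^esub> (w, \<delta>, \<kappa>))"
  have cj: "cj (i, j, k) = (i, \<delta> * (1 - sg i) + sg w * j, k)" for i j k
  proof -
    have "sg (w + i) * sg w = sg i" by (auto simp: sg_def)
    then show ?thesis by (simp add: cj_def algebra_simps)
  qed
  have conj: "conjugate amphi_group (w, \<delta>, \<kappa>) H = cj ` H"
    by (simp add: conjugate_def cj_def)
  show ?thesis
  proof
    assume "conjugate amphi_group (w, \<delta>, \<kappa>) H = H"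
    then have "cj (0, \<gamma>, q) \<in> H" "cj (p, \<alpha>, r) \<in> H"
      using generator_mem conj by blast+
    then show "s dvd (sg w - 1) * \<gamma> \<and> s dvd \<delta> * (1 - sg p) + (sg w - 1) * \<alpha>"
      using mem_iff[of 0 "sg w * \<gamma>" 1] mem_iff[of 1 "\<delta> * (1 - sg p) + sg w * \<alpha>" 0]
      by (simp add: cj algebra_simps)
  next
    assume cond: "s dvd (sg w - 1) * \<gamma> \<and> s dvd \<delta> * (1 - sg p) + (sg w - 1) * \<alpha>"
    \<comment> \<open>The condition on the generator passes to its powers: for even p the expression
      is linear in x, for odd p it depends on the parity of x only.\<close>
    have *: "s dvd \<delta> * (1 - sg (p * x)) + (sg w - 1) * power_offset p \<alpha> x" for x
    proof (cases "even p")
      case True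
      then have "\<delta> * (1 - sg (p * x)) + (sg w - 1) * power_offset p \<alpha> x =
          x * (\<delta> * (1 - sg p) + (sg w - 1) * \<alpha>)"
        by (simp add: power_offset_def sg_def algebra_simps)
      then show ?thesis using cond by simp
    next
      case False
      then show ?thesis using cond by (cases "even x") (auto simp: power_offset_def sg_def)
    qed
    have unit: "s dvd sg w * z \<longleftrightarrow> s dvd z" for z by (simp add: sg_def)
    have iff: "cj h \<in> H \<longleftrightarrow> h \<in> H" for h
    proof -
      obtain i j k where h: "h = (i, j, k)" by (cases h)
      show ?thesis
      proof (cases "\<exists>x y. i = p * x \<and> k = r * x + q * y")
        case True
        then obtain x y where [simp]: "i = p * x" "k = r * x + q * y" by blast
        let ?E = "(\<delta> * (1 - sg (p * x)) + (sg w - 1) * power_offset p \<alpha> x) + y * ((sg w - 1) * \<gamma>)"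
        have "s dvd ?E" by (rule dvd_add[OF * dvd_mult]) (use cond in blast)
        have "cj h \<in> H \<longleftrightarrow> s dvd \<delta> * (1 - sg (p * x)) + sg w * j - power_offset p \<alpha> x - y * \<gamma>"
          by (simp add: h cj mem_iff)
        also have "\<delta> * (1 - sg (p * x)) + sg w * j - power_offset p \<alpha> x - y * \<gamma> =
            sg w * (j - power_offset p \<alpha> x - y * \<gamma>) + ?E"
          by (simp add: algebra_simps)
        also have "s dvd \<dots> \<longleftrightarrow> s dvd j - power_offset p \<alpha> x - y * \<gamma>"
          unfolding dvd_add_left_iff[OF \<open>s dvd ?E\<close>] by (rule unit)
        also have "\<dots> \<longleftrightarrow> h \<in> H" by (simp add: h mem_iff)
        finally show ?thesis .
      next
        case False
        then show ?thesis by (auto simp: h cj hermite_subgroup_def)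
      qed
    qed
    show "conjugate amphi_group (w, \<delta>, \<kappa>) H = H"
      unfolding conj
    proof (intro equalityI subsetI)
      fix h assume "h \<in> cj ` H"
      then show "h \<in> H" using iff by blast
    next
      fix h assume h: "h \<in> H"
      obtain i j k where ijk: "h = (i, j, k)" by (cases h)
      \<comment> \<open>The preimage is explicit because \<open>sg w\<close> is its own
        inverse.\<close>
      have "cj (i, sg w * (j - \<delta> * (1 - sg i)), k) = h"
        by (simp add: cj ijk)
      with h iff show "h \<in> cj ` H" by (metis image_eqI)
    qed
  qed
qed

text \<open>Elements of H normalize H, so whether x normalizes H depends on its coset alone and can
  be tested on the representative in the box.\<close>

lemma normalizer_cosets_eq:
  "amphi.normalizer_cosets H =
     (\<lambda>x. H #>\<^bsub>amphi_group\<^esub> x) ` {x \<in> reps. conjugate amphi_group x H = H}"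
proof (intro equalityI subsetI)
  fix X assume "X \<in> amphi.normalizer_cosets H"
  then obtain x where x: "X = H #>\<^bsub>amphi_group\<^esub> x" "conjugate amphi_group x H = H"
    by (auto simp: amphi.normalizer_cosets_def)
  obtain y where y: "y \<in> reps" "H #>\<^bsub>amphi_group\<^esub> x = H #>\<^bsub>amphi_group\<^esub> y"
    using ex_rep by blast
  have "y \<otimes>\<^bsub>amphi_group\<^esub> inv\<^bsub>amphi_group\<^esub> x \<in> H"
    using y(2) amphi.r_coset_eq_iff[OF subgroup, of y x] by simp
  from amphi.conjugate_self[OF subgroup this]
  have "conjugate amphi_group (y \<otimes>\<^bsub>amphi_group\<^esub> inv\<^bsub>amphi_group\<^esub> x) (conjugate amphi_group x H) = H"
    by (simp only: x(2))
  then have "conjugate amphi_group y H = H"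
    by (subst (asm) amphi.conjugate_mult) (simp_all add: amphi.m_assoc del: amphi_group_simps(2,3))
  with x y show "X \<in> (\<lambda>x. H #>\<^bsub>amphi_group\<^esub> x) ` {x \<in> reps. conjugate amphi_group x H = H}"
    by blast
qed (auto simp: amphi.normalizer_cosets_def)

lemma card_normalizer_cosets:
  "card (amphi.normalizer_cosets H) = card {(w, \<delta>, \<kappa>). (w, \<delta>, \<kappa>) \<in> reps \<and>
     s dvd (sg w - 1) * \<gamma> \<and> s dvd \<delta> * (1 - sg p) + (sg w - 1) * \<alpha>}"
proof -
  have "{x \<in> reps. conjugate amphi_group x H = H} = {(w, \<delta>, \<kappa>). (w, \<delta>, \<kappa>) \<in> reps \<and>
     s dvd (sg w - 1) * \<gamma> \<and> s dvd \<delta> * (1 - sg p) + (sg w - 1) * \<alpha>}"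
    using conjugate_eq_iff by auto
  then show ?thesis
    unfolding normalizer_cosets_eq
    by (subst card_image) (auto intro: inj_on_subset[OF inj_on_reps])
qed

end

section \<open>Existence and uniqueness of the normal form\<close>

text \<open>Pigeonhole on finitely many cosets. The assumption on f holds for the powers of each of
  the three generators.\<close>

lemma ex_power_mem:
  fixes f :: "nat \<Rightarrow> int \<times> int \<times> int"
  assumes K: "subgroup K amphi_group" and fin: "finite (rcosets\<^bsub>amphi_group\<^esub> K)"
    and f: "\<And>m n. m < n \<Longrightarrow> f n \<otimes>\<^bsub>amphi_group\<^esub> inv\<^bsub>amphi_group\<^esub> f m = f (n - m)"
  shows "\<exists>m>0. f m \<in> K"
proof -
  have "range (\<lambda>n. K #>\<^bsub>amphi_group\<^esub> f n) \<subseteq> rcosets\<^bsub>amphi_group\<^esub> K"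
    by (auto simp: RCOSETS_def)
  then have "\<not> inj (\<lambda>n. K #>\<^bsub>amphi_group\<^esub> f n)"
    using fin by (meson finite_imageD infinite_UNIV_nat finite_subset)
  then obtain m n where "m < n" "K #>\<^bsub>amphi_group\<^esub> f n = K #>\<^bsub>amphi_group\<^esub> f m"
    unfolding inj_def by (metis nat_neq_iff)
  then have "f (n - m) \<in> K"
    using amphi.r_coset_eq_iff[OF K, of "f n" "f m"] f by simp
  with \<open>m < n\<close> show ?thesis by (intro exI[of _ "n - m"]) simp
qed

text \<open>The second coordinates of the elements with i = k = 0, the third coordinates of those
  with i = 0, and all first coordinates form subgroups of the integers. Their positive generators
  are s, q and p; elements of K over q and p supply \<gamma>, \<alpha> and r.\<close>

lemma ex_hermite:
  assumes K: "subgroup K amphi_group" and fin: "finite (rcosets\<^bsub>amphi_group\<^esub> K)"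
  obtains p q s r \<alpha> \<gamma> where "hermite p q s \<gamma>" "0 \<le> r" "r < q" "0 \<le> \<alpha>" "\<alpha> < s" "0 \<le> \<gamma>" "\<gamma> < s"
    "K = hermite_subgroup p q s r \<alpha> \<gamma>"
proof -
  have mult: "(i + i', j + sg i * j', k + k') \<in> K" if "(i, j, k) \<in> K" "(i', j', k') \<in> K" for i j k i' j' k'
    using subgroup.m_closed[OF K that] by simp
  have div: "(i - i', j - sg (i - i') * j', k - k') \<in> K" if "(i, j, k) \<in> K" "(i', j', k') \<in> K" for i j k i' j' k'
  proof -
    have "sg i * sg i' = sg (i - i')" by (auto simp: sg_def)
    then show ?thesis
      using subgroup.m_closed[OF K that(1) subgroup.m_inv_closed[OF K that(2)]]
      by (simp add: mult.assoc[symmetric])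
  qed
  obtain s where s: "s > 0" "{j. (0, j, 0) \<in> K} = {j. s dvd j}"
  proof (rule int_subgroup_eq_multiples[of "{j. (0, j, 0) \<in> K}"])
    obtain m where "m > 0" "(0, int m, 0) \<in> K"
      using ex_power_mem[OF K fin, of "\<lambda>n. (0, int n, 0)"] by auto
    then show "\<exists>j\<in>{j. (0, j, 0) \<in> K}. j > 0" by (intro bexI[of _ "int m"]) auto
  qed (use div in fastforce)
  obtain q where q: "q > 0" "{k. \<exists>j. (0, j, k) \<in> K} = {k. q dvd k}"
  proof (rule int_subgroup_eq_multiples[of "{k. \<exists>j. (0, j, k) \<in> K}"])
    obtain m where "m > 0" "(0, 0, int m) \<in> K"
      using ex_power_mem[OF K fin, of "\<lambda>n. (0, 0, int n)"] by auto
    then show "\<exists>k\<in>{k. \<exists>j. (0, j, k) \<in> K}. k > 0" by (intro bexI[of _ "int m"]) auto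
  qed (use div in fastforce)
  obtain p where p: "p > 0" "{i. \<exists>j k. (i, j, k) \<in> K} = {i. p dvd i}"
  proof (rule int_subgroup_eq_multiples[of "{i. \<exists>j k. (i, j, k) \<in> K}"])
    obtain m where "m > 0" "(int m, 0, 0) \<in> K"
      using ex_power_mem[OF K fin, of "\<lambda>n. (int n, 0, 0)"] by auto
    then show "\<exists>i\<in>{i. \<exists>j k. (i, j, k) \<in> K}. i > 0" by (intro bexI[of _ "int m"]) auto
  qed (use div in blast)
  have sK: "(0, j, 0) \<in> K \<longleftrightarrow> s dvd j" for j using s(2) by blast
  have qK: "(\<exists>j. (0, j, k) \<in> K) \<longleftrightarrow> q dvd k" for k using q(2) by blast
  have pK: "(\<exists>j k. (i, j, k) \<in> K) \<longleftrightarrow> p dvd i" for i using p(2) by blast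
  have shift: "(i, j', k) \<in> K" if "(i, j, k) \<in> K" "s dvd j' - j" for i j j' k
    using mult[OF iffD2[OF sK that(2)] that(1)] by simp
  obtain \<gamma> where \<gamma>: "0 \<le> \<gamma>" "\<gamma> < s" "(0, \<gamma>, q) \<in> K"
  proof -
    obtain j where "(0, j, q) \<in> K" using qK[of q] by auto
    then have "(0, j mod s, q) \<in> K" by (rule shift) (simp add: mod_eq_dvd_iff[symmetric])
    then show thesis using s(1) by (intro that) simp_all
  qed
  have \<gamma>_power: "(0, y * \<gamma>, y * q) \<in> K" for y
  proof (induction y rule: int_induct[of _ 0])
    case base
    show ?case using sK by simp
  next
    case (step1 y)
    then show ?case using mult[OF _ \<gamma>(3)] by (fastforce simp: distrib_right)
  next
    case (step2 y)
    then show ?case using div[OF _ \<gamma>(3)] by (fastforce simp: left_diff_distrib)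
  qed
  obtain \<alpha> r where \<alpha>: "0 \<le> \<alpha>" "\<alpha> < s" "0 \<le> r" "r < q" "(p, \<alpha>, r) \<in> K"
  proof -
    obtain j k where jk: "(p, j, k) \<in> K" using pK[of p] by auto
    \<comment> \<open>The third coordinate is reduced modulo q first, since this disturbs the
      second; the reduction modulo s that follows leaves the third one alone.\<close>
    have "(p, - (k div q) * \<gamma> + j, k mod q) \<in> K"
      using mult[OF \<gamma>_power[of "- (k div q)"] jk] minus_mult_div_eq_mod[of k q]
      by (simp add: algebra_simps)
    then have "(p, (- (k div q) * \<gamma> + j) mod s, k mod q) \<in> K"
      by (rule shift) (simp add: mod_eq_dvd_iff[symmetric])
    then show thesis using s(1) q(1) by (intro that) simp_all
  qed
  have \<alpha>_power: "(p * x, power_offset p \<alpha> x, r * x) \<in> K" for x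
  proof (induction x rule: int_induct[of _ 0])
    case base
    show ?case using sK by simp
  next
    case (step1 x)
    have "power_offset p \<alpha> (x + 1) = power_offset p \<alpha> x + sg (p * x) * \<alpha>"
      using power_offset_add[of p \<alpha> x 1] by simp
    then show ?case using mult[OF step1(2) \<alpha>(5)] by (simp add: distrib_left)
  next
    case (step2 x)
    have "power_offset p \<alpha> (x - 1) = power_offset p \<alpha> x - sg (p * x - p) * \<alpha>"
      by (auto simp: power_offset_def sg_def algebra_simps)
    then show ?case using div[OF step2(2) \<alpha>(5)] by (simp add: right_diff_distrib)
  qed
  have odd_p: "s dvd 2 * \<gamma>" if "odd p"
  proof -
    have "(p, \<alpha> - \<gamma>, r + q) \<in> K" "(p, \<alpha> + \<gamma>, r + q) \<in> K"
      using mult[OF \<alpha>(5) \<gamma>(3)] mult[OF \<gamma>(3) \<alpha>(5)] that by (simp_all add: sg_def add.commute)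
    from div[OF this(2,1)] show ?thesis by (simp add: sK)
  qed
  interpret hermite p q s r \<alpha> \<gamma>
    using p(1) q(1) s(1) odd_p by unfold_locales auto
  have "K = H"
  proof (intro equalityI subsetI)
    fix g assume "g \<in> H"
    then obtain x y j where g: "g = (p * x, j, r * x + q * y)" "s dvd j - power_offset p \<alpha> x - y * \<gamma>"
      by (elim memE) blast
    have "(p * x, y * \<gamma> + power_offset p \<alpha> x, r * x + q * y) \<in> K"
      using mult[OF \<gamma>_power[of y] \<alpha>_power[of x]] by (simp add: algebra_simps)
    then show "g \<in> K" unfolding g(1) by (rule shift) (use g(2) in \<open>simp add: algebra_simps\<close>)
  next
    fix g assume g: "g \<in> K"
    obtain i j k where ijk: "g = (i, j, k)" by (cases g)
    with g pK obtain x where x: "i = p * x" by blast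
    \<comment> \<open>Removing a power of \<open>(p, \<alpha>, r)\<close> and then one of
      \<open>(0, \<gamma>, q)\<close> leaves an element of K on the middle axis, where membership
      means divisibility by s.\<close>
    have 1: "(0, j - power_offset p \<alpha> x, k - r * x) \<in> K"
      using div[OF _ \<alpha>_power[of x], of i j k] g by (simp add: ijk x)
    with qK obtain y where "k - r * x = q * y" by blast
    then have k: "k = r * x + q * y" by simp
    have "(0, j - power_offset p \<alpha> x - y * \<gamma>, 0) \<in> K"
      using div[OF 1 \<gamma>_power[of y]] by (simp add: k algebra_simps)
    then show "g \<in> H" by (simp add: ijk x k mem_iff sK)
  qed
  with that \<alpha> \<gamma> show thesis by (blast intro: hermite_axioms)
qed

lemma dvd_diff_less_eq:
  fixes a b d :: int
  assumes "d dvd a - b" "0 \<le> a" "a < d" "0 \<le> b" "b < d"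
  shows "a = b"
  using assms zdvd_imp_le[of d "\<bar>a - b\<bar>"] by (cases "a = b") auto

text \<open>The generators of the smaller subgroup are expressed through the larger one. The offsets
  can be compared only once the exponents are known, which explains the staged hypotheses;
  inclusions in both directions give uniqueness.\<close>

lemma hermite_subgroup_dvd:
  assumes "hermite p q s \<gamma>" "hermite p' q' s' \<gamma>'"
    and sub: "hermite_subgroup p q s r \<alpha> \<gamma> \<subseteq> hermite_subgroup p' q' s' r' \<alpha>' \<gamma>'"
  shows "p' dvd p" "q' dvd q" "s' dvd s"
    "q = q' \<Longrightarrow> s' dvd \<gamma> - \<gamma>'"
    "p = p' \<Longrightarrow> q' dvd r - r'"
    "p = p' \<Longrightarrow> r = r' \<Longrightarrow> s' dvd \<alpha> - \<alpha>'"
proof -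
  interpret A: hermite p q s r \<alpha> \<gamma> by fact
  interpret B: hermite p' q' s' r' \<alpha>' \<gamma>' by fact
  have "(p, \<alpha>, r) \<in> B.H" "(0, \<gamma>, q) \<in> B.H" "(0, s, 0) \<in> B.H"
    using A.generator_mem sub by blast+
  note B = B.memE[OF this(1)] B.memE[OF this(2)] B.memE[OF this(3)]
  obtain x y where 1: "p = p' * x" "r = r' * x + q' * y" "s' dvd \<alpha> - power_offset p' \<alpha>' x - y * \<gamma>'"
    by (rule B(1)) auto
  obtain z where 2: "q = q' * z" "s' dvd \<gamma> - z * \<gamma>'"
    by (rule B(2)) (use B.pos in auto)
  obtain t where 3: "s' dvd s - t * \<gamma>'" "t = 0"
    by (rule B(3)) (use B.pos in auto)
  show "p' dvd p" "q' dvd q" "s' dvd s" using 1 2 3 by simp_all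
  show "s' dvd \<gamma> - \<gamma>'" if "q = q'" using 2 that B.pos by simp
  have x: "x = 1" if "p = p'" using 1 that B.pos by simp
  then show "q' dvd r - r'" if "p = p'" using 1 that by simp
  show "s' dvd \<alpha> - \<alpha>'" if "p = p'" "r = r'" using 1 x that B.pos by simp
qed

text \<open>The reduced offsets (r, \<alpha>, \<gamma>) that are admissible for the diagonal (q, p,
  s).\<close>

definition hermite_offsets :: "nat \<times> nat \<times> nat \<Rightarrow> (int \<times> int \<times> int) set" where
  "hermite_offsets = (\<lambda>(q, p, s). {0..<int q} \<times> {0..<int s} \<times> {\<gamma>\<in>{0..<int s}. odd p \<longrightarrow> int s dvd 2 * \<gamma>})"

lemma finite_hermite_offsets: "finite (hermite_offsets t)"
proof (cases t)
  case (fields q p s)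
  then have "hermite_offsets t \<subseteq> {0..<int q} \<times> {0..<int s} \<times> {0..<int s}"
    by (auto simp: hermite_offsets_def)
  then show ?thesis by (rule finite_subset) simp
qed

text \<open>Surjectivity is \<open>ex_hermite\<close>. For injectivity the divisibilities in both
  directions give the diagonal, and congruent reduced offsets are equal.\<close>

lemma bij_betw_hermite_subgroup:
  assumes "n > 0"
  shows "bij_betw (\<lambda>((q, p, s), (r, \<alpha>, \<gamma>)). hermite_subgroup (int p) (int q) (int s) r \<alpha> \<gamma>)
    (SIGMA t : {(q, p, s). q * p * s = n}. hermite_offsets t) (subgroups_of_index amphi_group n)"
    (is "bij_betw ?f ?A ?B")
  unfolding bij_betw_def
proof
  have hermite: "hermite (int p) (int q) (int s) \<gamma>"
    if "((q, p, s), (r, \<alpha>, \<gamma>)) \<in> ?A" for q p s r \<alpha> \<gamma>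
    using that assms by (auto simp: hermite_def hermite_offsets_def intro: Nat.gr0I)
  show "inj_on ?f ?A"
  proof (rule inj_onI)
    fix a b assume ab: "a \<in> ?A" "b \<in> ?A" and eq: "?f a = ?f b"
    obtain q p s r \<alpha> \<gamma> where a: "a = ((q, p, s), (r, \<alpha>, \<gamma>))" by (metis prod.exhaust)
    obtain q' p' s' r' \<alpha>' \<gamma>' where b: "b = ((q', p', s'), (r', \<alpha>', \<gamma>'))" by (metis prod.exhaust)
    have ha: "hermite (int p) (int q) (int s) \<gamma>" using hermite ab(1) unfolding a .
    have hb: "hermite (int p') (int q') (int s') \<gamma>'" using hermite ab(2) unfolding b .
    have sub: "hermite_subgroup (int p) (int q) (int s) r \<alpha> \<gamma> \<subseteq> hermite_subgroup (int p') (int q') (int s') r' \<alpha>' \<gamma>'"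
      "hermite_subgroup (int p') (int q') (int s') r' \<alpha>' \<gamma>' \<subseteq> hermite_subgroup (int p) (int q) (int s) r \<alpha> \<gamma>"
      using eq by (simp_all add: a b)
    note 1 = hermite_subgroup_dvd[OF ha hb sub(1)] and 2 = hermite_subgroup_dvd[OF hb ha sub(2)]
    have pqs: "p = p'" "q = q'" "s = s'" using 1(1-3) 2(1-3) by (auto intro: dvd_antisym)
    moreover have "r = r'" "\<gamma> = \<gamma>'"
      using 1(4,5) ab pqs by (auto simp: a b hermite_offsets_def intro!: dvd_diff_less_eq)
    moreover have "\<alpha> = \<alpha>'"
      using 1(6) ab pqs \<open>r = r'\<close> by (auto simp: a b hermite_offsets_def intro!: dvd_diff_less_eq)
    ultimately show "a = b" by (simp add: a b)
  qed
  show "?f ` ?A = ?B"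
  proof (intro equalityI subsetI)
    fix K assume "K \<in> ?f ` ?A"
    then obtain q p s r \<alpha> \<gamma> where *: "((q, p, s), (r, \<alpha>, \<gamma>)) \<in> ?A"
      and K: "K = hermite_subgroup (int p) (int q) (int s) r \<alpha> \<gamma>" by auto
    interpret hermite "int p" "int q" "int s" r \<alpha> \<gamma> using hermite[OF *] .
    show "K \<in> ?B"
      using * subgroup card_rcosets by (auto simp: K subgroups_of_index_def mult_ac)
  next
    fix K assume "K \<in> ?B"
    then have K: "subgroup K amphi_group" "finite (rcosets\<^bsub>amphi_group\<^esub> K)" "card (rcosets\<^bsub>amphi_group\<^esub> K) = n"
      by (auto simp: subgroups_of_index_def)
    then obtain p q s r \<alpha> \<gamma> where *: "hermite p q s \<gamma>" "0 \<le> r" "r < q" "0 \<le> \<alpha>" "\<alpha> < s" "0 \<le> \<gamma>" "\<gamma> < s"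
      "K = hermite_subgroup p q s r \<alpha> \<gamma>" by (elim ex_hermite)
    interpret hermite p q s r \<alpha> \<gamma> by fact
    have "nat q * nat p * nat s = n" using card_rcosets K *(8) by (simp add: mult_ac)
    then have "((nat q, nat p, nat s), (r, \<alpha>, \<gamma>)) \<in> ?A"
      using * pos odd_p by (auto simp: hermite_offsets_def even_nat_iff)
    moreover have "K = ?f ((nat q, nat p, nat s), (r, \<alpha>, \<gamma>))"
      using *(8) pos by simp
    ultimately show "K \<in> ?f ` ?A" by blast
  qed
qed

section \<open>Counting cosets in the normalizers\<close>

lemma card_even_less:
  "card {w\<in>{0..<int p}. even w} = (p + 1) div 2" "card {w\<in>{0..<int p}. odd w} = p div 2"
proof -
  have "{w\<in>{0..<int p}. even w} = (\<lambda>v. 2 * int v) ` {..<(p + 1) div 2}"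
  proof (intro equalityI subsetI)
    fix w assume w: "w \<in> {w\<in>{0..<int p}. even w}"
    then have "w = 2 * int (nat (w div 2))" "nat (w div 2) < (p + 1) div 2" by auto
    then show "w \<in> (\<lambda>v. 2 * int v) ` {..<(p + 1) div 2}" by blast
  qed auto
  then show "card {w\<in>{0..<int p}. even w} = (p + 1) div 2"
    by (simp add: card_image inj_on_def)
  have "{w\<in>{0..<int p}. odd w} = (\<lambda>v. 2 * int v + 1) ` {..<p div 2}"
  proof (intro equalityI subsetI)
    fix w assume w: "w \<in> {w\<in>{0..<int p}. odd w}"
    then have "w = 2 * int (nat (w div 2)) + 1" "nat (w div 2) < p div 2"
      by (simp_all add: nat_less_iff) presburger
    then show "w \<in> (\<lambda>v. 2 * int v + 1) ` {..<p div 2}" by blast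
  qed auto
  then show "card {w\<in>{0..<int p}. odd w} = p div 2"
    by (simp add: card_image inj_on_def)
qed

text \<open>The solutions are 0 and, for even s, also s/2.\<close>

lemma card_two_torsion:
  assumes "s > 0"
  shows "card {a\<in>{0..<int s}. int s dvd 2 * a} = gcd 2 s"
proof (cases "even s")
  case True
  then obtain t where t: "s = 2 * t" by (elim evenE)
  have "{a\<in>{0..<int s}. int s dvd 2 * a} = {0, int t}"
  proof (intro equalityI subsetI)
    fix a assume a: "a \<in> {a\<in>{0..<int s}. int s dvd 2 * a}"
    then obtain k where k: "a = int t * k" by (auto simp: t)
    with a assms have "0 \<le> k" "k < 2"
      by (auto simp: t zero_le_mult_iff mult.commute[of 2])
    with k show "a \<in> {0, int t}" by (cases "k = 0") auto
  qed (use assms in \<open>auto simp: t\<close>)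
  then show ?thesis using assms by (simp add: t)
next
  case False
  have "a = 0" if "int s dvd 2 * a" "0 \<le> a" "a < int s" for a
  proof -
    have "int s dvd a" using that(1) False by (simp add: coprime_dvd_mult_right_iff)
    then show ?thesis using dvd_diff_less_eq[of "int s" a 0] that by simp
  qed
  then have "{a\<in>{0..<int s}. int s dvd 2 * a} = {0}" using assms by auto
  moreover have "gcd 2 s = 1" using False by (simp add: coprime_iff_gcd_eq_1[symmetric])
  ultimately show ?thesis by simp
qed

text \<open>Translation by b modulo s reduces the inhomogeneous congruence to the homogeneous
  one.\<close>

lemma card_two_torsion_translate:
  assumes "s > 0"
  shows "card {a\<in>{0..<int s}. int s dvd 2 * a - 2 * b} = gcd 2 s"
proof -
  have key: "int s dvd 2 * (z mod int s) - c \<longleftrightarrow> int s dvd 2 * z - c" for z c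
  proof -
    have "2 * z - c = (2 * (z mod int s) - c) + int s * (2 * (z div int s))"
      using mult_div_mod_eq[of "int s" z] by linarith
    then show ?thesis by (simp only: dvd_add_left_iff[OF dvd_triv_left])
  qed
  have "bij_betw (\<lambda>a. (a - b) mod int s) {a\<in>{0..<int s}. int s dvd 2 * a - 2 * b} {a\<in>{0..<int s}. int s dvd 2 * a}"
  proof (rule bij_betw_byWitness[of _ "\<lambda>a. (a + b) mod int s"])
    show "\<forall>a\<in>{a\<in>{0..<int s}. int s dvd 2 * a - 2 * b}. ((a - b) mod int s + b) mod int s = a"
      by (intro ballI) (simp only: mod_add_left_eq diff_add_cancel, simp)
    show "\<forall>a\<in>{a\<in>{0..<int s}. int s dvd 2 * a}. ((a + b) mod int s - b) mod int s = a"
      by (intro ballI) (simp only: mod_diff_left_eq add_diff_cancel_right', simp)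
    show "(\<lambda>a. (a - b) mod int s) ` {a\<in>{0..<int s}. int s dvd 2 * a - 2 * b} \<subseteq> {a\<in>{0..<int s}. int s dvd 2 * a}"
    proof (rule image_subsetI)
      fix a assume "a \<in> {a\<in>{0..<int s}. int s dvd 2 * a - 2 * b}"
      then have "int s dvd 2 * (a - b) - 0" by (simp only: mem_Collect_eq right_diff_distrib diff_zero)
      with key have "int s dvd 2 * ((a - b) mod int s) - 0" by blast
      then show "(a - b) mod int s \<in> {a\<in>{0..<int s}. int s dvd 2 * a}" using assms by simp
    qed
    show "(\<lambda>a. (a + b) mod int s) ` {a\<in>{0..<int s}. int s dvd 2 * a} \<subseteq> {a\<in>{0..<int s}. int s dvd 2 * a - 2 * b}"
    proof (rule image_subsetI)
      fix a assume "a \<in> {a\<in>{0..<int s}. int s dvd 2 * a}"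
      then have "int s dvd 2 * (a + b) - 2 * b" by (simp only: mem_Collect_eq distrib_left add_diff_cancel_right')
      with key have "int s dvd 2 * ((a + b) mod int s) - 2 * b" by blast
      then show "(a + b) mod int s \<in> {a\<in>{0..<int s}. int s dvd 2 * a - 2 * b}" using assms by simp
    qed
  qed
  from bij_betw_same_card[OF this] show ?thesis using card_two_torsion[OF assms] by simp
qed

text \<open>Let w be the first coordinate of the normalizing element. For even p its second
  coordinate \<delta> is free; even w is unconstrained, and odd w requires that s divides 2 \<gamma>
  and 2 \<alpha>. For odd p the condition on \<gamma> holds anyway, and each w leaves gcd 2 s values
  of \<delta>. The third coordinate is always free.\<close>

lemma card_normalizer_cosets_hermite:
  assumes "hermite (int p) (int q) (int s) \<gamma>"
  shows "card (amphi.normalizer_cosets (hermite_subgroup (int p) (int q) (int s) r \<alpha> \<gamma>)) =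
    (if even p then p div 2 * s * q + (if int s dvd 2 * \<gamma> \<and> int s dvd 2 * \<alpha> then p div 2 * s * q else 0)
     else p * gcd 2 s * q)"
proof -
  interpret hermite "int p" "int q" "int s" r \<alpha> \<gamma> by fact
  have s: "s > 0" using pos by simp
  let ?C = "{(w, \<delta>, \<kappa>). (w, \<delta>, \<kappa>) \<in> reps \<and>
     int s dvd (sg w - 1) * \<gamma> \<and> int s dvd \<delta> * (1 - sg (int p)) + (sg w - 1) * \<alpha>}"
  show ?thesis
  proof (cases "even p")
    case True
    define E where "E = {w\<in>{0..<int p}. even w}"
    define F where "F = {w\<in>{0..<int p}. odd w}"
    have card: "card E = p div 2" "card F = p div 2"
      unfolding E_def F_def card_even_less using True by auto
    have "E \<subseteq> {0..<int p}" "F \<subseteq> {0..<int p}" "E \<inter> F = {}"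
      by (auto simp: E_def F_def)
    then have EF: "finite E" "finite F" "E \<inter> F = {}"
      using finite_atLeastLessThan_int finite_subset by blast+
    note EF = EF card
    let ?SQ = "{0..<int s} \<times> {0..<int q}"
    let ?c = "int s dvd 2 * \<gamma> \<and> int s dvd 2 * \<alpha>"
    have "?C = E \<times> ?SQ \<union> (if ?c then F \<times> ?SQ else {})"
      using True by (auto simp: reps_def sg_def E_def F_def split: if_splits)
    also have "card \<dots> = card (E \<times> ?SQ) + card (if ?c then F \<times> ?SQ else {})"
      using EF by (intro card_Un_disjoint) auto
    finally show ?thesis
      using True EF by (simp add: card_normalizer_cosets card_cartesian_product)
  next
    case False
    \<comment> \<open>The congruence for \<delta> given w: the term with \<alpha> is present only if
      w reflects.\<close>
    define D where "D = (\<lambda>w::int. {\<delta>\<in>{0..<int s}. int s dvd 2 * \<delta> - 2 * (if even w then 0 else \<alpha>)})"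
    have D: "finite (D w)" "card (D w) = gcd 2 s" for w :: int
    proof -
      have "D w \<subseteq> {0..<int s}" by (auto simp: D_def)
      then show "finite (D w)" by (rule finite_subset) simp
      show "card (D w) = gcd 2 s" unfolding D_def by (rule card_two_torsion_translate[OF s])
    qed
    have "?C = (SIGMA w:{0..<int p}. D w \<times> {0..<int q})"
      using False odd_p by (auto simp: D_def reps_def sg_def algebra_simps split: if_splits)
    also have "card \<dots> = p * (gcd 2 s * q)"
      using D by (subst card_SigmaI) (simp_all add: card_cartesian_product)
    finally show ?thesis using False by (simp add: card_normalizer_cosets mult_ac)
  qed
qed

text \<open>For even p all s^2 pairs (\<alpha>, \<gamma>) count for even w, but only the (gcd 2 s)^2
  pairs of 2-torsion for odd w. For odd p, \<gamma> is restricted to 2-torsion and \<alpha> is free.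
  One factor q stems from r and the other from the normalizing element.\<close>

lemma sum_card_normalizer_cosets:
  assumes "n > 0"
  shows "(\<Sum>H\<in>subgroups_of_index amphi_group n. card (amphi.normalizer_cosets H)) =
    (\<Sum>(q, p, s) | q * p * s = n. q ^ 2 *
         ((if even p then p div 2 * s ^ 3 else 0) + (if even p then p div 2 else p) * s * (gcd 2 s) ^ 2))"
proof -
  let ?A = "{(q, p, s). q * p * s = n}"
  let ?h = "\<lambda>((q, p, s), (r, \<alpha>, \<gamma>)). hermite_subgroup (int p) (int q) (int s) r \<alpha> \<gamma>"
  have pos: "q > 0 \<and> p > 0 \<and> s > 0" if "(q, p, s) \<in> ?A" for q p s
    using that assms by (auto intro: Nat.gr0I)
  have finA: "finite ?A"
  proof (rule finite_subset)
    show "?A \<subseteq> {..n} \<times> {..n} \<times> {..n}"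
      using assms by (auto simp: Suc_leI)
  qed simp
  note finB = finite_hermite_offsets
  have "(\<Sum>H\<in>subgroups_of_index amphi_group n. card (amphi.normalizer_cosets H)) =
      (\<Sum>x\<in>(SIGMA t : ?A. hermite_offsets t). card (amphi.normalizer_cosets (?h x)))"
    by (rule sum.reindex_bij_betw[OF bij_betw_hermite_subgroup[OF assms], symmetric])
  also have "\<dots> = (\<Sum>t\<in>?A. \<Sum>v\<in>hermite_offsets t. card (amphi.normalizer_cosets (?h (t, v))))"
    using finA finB by (simp add: sum.Sigma case_prod_unfold)
  also have "\<dots> = (\<Sum>(q, p, s)\<in>?A. q ^ 2 *
         ((if even p then p div 2 * s ^ 3 else 0) + (if even p then p div 2 else p) * s * (gcd 2 s) ^ 2))"
  proof (rule sum.cong[OF HOL.refl])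
    fix t assume t: "t \<in> ?A"
    obtain q p s where t_eq: "t = (q, p, s)" by (cases t)
    have s: "s > 0" "p > 0" "q > 0" using pos t by (simp_all add: t_eq)
    let ?S = "{0..<int s}"
    define G where "G = {a\<in>?S. int s dvd 2 * a}"
    have G: "finite G" "card G = gcd 2 s"
    proof -
      have "G \<subseteq> ?S" by (auto simp: G_def)
      then show "finite G" by (rule finite_subset) simp
      show "card G = gcd 2 s" unfolding G_def by (rule card_two_torsion[OF s(1)])
    qed
    have "card (amphi.normalizer_cosets (?h (t, (r, \<alpha>, \<gamma>)))) =
        (if even p then p div 2 * s * q + (if int s dvd 2 * \<gamma> \<and> int s dvd 2 * \<alpha> then p div 2 * s * q else 0)
        else p * gcd 2 s * q)" if "(r, \<alpha>, \<gamma>) \<in> hermite_offsets t" for r \<alpha> \<gamma>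
    proof -
      have "hermite (int p) (int q) (int s) \<gamma>"
        using that s by (auto simp: hermite_def hermite_offsets_def t_eq)
      then show ?thesis by (simp add: t_eq card_normalizer_cosets_hermite)
    qed
    then have "(\<Sum>v\<in>hermite_offsets t. card (amphi.normalizer_cosets (?h (t, v)))) =
      (\<Sum>(r, \<alpha>, \<gamma>)\<in>hermite_offsets t.
        (if even p then p div 2 * s * q + (if int s dvd 2 * \<gamma> \<and> int s dvd 2 * \<alpha> then p div 2 * s * q else 0)
        else p * gcd 2 s * q))"
      by (intro sum.cong) auto
    also have "\<dots> = q ^ 2 * ((if even p then p div 2 * s ^ 3 else 0) + (if even p then p div 2 else p) * s * (gcd 2 s) ^ 2)"
    proof (cases "even p")
      case True
      have off: "hermite_offsets t = {0..<int q} \<times> ?S \<times> ?S"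
        using True by (auto simp: hermite_offsets_def t_eq)
      have "(\<Sum>(r, \<alpha>, \<gamma>)\<in>{0..<int q} \<times> ?S \<times> ?S. if int s dvd 2 * \<gamma> \<and> int s dvd 2 * \<alpha> then p div 2 * s * q else 0) =
          (\<Sum>x\<in>{0..<int q} \<times> G \<times> G. p div 2 * s * q)"
        by (rule sum.mono_neutral_cong_right) (auto simp: G_def split: if_splits)
      also have "\<dots> = q * gcd 2 s ^ 2 * (p div 2 * s * q)"
        using s by (simp add: card_cartesian_product G power2_eq_square)
      finally show ?thesis
        using True unfolding off
        by (simp add: case_prod_unfold sum.distrib card_cartesian_product algebra_simps power2_eq_square power3_eq_cube)
    next
      case False
      then have "hermite_offsets t = {0..<int q} \<times> ?S \<times> G"
        by (auto simp: hermite_offsets_def t_eq G_def)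
      with False s show ?thesis
        by (simp add: case_prod_unfold card_cartesian_product G power2_eq_square)
    qed
    finally show "(\<Sum>v\<in>hermite_offsets t. card (amphi.normalizer_cosets (?h (t, v)))) =
        (case t of (q, p, s) \<Rightarrow> q ^ 2 * ((if even p then p div 2 * s ^ 3 else 0) +
          (if even p then p div 2 else p) * s * (gcd 2 s) ^ 2))"
      by (simp add: t_eq)
  qed
  finally show ?thesis .
qed

lemma finite_subgroups_of_index_amphi_group:
  assumes "n > 0"
  shows "finite (subgroups_of_index amphi_group n)"
proof -
  have "finite {(q, p, s). q * p * s = n}"
  proof (rule finite_subset)
    show "{(q, p, s). q * p * s = n} \<subseteq> {..n} \<times> {..n} \<times> {..n}"
      using assms by (auto simp: Suc_leI)
  qed simp
  then have "finite (SIGMA t : {(q, p, s). q * p * s = n}. hermite_offsets t)"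
    by (rule finite_SigmaI) (rule finite_hermite_offsets)
  then show ?thesis using bij_betw_finite[OF bij_betw_hermite_subgroup[OF assms]] by simp
qed

section \<open>Covering maps\<close>

definition evenly_covered :: "'a topology \<Rightarrow> ('a \<Rightarrow> 'b) \<Rightarrow> 'b topology \<Rightarrow> 'b set \<Rightarrow> bool" where
  "evenly_covered N p M T \<longleftrightarrow> openin M T \<and>
     (\<exists>\<V>. \<Union>\<V> = {y \<in> topspace N. p y \<in> T} \<and> (\<forall>V\<in>\<V>. openin N V) \<and> pairwise disjnt \<V> \<and>
        (\<forall>V\<in>\<V>. homeomorphic_map (subtopology N V) (subtopology M T) p))"

lemma covering_map_evenly_covered:
  assumes "covering_map N p M" "x \<in> topspace M"
  obtains T where "x \<in> T" "evenly_covered N p M T"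
proof -
  have "\<exists>T. x \<in> T \<and> evenly_covered N p M T"
    using assms unfolding covering_map_def evenly_covered_def by blast
  with that show thesis by blast
qed

lemma covering_map_continuous: "covering_map N p M \<Longrightarrow> continuous_map N M p"
  by (simp add: covering_map_def)

text \<open>Over an evenly covered set two lifts agree near x if their values at x lie in the same
  sheet, and differ near x otherwise; so agreement is an open and closed condition.\<close>

lemma covering_map_unique_lift:
  assumes cov: "covering_map N p M"
    and f: "continuous_map X N f" and g: "continuous_map X N g"
    and pfg: "\<And>x. x \<in> topspace X \<Longrightarrow> p (f x) = p (g x)"
    and conn: "connected_space X" and a: "a \<in> topspace X" "f a = g a"
    and x: "x \<in> topspace X"
  shows "f x = g x"
proof -
  let ?A = "{x \<in> topspace X. f x = g x}" and ?B = "{x \<in> topspace X. f x \<noteq> g x}"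
  have f_top: "f x \<in> topspace N" and g_top: "g x \<in> topspace N" if "x \<in> topspace X" for x
    using f g that by (auto dest: continuous_map_funspace)
  have local: "\<exists>U. openin X U \<and> x \<in> U \<and> (U \<subseteq> ?A \<or> U \<subseteq> ?B)" if x: "x \<in> topspace X" for x
  proof -
    have "p (f x) \<in> topspace M"
      using covering_map_continuous[OF cov] f_top[OF x] by (auto dest: continuous_map_funspace)
    then obtain T where T: "p (f x) \<in> T" "evenly_covered N p M T"
      using cov by (rule_tac covering_map_evenly_covered)
    then obtain \<V> where \<V>: "\<Union>\<V> = {y \<in> topspace N. p y \<in> T}" "\<forall>V\<in>\<V>. openin N V"
      "pairwise disjnt \<V>" "\<forall>V\<in>\<V>. homeomorphic_map (subtopology N V) (subtopology M T) p"
      by (auto simp: evenly_covered_def)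
    have inj: "inj_on p V" if "V \<in> \<V>" for V
    proof -
      have "V \<subseteq> topspace N" using \<V>(2) that by (auto dest: openin_subset)
      moreover have "inj_on p (topspace (subtopology N V))"
        using \<V>(4) that by (blast dest: homeomorphic_imp_injective_map)
      ultimately show ?thesis by (simp add: Int_absorb1)
    qed
    have "f x \<in> \<Union>\<V>" "g x \<in> \<Union>\<V>"
      using \<V>(1) f_top g_top x T pfg by auto
    then obtain V W where VW: "V \<in> \<V>" "f x \<in> V" "W \<in> \<V>" "g x \<in> W" by blast
    define U where "U = {z \<in> topspace X. f z \<in> V} \<inter> {z \<in> topspace X. g z \<in> W}"
    have U: "openin X U" "x \<in> U"
      unfolding U_def using VW \<V>(2) f g x by (auto intro!: openin_Int openin_continuous_map_preimage)
    show ?thesis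
    proof (cases "V = W")
      case True
      then have "U \<subseteq> ?A"
        using inj[OF VW(1)] pfg by (auto simp: U_def dest: inj_onD)
      with U show ?thesis by blast
    next
      case False
      then have "disjnt V W" using \<V>(3) VW by (auto simp: pairwise_def)
      then have "U \<subseteq> ?B" by (auto simp: U_def disjnt_iff)
      with U show ?thesis by blast
    qed
  qed
  have "openin X ?A" "openin X ?B"
    unfolding openin_subopen[of X ?A] openin_subopen[of X ?B] using local by fastforce+
  moreover have "topspace X \<subseteq> ?A \<union> ?B" "?A \<inter> ?B = {}" by auto
  moreover have "?A \<noteq> {}" using a by blast
  ultimately have "?B = {}" using conn unfolding connected_space_def by blast
  with x show ?thesis by blast
qed

text \<open>The section is the inverse of p on the sheet through y.\<close>

lemma evenly_covered_section:
  assumes T: "evenly_covered N p M T" and y: "y \<in> topspace N" "p y \<in> T"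
  obtains s where "continuous_map (subtopology M T) N s" "\<And>x. x \<in> T \<Longrightarrow> p (s x) = x" "s (p y) = y"
proof -
  obtain \<V> where \<V>: "\<Union>\<V> = {y \<in> topspace N. p y \<in> T}" "\<forall>V\<in>\<V>. openin N V"
    "\<forall>V\<in>\<V>. homeomorphic_map (subtopology N V) (subtopology M T) p"
    using T by (auto simp: evenly_covered_def)
  then obtain V where V: "V \<in> \<V>" "y \<in> V" using y by blast
  then obtain s where s: "homeomorphic_maps (subtopology N V) (subtopology M T) p s"
    using \<V>(3) homeomorphic_map_maps by blast
  have "T \<subseteq> topspace M" using T by (auto simp: evenly_covered_def dest: openin_subset)
  then have "continuous_map (subtopology M T) N s" "\<And>x. x \<in> T \<Longrightarrow> p (s x) = x" "s (p y) = y"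
    using s V y by (auto simp: homeomorphic_maps_def continuous_map_in_subtopology)
  then show thesis by (rule that)
qed

section \<open>Quotients of Euclidean spaces by discrete groups of isometries\<close>

text \<open>The projection is described by its properties instead of M being an orbit space by
  definition, because the first amphicosm is given as a product. Discreteness is uniform in the
  point, so balls of radius 1/2 embed in the quotient by any subgroup.\<close>

locale deck_group = group G for G (structure) +
  fixes act :: "'a \<Rightarrow> 'v::euclidean_space \<Rightarrow> 'v" and M :: "'m topology" and \<pi> :: "'v \<Rightarrow> 'm"
  assumes act_mult: "\<lbrakk>g \<in> carrier G; h \<in> carrier G\<rbrakk> \<Longrightarrow> act (g \<otimes> h) u = act g (act h u)"
    and act_one: "act \<one> u = u"
    and act_dist: "g \<in> carrier G \<Longrightarrow> dist (act g u) (act g v) = dist u v"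
    and act_discrete: "\<lbrakk>g \<in> carrier G; dist (act g u) u < 1\<rbrakk> \<Longrightarrow> g = \<one>"
    and pi_continuous: "continuous_map euclidean M \<pi>"
    and pi_open: "open_map euclidean M \<pi>"
    and pi_surj: "range \<pi> = topspace M"
    and pi_eq_iff: "\<pi> u = \<pi> v \<longleftrightarrow> (\<exists>g\<in>carrier G. v = act g u)"
    and cocompact: "\<exists>K. compact K \<and> (\<forall>u. \<exists>g\<in>carrier G. act g u \<in> K)"
begin

lemma act_inv [simp]:
  assumes "g \<in> carrier G"
  shows "act (inv g) (act g u) = u" "act g (act (inv g) u) = u"
  using assms act_mult[of "inv g" g u] act_mult[of g "inv g" u] by (simp_all add: act_one)

lemma pi_act: "g \<in> carrier G \<Longrightarrow> \<pi> (act g u) = \<pi> u"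
  using pi_eq_iff[of u "act g u"] by auto

lemma act_ball: "g \<in> carrier G \<Longrightarrow> act g ` ball u r = ball (act g u) r"
proof (intro equalityI subsetI)
  fix v assume g: "g \<in> carrier G" and "v \<in> ball (act g u) r"
  then have "act (inv g) v \<in> ball u r"
    using act_dist[OF g, of u "act (inv g) v"] by simp
  then show "v \<in> act g ` ball u r" using g by (metis act_inv(2) image_eqI)
qed (auto simp: act_dist)

lemma act_continuous: "g \<in> carrier G \<Longrightarrow> continuous_map euclidean euclidean (act g)"
  by (auto simp: continuous_on_iff act_dist)

lemma act_free:
  assumes "g \<in> carrier G" "h \<in> carrier G" "dist (act g u) (act h u) < 1"
  shows "g = h"
proof -
  have "dist (act (inv h \<otimes> g) u) u < 1"
    using assms act_dist[of "inv h" "act g u" "act h u"] by (simp add: act_mult)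
  then have "inv h \<otimes> g = \<one>" using assms by (intro act_discrete) auto
  then show ?thesis using assms by (metis inv_equality inv_inv inv_closed)
qed

lemma pi_topspace: "\<pi> u \<in> topspace M"
  using pi_surj by blast

text \<open>A Lebesgue number for the compact set K serves everywhere: elements of G move any ball
  to one centred in K, and \<open>\<pi>\<close> does not notice.\<close>

lemma uniform_evenly_covered:
  assumes cov: "covering_map N p M"
  obtains \<epsilon> where "\<epsilon> > 0" "\<And>v. \<exists>T. evenly_covered N p M T \<and> \<pi> ` ball v \<epsilon> \<subseteq> T"
proof -
  obtain K where K: "compact K" "\<And>u. \<exists>g\<in>carrier G. act g u \<in> K"
    using cocompact by blast
  have "\<exists>T. \<pi> v \<in> T \<and> evenly_covered N p M T" for v
    using covering_map_evenly_covered[OF cov pi_topspace] by metis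
  then obtain T where T: "\<And>v. \<pi> v \<in> T v" "\<And>v. evenly_covered N p M (T v)" by metis
  have open_T: "open {u. \<pi> u \<in> T v}" for v
    using openin_continuous_map_preimage[OF pi_continuous, of "T v"] T(2)[of v]
    by (simp add: evenly_covered_def)
  obtain \<epsilon> where \<epsilon>: "\<epsilon> > 0" "\<And>v. v \<in> K \<Longrightarrow> \<exists>U\<in>range (\<lambda>v. {u. \<pi> u \<in> T v}). ball v \<epsilon> \<subseteq> U"
  proof (rule Heine_Borel_lemma[OF K(1)])
    show "K \<subseteq> \<Union>(range (\<lambda>v. {u. \<pi> u \<in> T v}))" using T(1) by blast
    show "open X" if "X \<in> range (\<lambda>v. {u. \<pi> u \<in> T v})" for X
      using that open_T by blast
  qed blast
  have "\<exists>T. evenly_covered N p M T \<and> \<pi> ` ball v \<epsilon> \<subseteq> T" for v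
  proof -
    obtain g where g: "g \<in> carrier G" "act g v \<in> K" using K by blast
    then obtain w where "ball (act g v) \<epsilon> \<subseteq> {u. \<pi> u \<in> T w}" using \<epsilon>(2) by blast
    then have "\<pi> ` act g ` ball v \<epsilon> \<subseteq> T w" using act_ball[OF g(1)] by blast
    then have "\<pi> ` ball v \<epsilon> \<subseteq> T w" using pi_act[OF g(1)] by (simp add: image_image)
    with T(2) show ?thesis by blast
  qed
  with \<epsilon>(1) show thesis by (rule that)
qed

definition lifts :: "'c topology \<Rightarrow> ('c \<Rightarrow> 'm) \<Rightarrow> ('v \<Rightarrow> 'c) set" where
  "lifts N p = {g. continuous_map euclidean N g \<and> (\<forall>u. p (g u) = \<pi> u)}"

text \<open>The local lift is a section composed with \<open>\<pi>\<close>. It is chosen once, as a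
  function of the centre v and the prescribed value y, so that different local lifts can be compared
  by uniqueness.\<close>

lemma local_lift_exists:
  assumes cov: "covering_map N p M"
  obtains \<epsilon> s where "\<epsilon> > 0"
    "\<And>v y. \<lbrakk>y \<in> topspace N; p y = \<pi> v\<rbrakk> \<Longrightarrow> continuous_map (top_of_set (ball v \<epsilon>)) N (s v y)"
    "\<And>v y u. \<lbrakk>y \<in> topspace N; p y = \<pi> v; u \<in> ball v \<epsilon>\<rbrakk> \<Longrightarrow> p (s v y u) = \<pi> u"
    "\<And>v y. \<lbrakk>y \<in> topspace N; p y = \<pi> v\<rbrakk> \<Longrightarrow> s v y v = y"
proof -
  obtain \<epsilon> where \<epsilon>: "\<epsilon> > 0" "\<And>v. \<exists>T. evenly_covered N p M T \<and> \<pi> ` ball v \<epsilon> \<subseteq> T"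
    using uniform_evenly_covered[OF cov] by metis
  have "\<exists>s. continuous_map (top_of_set (ball v \<epsilon>)) N s \<and> (\<forall>u\<in>ball v \<epsilon>. p (s u) = \<pi> u) \<and> s v = y"
    if y: "y \<in> topspace N" "p y = \<pi> v" for v y
  proof -
    obtain T where T: "evenly_covered N p M T" "\<pi> ` ball v \<epsilon> \<subseteq> T" using \<epsilon>(2) by blast
    then have "p y \<in> T" using \<epsilon>(1) y(2) by auto
    from evenly_covered_section[OF T(1) y(1) this]
    obtain q where q: "continuous_map (subtopology M T) N q" "\<And>x. x \<in> T \<Longrightarrow> p (q x) = x" "q (p y) = y"
      by blast
    have "continuous_map (top_of_set (ball v \<epsilon>)) (subtopology M T) \<pi>"
      using T(2) pi_continuous by (auto simp: continuous_map_in_subtopology continuous_map_from_subtopology)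
    from continuous_map_compose[OF this q(1)]
    have "continuous_map (top_of_set (ball v \<epsilon>)) N (q \<circ> \<pi>)" .
    then show ?thesis using q y T(2) by (intro exI[of _ "q \<circ> \<pi>"]) auto
  qed
  note * = someI_ex[OF this]
  define s where "s = (\<lambda>v y. SOME s. continuous_map (top_of_set (ball v \<epsilon>)) N s \<and>
    (\<forall>u\<in>ball v \<epsilon>. p (s u) = \<pi> u) \<and> s v = y)"
  show thesis
    by (rule that[of \<epsilon> s]) (use \<epsilon>(1) * in \<open>simp_all add: s_def\<close>)
qed

text \<open>Convexity supplies connectedness and survives intersection, so this applies to overlaps
  of balls.\<close>

lemma lift_unique_on:
  assumes cov: "covering_map N p M" and S: "convex S" "S \<subseteq> A" "S \<subseteq> B"
    and f: "continuous_map (top_of_set A) N f" "\<And>u. u \<in> A \<Longrightarrow> p (f u) = \<pi> u"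
    and g: "continuous_map (top_of_set B) N g" "\<And>u. u \<in> B \<Longrightarrow> p (g u) = \<pi> u"
    and v: "v \<in> S" "f v = g v" and u: "u \<in> S"
  shows "f u = g u"
proof (rule covering_map_unique_lift[OF cov, of "top_of_set S" f g v u])
  show "continuous_map (top_of_set S) N f" "continuous_map (top_of_set S) N g"
    using S f g by (auto intro: continuous_map_from_subtopology_mono)
  show "connected_space (top_of_set S)"
    using convex_connected[OF S(1)] unfolding connectedin_iff_connected[symmetric] connectedin_def by simp
  show "p (f x) = p (g x)" if "x \<in> topspace (top_of_set S)" for x
  proof -
    have "x \<in> A" "x \<in> B" using that S by auto
    with f(2) g(2) show ?thesis by simp
  qed
qed (use u v in auto)

text \<open>A lift on a ball is extended to a larger ball by continuing it along the rays from the centre.\<close>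

lemma lift_exists:
  assumes cov: "covering_map N p M" and y: "y \<in> topspace N" "p y = \<pi> a"
  obtains g where "g \<in> lifts N p" "g a = y"
proof -
  obtain \<epsilon> s where \<epsilon>: "\<epsilon> > 0"
    and s_cont: "\<And>v y. \<lbrakk>y \<in> topspace N; p y = \<pi> v\<rbrakk> \<Longrightarrow> continuous_map (top_of_set (ball v \<epsilon>)) N (s v y)"
    and s_lift: "\<And>v y u. \<lbrakk>y \<in> topspace N; p y = \<pi> v; u \<in> ball v \<epsilon>\<rbrakk> \<Longrightarrow> p (s v y u) = \<pi> u"
    and s_base: "\<And>v y. \<lbrakk>y \<in> topspace N; p y = \<pi> v\<rbrakk> \<Longrightarrow> s v y v = y"
    by (rule local_lift_exists[OF cov]) blast
  define L where "L = (\<lambda>r g. continuous_map (top_of_set (ball a r)) N g \<and> (\<forall>u\<in>ball a r. p (g u) = \<pi> u) \<and> g a = y)"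
  have step: "\<exists>g'. L (r + \<epsilon>) g'" if r: "r > 0" and g: "L r g" for r g
  proof -
    \<comment> \<open>The contraction about a takes the ball of radius r + \<epsilon> into that of
      radius r and moves each of its points by less than \<epsilon>, so x is within reach of the
      local lift at \<open>c x\<close>.\<close>
    define c where "c = (\<lambda>x. a + (r / (r + \<epsilon>)) *\<^sub>R (x - a))"
    have c_cont: "continuous_on UNIV c" unfolding c_def by (intro continuous_intros)
    have c: "c x \<in> ball a r \<and> x \<in> ball (c x) \<epsilon>" if x: "x \<in> ball a (r + \<epsilon>)" for x
    proof -
      have "dist a (c x) = r / (r + \<epsilon>) * norm (x - a)"
        using r \<epsilon> by (simp add: c_def dist_norm)
      moreover have "norm (x - a) < r + \<epsilon>" using x by (simp add: dist_norm norm_minus_commute)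
      moreover have "x - c x = (\<epsilon> / (r + \<epsilon>)) *\<^sub>R (x - a)"
      proof -
        have "x - c x = (1 - r / (r + \<epsilon>)) *\<^sub>R (x - a)" by (simp add: c_def scaleR_diff_left)
        also have "1 - r / (r + \<epsilon>) = \<epsilon> / (r + \<epsilon>)" using r \<epsilon> by (simp add: field_simps)
        finally show ?thesis .
      qed
      then have "dist (c x) x = \<epsilon> / (r + \<epsilon>) * norm (x - a)"
        using r \<epsilon> by (simp add: dist_norm norm_minus_commute[of "c x"])
      moreover have "t / (r + \<epsilon>) * norm (x - a) < t" if "t > 0" for t
        using mult_strict_left_mono[OF \<open>norm (x - a) < r + \<epsilon>\<close>, of "t / (r + \<epsilon>)"] that r \<epsilon> by simp
      ultimately show ?thesis using r \<epsilon> by simp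
    qed
    have g_top: "g v \<in> topspace N" and g_lift: "p (g v) = \<pi> v" if "v \<in> ball a r" for v
      using g that continuous_map_funspace[of "top_of_set (ball a r)" N g] by (auto simp: L_def)
    define g' where "g' = (\<lambda>x. s (c x) (g (c x)) x)"
    \<comment> \<open>Near x0 the extension is to coincide with the one local lift started at
      \<open>c x0\<close>; this makes it continuous by pasting.\<close>
    define U where "U = (\<lambda>x0. {x \<in> ball a (r + \<epsilon>). c x \<in> ball (c x0) \<epsilon> \<and> x \<in> ball (c x0) \<epsilon>})"
    have g'_eq: "g' x = s (c x0) (g (c x0)) x" if x0: "x0 \<in> ball a (r + \<epsilon>)" and x: "x \<in> U x0" for x0 x
    proof -
      have x': "x \<in> ball a (r + \<epsilon>)" "c x \<in> ball (c x0) \<epsilon>" "x \<in> ball (c x0) \<epsilon>"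
        using x by (auto simp: U_def)
      note cx = c[OF x'(1)] and cx0 = c[OF x0]
      \<comment> \<open>The comparison takes two steps: the local lift at \<open>c x0\<close> agrees
        with g at \<open>c x\<close>, since both agree at \<open>c x0\<close>; then the local lifts
        at \<open>c x\<close> and \<open>c x0\<close> agree at x, since both agree at
        \<open>c x\<close>.\<close>
      have 1: "s (c x0) (g (c x0)) (c x) = g (c x)"
      proof (rule lift_unique_on[OF cov, where S = "ball (c x0) \<epsilon> \<inter> ball a r" and A = "ball (c x0) \<epsilon>" and B = "ball a r" and v = "c x0"
            and f = "s (c x0) (g (c x0))" and g = g and u = "c x"])
        show "convex (ball (c x0) \<epsilon> \<inter> ball a r)" by (intro convex_Int convex_ball)
        show "continuous_map (top_of_set (ball a r)) N g" using g by (simp add: L_def)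
        show "s (c x0) (g (c x0)) (c x0) = g (c x0)" using cx0 by (intro s_base g_top g_lift) auto
      qed (use cx cx0 x' \<epsilon> in \<open>auto intro!: s_cont s_lift g_top g_lift\<close>)
      show ?thesis unfolding g'_def
      proof (rule lift_unique_on[OF cov, where S = "ball (c x) \<epsilon> \<inter> ball (c x0) \<epsilon>" and A = "ball (c x) \<epsilon>"
            and B = "ball (c x0) \<epsilon>" and v = "c x"
            and f = "s (c x) (g (c x))" and g = "s (c x0) (g (c x0))" and u = x])
        show "convex (ball (c x) \<epsilon> \<inter> ball (c x0) \<epsilon>)" by (intro convex_Int convex_ball)
        show "s (c x) (g (c x)) (c x) = s (c x0) (g (c x0)) (c x)"
          unfolding 1 using cx by (intro s_base g_top g_lift) auto
      qed (use cx cx0 x' \<epsilon> in \<open>auto intro!: s_cont s_lift g_top g_lift\<close>)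
    qed
    have "continuous_map (top_of_set (ball a (r + \<epsilon>))) N g'"
    proof (rule pasting_lemma[where I = "ball a (r + \<epsilon>)" and T = U and f = "\<lambda>x0. s (c x0) (g (c x0))"])
      fix x0 assume x0: "x0 \<in> ball a (r + \<epsilon>)"
      have "open (c -` ball (c x0) \<epsilon>)"
        using c_cont by (intro open_vimage) auto
      then have "open (U x0)"
        unfolding U_def using open_Int[OF open_Int[OF open_ball[of a "r + \<epsilon>"] \<open>open (c -` ball (c x0) \<epsilon>)\<close>] open_ball[of "c x0" \<epsilon>]]
        by (simp add: Int_def vimage_def conj_assoc)
      then show "openin (top_of_set (ball a (r + \<epsilon>))) (U x0)"
        by (intro open_subset) (auto simp: U_def)
      have "continuous_map (top_of_set (ball (c x0) \<epsilon>)) N (s (c x0) (g (c x0)))"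
        using c[OF x0] by (intro s_cont g_top g_lift) auto
      then have "continuous_map (top_of_set (U x0)) N (s (c x0) (g (c x0)))"
        by (rule continuous_map_from_subtopology_mono) (auto simp: U_def)
      moreover have "ball a (r + \<epsilon>) \<inter> U x0 = U x0" by (auto simp: U_def)
      ultimately show "continuous_map (subtopology (top_of_set (ball a (r + \<epsilon>))) (U x0)) N (s (c x0) (g (c x0)))"
        by (simp only: subtopology_subtopology)
    next
      fix i j x assume "i \<in> ball a (r + \<epsilon>)" "j \<in> ball a (r + \<epsilon>)"
        "x \<in> topspace (top_of_set (ball a (r + \<epsilon>))) \<inter> U i \<inter> U j"
      then show "s (c i) (g (c i)) x = s (c j) (g (c j)) x"
        using g'_eq[of i x] g'_eq[of j x] by simp
    next
      fix x assume "x \<in> topspace (top_of_set (ball a (r + \<epsilon>)))"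
      then have x: "x \<in> ball a (r + \<epsilon>)" by simp
      then have "x \<in> U x" using c[OF x] \<epsilon> by (auto simp: U_def)
      with x show "\<exists>j. j \<in> ball a (r + \<epsilon>) \<and> x \<in> U j \<and> g' x = s (c j) (g (c j)) x"
        by (auto simp: g'_def)
    qed
    moreover have "p (g' x) = \<pi> x" if "x \<in> ball a (r + \<epsilon>)" for x
      unfolding g'_def using c[OF that] by (intro s_lift g_top g_lift) auto
    moreover have "g' a = y"
    proof -
      have "c a = a" "g a = y" using g by (simp_all add: c_def L_def)
      then show ?thesis using y by (simp add: g'_def s_base)
    qed
    ultimately show ?thesis by (auto simp: L_def)
  qed
  \<comment> \<open>The radii start at \<epsilon>, not at 0, because \<open>step\<close> needs a
    positive radius.\<close>
  have "\<exists>g. L (real (Suc k) * \<epsilon>) g" for k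
  proof (induction k)
    case 0
    have "L \<epsilon> (s a y)" using s_cont[OF y] s_lift[OF y] s_base[OF y] by (auto simp: L_def)
    then show ?case by auto
  next
    case (Suc k)
    then obtain g where "L (real (Suc k) * \<epsilon>) g" by blast
    moreover have "real (Suc k) * \<epsilon> > 0" using \<epsilon> by simp
    ultimately obtain g' where "L (real (Suc k) * \<epsilon> + \<epsilon>) g'" using step by blast
    then show ?case by (auto simp: algebra_simps)
  qed
  \<comment> \<open>These lifts are chosen independently and need not extend each other by
    construction; uniqueness from the common value at a makes them agree on overlaps.\<close>
  then obtain f where f: "\<And>k. L (real (Suc k) * \<epsilon>) (f k)" by metis
  define B where "B = (\<lambda>k. ball a (real (Suc k) * \<epsilon>))"
  have f_eq: "f i x = f j x" if "x \<in> B i" "x \<in> B j" for i j x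
  proof (rule lift_unique_on[OF cov, where S = "B i \<inter> B j" and A = "B i" and B = "B j" and v = a
        and f = "f i" and g = "f j" and u = x])
    show "convex (B i \<inter> B j)" unfolding B_def by (intro convex_Int convex_ball)
    show "f i a = f j a" using f by (simp add: L_def)
    have "a \<in> B k" for k using \<epsilon> by (simp add: B_def)
    then show "a \<in> B i \<inter> B j" by blast
    show "continuous_map (top_of_set (B i)) N (f i)" "continuous_map (top_of_set (B j)) N (f j)"
      using f by (simp_all add: L_def B_def)
    show "p (f i u) = \<pi> u" if "u \<in> B i" for u using f that by (simp add: L_def B_def)
    show "p (f j u) = \<pi> u" if "u \<in> B j" for u using f that by (simp add: L_def B_def)
  qed (use that in auto)
  have "\<exists>k. x \<in> B k" for x
  proof -
    obtain k where "dist a x < real k * \<epsilon>" using reals_Archimedean3[OF \<epsilon>] by blast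
    also have "\<dots> \<le> real (Suc k) * \<epsilon>" using \<epsilon> by (intro mult_right_mono) auto
    finally show ?thesis by (auto simp: B_def)
  qed
  then obtain k where k: "\<And>x. x \<in> B (k x)" by metis
  define g where "g = (\<lambda>x. f (k x) x)"
  have "continuous_map euclidean N g"
  proof (rule pasting_lemma[where I = UNIV and T = B and f = f])
    show "continuous_map (top_of_set (B i)) N (f i)" for i using f by (simp add: L_def B_def)
  qed (use k f_eq in \<open>auto simp: g_def B_def\<close>)
  moreover have "p (g u) = \<pi> u" for u
    using f[of "k u"] k[of u] by (simp add: g_def L_def B_def)
  moreover have "g a = y" using f by (simp add: g_def L_def)
  ultimately show thesis by (intro that[of g]) (auto simp: lifts_def)
qed

end

section \<open>Lifts, stabilizers and equivalence of coverings\<close>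

text \<open>Two maps with the same fibres have images of the same size; below these are the cosets
  of a stabilizer and the points of a fibre.\<close>

lemma bij_betw_images:
  assumes "\<And>x y. x \<in> A \<Longrightarrow> y \<in> A \<Longrightarrow> f x = f y \<longleftrightarrow> h x = h y"
  obtains F where "bij_betw F (f ` A) (h ` A)"
proof -
  define c where "c = (\<lambda>z. SOME x. x \<in> A \<and> f x = z)"
  have c: "c (f x) \<in> A \<and> f (c (f x)) = f x" if "x \<in> A" for x
    unfolding c_def by (rule someI_ex) (use that in blast)
  then have hc: "h (c (f x)) = h x" if "x \<in> A" for x
    using assms that by blast
  have "bij_betw (\<lambda>z. h (c z)) (f ` A) (h ` A)"
    unfolding bij_betw_def
  proof
    show "inj_on (\<lambda>z. h (c z)) (f ` A)"
      by (rule inj_onI) (use hc assms in auto)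
    show "(\<lambda>z. h (c z)) ` f ` A = h ` A"
      unfolding image_image by (rule image_cong) (use hc in auto)
  qed
  then show thesis by (rule that)
qed

context deck_group
begin

lemma lifts_topspace: "g \<in> lifts N p \<Longrightarrow> g u \<in> topspace N"
  unfolding lifts_def using continuous_map_funspace[of euclidean N g] by auto

lemma lifts_lift: "g \<in> lifts N p \<Longrightarrow> p (g u) = \<pi> u"
  by (simp add: lifts_def)

lemma lifts_continuous: "g \<in> lifts N p \<Longrightarrow> continuous_map euclidean N g"
  by (simp add: lifts_def)

lemma lifts_act:
  assumes "g \<in> lifts N p" "\<gamma> \<in> carrier G"
  shows "(\<lambda>u. g (act \<gamma> u)) \<in> lifts N p"
  using assms continuous_map_compose[OF act_continuous[OF assms(2)], of N g]
  by (simp add: lifts_def pi_act comp_def)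

lemma connected_space_euclidean: "connected_space (euclidean :: 'v topology)"
  using connected_UNIV unfolding connectedin_iff_connected[symmetric] connectedin_def by simp

lemma lifts_unique:
  assumes "covering_map N p M" "f \<in> lifts N p" "g \<in> lifts N p" "f u = g u"
  shows "f = g"
proof
  fix x show "f x = g x"
    by (rule covering_map_unique_lift[OF assms(1), of euclidean f g u x])
       (use assms in \<open>simp_all add: lifts_def connected_space_euclidean\<close>)
qed

text \<open>The values lie over one point of M, which yields \<gamma>; then f and the translate of g
  by \<gamma> agree at u and hence everywhere.\<close>

lemma lifts_deck:
  assumes "covering_map N p M" "f \<in> lifts N p" "g \<in> lifts N p" "f u = g w"
  obtains \<gamma> where "\<gamma> \<in> carrier G" "w = act \<gamma> u" "f = (\<lambda>x. g (act \<gamma> x))"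
proof -
  have "\<pi> u = \<pi> w" using assms lifts_lift by metis
  then obtain \<gamma> where \<gamma>: "\<gamma> \<in> carrier G" "w = act \<gamma> u" using pi_eq_iff by blast
  moreover have "f = (\<lambda>x. g (act \<gamma> x))"
    using lifts_unique[OF assms(1,2) lifts_act[OF assms(3) \<gamma>(1)], of u] assms(4) \<gamma>(2) by simp
  ultimately show thesis by (rule that)
qed

text \<open>Locally g is the open map \<open>\<pi>\<close> followed by the inverse of p on a
  sheet.\<close>

lemma lifts_open_map:
  assumes cov: "covering_map N p M" and g: "g \<in> lifts N p"
  shows "open_map euclidean N g"
  unfolding open_map_def
proof (intro allI impI)
  fix U :: "'v set" assume "openin euclidean U"
  then have U: "open U" by simp
  show "openin N (g ` U)"
  proof (subst openin_subopen, intro ballI)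
    fix y assume "y \<in> g ` U"
    then obtain v where v: "v \<in> U" "y = g v" by blast
    obtain T where T: "\<pi> v \<in> T" "evenly_covered N p M T"
      using covering_map_evenly_covered[OF cov pi_topspace] by blast
    then obtain \<V> where \<V>: "\<Union>\<V> = {y \<in> topspace N. p y \<in> T}" "\<forall>V\<in>\<V>. openin N V"
      "\<forall>V\<in>\<V>. homeomorphic_map (subtopology N V) (subtopology M T) p"
      by (auto simp: evenly_covered_def)
    have "g v \<in> \<Union>\<V>" using \<V>(1) T lifts_topspace[OF g] lifts_lift[OF g] by simp
    then obtain V where V: "V \<in> \<V>" "g v \<in> V" by blast
    then have V_top: "V \<subseteq> topspace N" and V_open: "openin N V"
      using \<V>(2) by (auto dest: openin_subset)
    have inj: "inj_on p V"
      using \<V>(3) V homeomorphic_imp_injective_map[of "subtopology N V"] V_top by (auto simp: Int_absorb1)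
    define W where "W = U \<inter> {u. g u \<in> V}"
    have "open W"
      unfolding W_def using U openin_continuous_map_preimage[OF lifts_continuous[OF g] V_open] by auto
    then have "openin M (\<pi> ` W)"
      using pi_open by (simp add: open_map_def)
    then have "openin N {y \<in> topspace N. p y \<in> \<pi> ` W}"
      by (rule openin_continuous_map_preimage[OF covering_map_continuous[OF cov]])
    then have "openin N (V \<inter> {y \<in> topspace N. p y \<in> \<pi> ` W})"
      by (rule openin_Int[OF V_open])
    moreover have "V \<inter> {y \<in> topspace N. p y \<in> \<pi> ` W} = g ` W"
    proof (intro equalityI subsetI)
      fix z assume z: "z \<in> V \<inter> {y \<in> topspace N. p y \<in> \<pi> ` W}"
      then obtain w where w: "w \<in> W" "p z = \<pi> w" by blast
      then have "p z = p (g w)" "g w \<in> V" using lifts_lift[OF g] by (auto simp: W_def)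
      then have "z = g w" using inj z by (auto dest: inj_onD)
      with w show "z \<in> g ` W" by blast
    next
      fix z assume "z \<in> g ` W"
      then show "z \<in> V \<inter> {y \<in> topspace N. p y \<in> \<pi> ` W}"
        using lifts_topspace[OF g] lifts_lift[OF g] by (auto simp: W_def)
    qed
    ultimately have "openin N (g ` W)" by simp
    moreover have "y \<in> g ` W" using v V by (auto simp: W_def)
    moreover have "g ` W \<subseteq> g ` U" by (auto simp: W_def)
    ultimately show "\<exists>S. openin N S \<and> y \<in> S \<and> S \<subseteq> g ` U" by blast
  qed
qed

text \<open>Through every point of N passes the image of some lift. These images are open, and those
  that meet coincide, so each is also closed.\<close>

lemma lifts_surj:
  assumes cov: "covering_map N p M" and conn: "connected_space N" and g: "g \<in> lifts N p"
  shows "range g = topspace N"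
proof -
  have open_range: "openin N (range f)" if "f \<in> lifts N p" for f
    using lifts_open_map[OF cov that] by (simp add: open_map_def)
  have "openin N (topspace N - range g)"
  proof (subst openin_subopen, intro ballI)
    fix y assume y: "y \<in> topspace N - range g"
    then have "p y \<in> topspace M"
      using continuous_map_funspace[OF covering_map_continuous[OF cov]] by auto
    then obtain a where "p y = \<pi> a" using pi_surj by blast
    then obtain f where f: "f \<in> lifts N p" "f a = y"
      using lift_exists[OF cov] y by blast
    have "range f \<inter> range g = {}"
    proof (rule ccontr)
      assume "range f \<inter> range g \<noteq> {}"
      then obtain u w where "f u = g w" by auto
      then obtain \<gamma> where "f = (\<lambda>x. g (act \<gamma> x))" using lifts_deck[OF cov f(1) g] by metis
      with f(2) y show False by auto
    qed
    then show "\<exists>S. openin N S \<and> y \<in> S \<and> S \<subseteq> topspace N - range g"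
      using open_range[OF f(1)] f lifts_topspace by (intro exI[of _ "range f"]) auto
  qed
  moreover have "range g \<subseteq> topspace N" using lifts_topspace[OF g] by blast
  ultimately have "closedin N (range g)" by (simp add: closedin_def)
  with open_range[OF g] conn show ?thesis unfolding connected_space_clopen_in by blast
qed

text \<open>For a lift of \<open>\<pi>\<close> this is its deck group; it plays the part of the
  image of the fundamental group of N.\<close>

definition stabilizer :: "('v \<Rightarrow> 'c) \<Rightarrow> 'a set" where
  "stabilizer g = {\<gamma> \<in> carrier G. \<forall>u. g (act \<gamma> u) = g u}"

lemma lifts_eq_iff:
  assumes "covering_map N p M" "g \<in> lifts N p"
  shows "g u = g w \<longleftrightarrow> (\<exists>\<gamma>\<in>stabilizer g. w = act \<gamma> u)"
proof
  assume "g u = g w"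
  then obtain \<gamma> where \<gamma>: "\<gamma> \<in> carrier G" "w = act \<gamma> u" "g = (\<lambda>x. g (act \<gamma> x))"
    by (rule lifts_deck[OF assms(1) assms(2) assms(2)])
  then have "\<gamma> \<in> stabilizer g" unfolding stabilizer_def using fun_cong[OF \<gamma>(3)] by simp
  with \<gamma> show "\<exists>\<gamma>\<in>stabilizer g. w = act \<gamma> u" by blast
qed (auto simp: stabilizer_def)

lemma subgroup_stabilizer: "subgroup (stabilizer g) G"
proof (rule subgroupI)
  show "stabilizer g \<noteq> {}" using act_one by (auto simp: stabilizer_def intro!: exI[of _ \<one>])
next
  fix a assume a: "a \<in> stabilizer g"
  then have "g (act (inv a) u) = g u" for u
    using act_inv(2)[of a u] unfolding stabilizer_def by (metis (mono_tags, lifting) mem_Collect_eq)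
  with a show "inv a \<in> stabilizer g" by (simp add: stabilizer_def)
qed (auto simp: stabilizer_def act_mult)

text \<open>The map sending \<gamma> to \<open>g (act \<gamma> v)\<close> has the right cosets of
  the stabilizer as its fibres, because the action is free.\<close>

lemma fibre_bij:
  assumes cov: "covering_map N p M" and g: "g \<in> lifts N p" and surj: "range g = topspace N"
  obtains F where "bij_betw F (rcosets stabilizer g) {y \<in> topspace N. p y = \<pi> v}"
proof -
  note sub = subgroup_stabilizer[of g]
  have "stabilizer g #> \<gamma> = stabilizer g #> \<delta> \<longleftrightarrow> g (act \<gamma> v) = g (act \<delta> v)"
    if "\<gamma> \<in> carrier G" "\<delta> \<in> carrier G" for \<gamma> \<delta>
  proof
    assume "stabilizer g #> \<gamma> = stabilizer g #> \<delta>"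
    then have *: "\<gamma> \<otimes> inv \<delta> \<in> stabilizer g" using r_coset_eq_iff[OF sub that] by simp
    have "\<gamma> = (\<gamma> \<otimes> inv \<delta>) \<otimes> \<delta>" using that by (simp add: m_assoc)
    then have "act \<gamma> v = act ((\<gamma> \<otimes> inv \<delta>) \<otimes> \<delta>) v" by (rule arg_cong)
    also have "\<dots> = act (\<gamma> \<otimes> inv \<delta>) (act \<delta> v)" using that by (intro act_mult) auto
    finally have "g (act \<gamma> v) = g (act (\<gamma> \<otimes> inv \<delta>) (act \<delta> v))" by (rule arg_cong)
    also have "\<dots> = g (act \<delta> v)" using * by (simp add: stabilizer_def)
    finally show "g (act \<gamma> v) = g (act \<delta> v)" .
  next
    assume "g (act \<gamma> v) = g (act \<delta> v)"
    then obtain \<theta> where \<theta>: "\<theta> \<in> stabilizer g" "act \<gamma> v = act \<theta> (act \<delta> v)"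
      using lifts_eq_iff[OF cov g, of "act \<delta> v" "act \<gamma> v"] by auto
    then have "\<theta> \<in> carrier G" by (simp add: stabilizer_def)
    then have "\<gamma> = \<theta> \<otimes> \<delta>"
      using \<theta>(2) that by (intro act_free[where u = v]) (simp_all add: act_mult)
    then have "\<gamma> \<otimes> inv \<delta> = \<theta>" using that \<open>\<theta> \<in> carrier G\<close> by (simp add: m_assoc)
    with \<theta>(1) show "stabilizer g #> \<gamma> = stabilizer g #> \<delta>" using r_coset_eq_iff[OF sub that] by simp
  qed
  then obtain F where F: "bij_betw F ((\<lambda>\<gamma>. stabilizer g #> \<gamma>) ` carrier G) ((\<lambda>\<gamma>. g (act \<gamma> v)) ` carrier G)"
    by (rule bij_betw_images)
  have "(\<lambda>\<gamma>. stabilizer g #> \<gamma>) ` carrier G = rcosets stabilizer g"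
    by (auto simp: RCOSETS_def)
  moreover have "(\<lambda>\<gamma>. g (act \<gamma> v)) ` carrier G = {y \<in> topspace N. p y = \<pi> v}"
  proof (intro equalityI subsetI)
    fix y assume "y \<in> {y \<in> topspace N. p y = \<pi> v}"
    then obtain u where "y = g u" "p y = \<pi> v" using surj by blast
    then have "y = g u" "\<pi> v = \<pi> u" using lifts_lift[OF g] by simp_all
    then show "y \<in> (\<lambda>\<gamma>. g (act \<gamma> v)) ` carrier G" using pi_eq_iff by auto
  qed (auto simp: lifts_topspace[OF g] lifts_lift[OF g] pi_act)
  ultimately show thesis using F that by simp
qed

lemma stabilizer_index:
  assumes "(N, p) \<in> fold_coverings k M n" "g \<in> lifts N p"
  shows "stabilizer g \<in> subgroups_of_index G n"
proof -
  have cov: "covering_map N p M" and conn: "connected_space N"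
    and fib: "finite {y \<in> topspace N. p y = \<pi> 0}" "card {y \<in> topspace N. p y = \<pi> 0} = n"
    using assms(1) pi_topspace by (auto simp: fold_coverings_def)
  obtain F where "bij_betw F (rcosets stabilizer g) {y \<in> topspace N. p y = \<pi> 0}"
    using fibre_bij[OF cov assms(2) lifts_surj[OF cov conn assms(2)]] .
  with fib bij_betw_finite bij_betw_same_card subgroup_stabilizer show ?thesis
    unfolding subgroups_of_index_def by blast
qed

lemma stabilizer_act:
  assumes "\<gamma> \<in> carrier G"
  shows "stabilizer (\<lambda>x. g (act \<gamma> x)) = conjugate G (inv \<gamma>) (stabilizer g)"
proof (intro equalityI subsetI)
  fix \<theta> assume \<theta>: "\<theta> \<in> stabilizer (\<lambda>x. g (act \<gamma> x))"
  then have "\<theta> \<in> carrier G" by (simp add: stabilizer_def)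
  have "g (act (\<gamma> \<otimes> \<theta> \<otimes> inv \<gamma>) u) = g u" for u
  proof -
    have "g (act (\<gamma> \<otimes> \<theta> \<otimes> inv \<gamma>) u) = g (act \<gamma> (act \<theta> (act (inv \<gamma>) u)))"
      using assms \<open>\<theta> \<in> carrier G\<close> by (simp add: act_mult)
    also have "\<dots> = g (act \<gamma> (act (inv \<gamma>) u))" using \<theta> by (simp add: stabilizer_def)
    finally show ?thesis using assms by simp
  qed
  then have "\<gamma> \<otimes> \<theta> \<otimes> inv \<gamma> \<in> stabilizer g"
    using assms \<open>\<theta> \<in> carrier G\<close> by (simp add: stabilizer_def)
  moreover have "\<theta> = inv \<gamma> \<otimes> (\<gamma> \<otimes> \<theta> \<otimes> inv \<gamma>) \<otimes> inv (inv \<gamma>)"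
    using assms \<open>\<theta> \<in> carrier G\<close> by (simp add: m_assoc)
  ultimately show "\<theta> \<in> conjugate G (inv \<gamma>) (stabilizer g)"
    unfolding conjugate_def by (rule rev_image_eqI)
next
  fix \<theta> assume "\<theta> \<in> conjugate G (inv \<gamma>) (stabilizer g)"
  then obtain h where h: "h \<in> stabilizer g" "\<theta> = inv \<gamma> \<otimes> h \<otimes> \<gamma>"
    using assms by (auto simp: conjugate_def)
  then have "h \<in> carrier G" by (simp add: stabilizer_def)
  then have "act \<gamma> (act \<theta> u) = act h (act \<gamma> u)" for u
    using assms by (simp add: h(2) act_mult)
  then show "\<theta> \<in> stabilizer (\<lambda>x. g (act \<gamma> x))"
    using h assms \<open>h \<in> carrier G\<close> by (simp add: stabilizer_def)
qed

text \<open>Both lifts are open surjections, and their fibres are the orbits of the same group, so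
  each factors through the other.\<close>

lemma equal_stabilizer_imp_equivalent:
  assumes C: "(N, p) \<in> fold_coverings k M n" "g \<in> lifts N p"
    and C': "(N', p') \<in> fold_coverings k M n'" "g' \<in> lifts N' p'"
    and eq: "stabilizer g = stabilizer g'"
  shows "equivalent_coverings (N, p) (N', p')"
proof -
  have cov: "covering_map N p M" "covering_map N' p' M"
    and conn: "connected_space N" "connected_space N'"
    using C C' by (auto simp: fold_coverings_def)
  note surj = lifts_surj[OF cov(1) conn(1) C(2)] lifts_surj[OF cov(2) conn(2) C'(2)]
  have iff: "g u = g w \<longleftrightarrow> g' u = g' w" for u w
    using lifts_eq_iff[OF cov(1) C(2)] lifts_eq_iff[OF cov(2) C'(2)] eq by simp
  have quot: "quotient_map euclidean N g"
    using lifts_continuous[OF C(2)] lifts_open_map[OF cov(1) C(2)] surj(1)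
    by (intro continuous_open_imp_quotient_map) auto
  \<comment> \<open>The choice of the preimage does not matter, since g and \<open>g'\<close> have
    the same fibres.\<close>
  define \<eta> where "\<eta> = (\<lambda>y. g' (SOME u. g u = y))"
  have \<eta>: "\<eta> (g u) = g' u" for u
  proof -
    have "g (SOME w. g w = g u) = g u" by (rule someI) (rule HOL.refl)
    then show ?thesis using iff by (simp add: \<eta>_def)
  qed
  have comp: "\<eta> \<circ> g = g'" by (auto simp: \<eta>)
  have "homeomorphic_map N N' \<eta>"
  proof (rule bijective_open_imp_homeomorphic_map)
    show "continuous_map N N' \<eta>"
      using continuous_compose_quotient_map_eq[OF quot, of N' \<eta>] lifts_continuous[OF C'(2)] comp by simp
    show "open_map N N' \<eta>"
      unfolding open_map_def
    proof (intro allI impI)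
      fix U assume U: "openin N U"
      then have "openin N' (g' ` {u. g u \<in> U})"
        using openin_continuous_map_preimage[OF lifts_continuous[OF C(2)] U] lifts_open_map[OF cov(2) C'(2)]
        by (simp add: open_map_def)
      moreover have "\<eta> ` U = g' ` {u. g u \<in> U}"
      proof -
        have "U \<subseteq> range g" using openin_subset[OF U] surj(1) by simp
        then have "U = g ` {u. g u \<in> U}" by blast
        then have "\<eta> ` U = \<eta> ` g ` {u. g u \<in> U}" by simp
        then show ?thesis by (simp add: image_image \<eta>)
      qed
      ultimately show "openin N' (\<eta> ` U)" by simp
    qed
    show "\<eta> ` topspace N = topspace N'"
      unfolding surj[symmetric] by (simp add: image_image \<eta>)
    show "inj_on \<eta> (topspace N)"
      unfolding surj(1)[symmetric] by (auto simp: inj_on_def \<eta> iff)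
  qed
  moreover have "p y = p' (\<eta> y)" if "y \<in> topspace N" for y
    using that lifts_lift[OF C(2)] lifts_lift[OF C'(2)] by (auto simp: surj(1)[symmetric] \<eta>)
  ultimately show ?thesis
    unfolding equivalent_coverings_def by auto
qed

lemma equivalent_lifts:
  assumes "homeomorphic_map N N' \<eta>" "\<And>y. y \<in> topspace N \<Longrightarrow> p y = p' (\<eta> y)" "g \<in> lifts N p"
  shows "\<eta> \<circ> g \<in> lifts N' p'" "stabilizer (\<eta> \<circ> g) = stabilizer g"
proof -
  have "continuous_map N N' \<eta>" "inj_on \<eta> (topspace N)"
    using assms(1) by (auto simp: homeomorphic_eq_everything_map)
  then show "\<eta> \<circ> g \<in> lifts N' p'"
    using assms(2) lifts_topspace[OF assms(3)] lifts_lift[OF assms(3)] lifts_continuous[OF assms(3)]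
    by (auto simp: lifts_def intro: continuous_map_compose)
  show "stabilizer (\<eta> \<circ> g) = stabilizer g"
    using inj_on_eq_iff[OF \<open>inj_on \<eta> (topspace N)\<close>] lifts_topspace[OF assms(3)]
    by (simp add: stabilizer_def)
qed

text \<open>An equivalence carries g to a lift with the same stabilizer; being surjective, it meets
  \<open>g'\<close> and differs from it by an element of G. Conversely, translating g makes the
  stabilizers equal.\<close>

lemma equivalent_iff_conjugate:
  assumes C: "(N, p) \<in> fold_coverings k M n" "g \<in> lifts N p"
    and C': "(N', p') \<in> fold_coverings k M n" "g' \<in> lifts N' p'"
  shows "equivalent_coverings (N, p) (N', p') \<longleftrightarrow> conjugate_sets G (stabilizer g) (stabilizer g')"
proof
  have cov': "covering_map N' p' M" and conn': "connected_space N'"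
    using C' by (auto simp: fold_coverings_def)
  assume "equivalent_coverings (N, p) (N', p')"
  then obtain \<eta> where \<eta>: "homeomorphic_map N N' \<eta>" "\<And>y. y \<in> topspace N \<Longrightarrow> p y = p' (\<eta> y)"
    by (auto simp: equivalent_coverings_def)
  note h = equivalent_lifts[OF \<eta> C(2)]
  have "g' 0 \<in> range (\<eta> \<circ> g)"
    using lifts_surj[OF cov' conn' h(1)] lifts_topspace[OF C'(2)] by simp
  then obtain w where w: "g' 0 = (\<eta> \<circ> g) w" by blast
  obtain \<gamma> where \<gamma>: "\<gamma> \<in> carrier G" "g' = (\<lambda>x. (\<eta> \<circ> g) (act \<gamma> x))"
    by (rule lifts_deck[OF cov' C'(2) h(1) w]) blast
  then have "stabilizer g' = conjugate G (inv \<gamma>) (stabilizer g)"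
    using stabilizer_act[OF \<gamma>(1), of "\<eta> \<circ> g"] h(2) by simp
  with \<gamma>(1) show "conjugate_sets G (stabilizer g) (stabilizer g')"
    unfolding conjugate_sets_iff by blast
next
  assume "conjugate_sets G (stabilizer g) (stabilizer g')"
  then obtain \<gamma> where \<gamma>: "\<gamma> \<in> carrier G" "stabilizer g' = conjugate G \<gamma> (stabilizer g)"
    by (auto simp: conjugate_sets_iff)
  then have "stabilizer (\<lambda>x. g (act (inv \<gamma>) x)) = stabilizer g'"
    using stabilizer_act[of "inv \<gamma>" g] by simp
  then show "equivalent_coverings (N, p) (N', p')"
    using equal_stabilizer_imp_equivalent[OF C(1) lifts_act[OF C(2) inv_closed[OF \<gamma>(1)]] C'] by blast
qed

end

lemma equiv_equivalent_coverings:
  fixes M :: "'b topology"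
  shows "equiv (fold_coverings k M n :: ('c topology \<times> ('c \<Rightarrow> 'b)) set)
    {(C, C'). C \<in> fold_coverings k M n \<and> C' \<in> fold_coverings k M n \<and>
                 equivalent_coverings C C'}"
proof (rule equivI)
  let ?F = "fold_coverings k M n :: ('c topology \<times> ('c \<Rightarrow> 'b)) set"
  show "{(C, C'). C \<in> ?F \<and> C' \<in> ?F \<and> equivalent_coverings C C'}
      \<subseteq> ?F \<times> ?F"
    by auto
  have "equivalent_coverings C C" for C :: "'c topology \<times> ('c \<Rightarrow> 'b)"
    unfolding equivalent_coverings_def by (intro exI[of _ id]) simp
  then show "refl_on (?F) {(C, C'). C \<in> ?F \<and> C' \<in> ?F \<and>
                 equivalent_coverings C C'}"
    by (simp add: refl_on_def)
  have "equivalent_coverings C' C" if "equivalent_coverings C C'" for C C' :: "'c topology \<times> ('c \<Rightarrow> 'b)"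
  proof -
    obtain \<eta> \<theta> where \<eta>: "homeomorphic_maps (fst C) (fst C') \<eta> \<theta>" "\<forall>y\<in>topspace (fst C). snd C y = snd C' (\<eta> y)"
      using \<open>equivalent_coverings C C'\<close> by (auto simp: equivalent_coverings_def homeomorphic_map_maps)
    then have "homeomorphic_map (fst C') (fst C) \<theta>"
      using homeomorphic_map_maps homeomorphic_maps_sym by blast
    moreover have "snd C' y = snd C (\<theta> y)" if "y \<in> topspace (fst C')" for y
    proof -
      have "\<theta> y \<in> topspace (fst C)" "\<eta> (\<theta> y) = y"
        using \<eta>(1) that by (auto simp: homeomorphic_maps_def dest: continuous_map_funspace)
      with \<eta>(2) show ?thesis by force
    qed
    ultimately show ?thesis by (auto simp: equivalent_coverings_def)
  qed
  then show "Relation.sym {(C, C'). C \<in> ?F \<and> C' \<in> ?F \<and> equivalent_coverings C C'}"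
    by (auto intro!: symI)
  have "equivalent_coverings C E" if CDE: "equivalent_coverings C D" "equivalent_coverings D E"
    for C D E :: "'c topology \<times> ('c \<Rightarrow> 'b)"
  proof -
    obtain \<eta> \<theta> where \<eta>: "homeomorphic_map (fst C) (fst D) \<eta>" "\<forall>y\<in>topspace (fst C). snd C y = snd D (\<eta> y)"
      and \<theta>: "homeomorphic_map (fst D) (fst E) \<theta>" "\<forall>y\<in>topspace (fst D). snd D y = snd E (\<theta> y)"
      using CDE unfolding equivalent_coverings_def by blast
    have "homeomorphic_map (fst C) (fst E) (\<theta> \<circ> \<eta>)"
      using \<eta>(1) \<theta>(1) by (rule homeomorphic_map_compose)
    moreover have "\<eta> y \<in> topspace (fst D)" if "y \<in> topspace (fst C)" for y
      using homeomorphic_imp_surjective_map[OF \<eta>(1)] that by blast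
    ultimately show ?thesis
      unfolding equivalent_coverings_def using \<eta>(2) \<theta>(2) by (intro exI[of _ "\<theta> \<circ> \<eta>"]) simp
  qed
  then show "Relation.trans {(C, C'). C \<in> ?F \<and> C' \<in> ?F \<and> equivalent_coverings C C'}"
    by (auto intro!: transI)
qed

section \<open>The covering belonging to a subgroup\<close>

lemma second_countable_euclidean: "second_countable (euclidean :: 'a::second_countable_topology topology)"
proof -
  obtain B :: "'a set set" where B: "countable B" "topological_basis B"
    using ex_countable_basis by blast
  show ?thesis
    unfolding second_countable_def
  proof (intro exI[of _ B] conjI allI impI ballI)
    show "countable B" by (rule B(1))
    show "openin euclidean V" if "V \<in> B" for V
      using topological_basis_open[OF B(2) that] by simp
    show "\<exists>V\<in>B. x \<in> V \<and> V \<subseteq> U" if "openin euclidean U \<and> x \<in> U" for U x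
      using topological_basisE[OF B(2), of U x] that by auto
  qed
qed

lemma open_set_homeomorphic_Euclidean:
  assumes "(euclidean :: 'v::euclidean_space topology) homeomorphic_space Euclidean_space k" "open (U :: 'v set)"
  obtains V where "openin (Euclidean_space k) V"
    "top_of_set U homeomorphic_space subtopology (Euclidean_space k) V"
proof -
  obtain e where e: "homeomorphic_map (euclidean :: 'v topology) (Euclidean_space k) e"
    using assms(1) homeomorphic_space by blast
  have "openin (Euclidean_space k) (e ` U)"
    using homeomorphic_imp_open_map[OF e] assms(2) by (simp add: open_map_def)
  moreover have "homeomorphic_map (top_of_set U) (subtopology (Euclidean_space k) (e ` U)) e"
    using e by (rule homeomorphic_map_subtopologies_alt) (use homeomorphic_imp_injective_map[OF e] in \<open>auto dest: injD\<close>)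
  ultimately show thesis using that homeomorphic_space by blast
qed

context deck_group
begin

text \<open>Only the fibres of \<open>orb\<close> are prescribed, so the points of the total space
  may be encoded in any type that has room for the orbits.\<close>

lemma quotient_covering:
  fixes orb :: "'v \<Rightarrow> 'c"
  assumes H: "subgroup H G" and orb: "\<And>u w. orb u = orb w \<longleftrightarrow> (\<exists>h\<in>H. w = act h u)"
    and index: "finite (rcosets H)" "card (rcosets H) = n"
    and dim: "(euclidean :: 'v topology) homeomorphic_space Euclidean_space k"
  obtains N p where "(N, p) \<in> fold_coverings k M n" "orb \<in> lifts N p" "stabilizer orb = H"
proof -
  define N where "N = quotient_topology euclidean orb"
  define p where "p = (\<lambda>y. \<pi> (SOME u. orb u = y))"
  have HG: "H \<subseteq> carrier G" using H by (rule subgroup.subset)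
  have p: "p (orb u) = \<pi> u" for u
  proof -
    have "orb (SOME w. orb w = orb u) = orb u" by (rule someI) (rule HOL.refl)
    then obtain h where "h \<in> H" "u = act h (SOME w. orb w = orb u)" using orb by blast
    then have "\<exists>g\<in>carrier G. u = act g (SOME w. orb w = orb u)" using HG by blast
    then show ?thesis unfolding p_def pi_eq_iff .
  qed
  have openin_N: "openin N U \<longleftrightarrow> U \<subseteq> range orb \<and> open {u. orb u \<in> U}" for U
    unfolding N_def openin_quotient_topology by simp
  have top_N: "topspace N = range orb"
  proof
    show "topspace N \<subseteq> range orb" using openin_N[of "topspace N"] by simp
    have "openin N (range orb)" by (simp add: openin_N)
    then show "range orb \<subseteq> topspace N" by (rule openin_subset)
  qed
  have orb_cont: "continuous_map euclidean N orb"
    unfolding continuous_map by (auto simp: openin_N top_N)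
  have orb_act: "orb (act h u) = orb u" if "h \<in> H" for h u
  proof -
    have "orb u = orb (act h u)" unfolding orb using that by blast
    then show ?thesis by (rule HOL.sym)
  qed
  have orb_open: "openin N (orb ` W)" if "open W" for W
  proof -
    have "{u. orb u \<in> orb ` W} = (\<Union>h\<in>H. act h -` W)"
      using orb orb_act by (auto simp: image_iff)
    moreover have "open (act h -` W)" if "h \<in> H" for h
      using act_continuous[of h] that HG \<open>open W\<close> by (intro open_vimage) auto
    ultimately have "open {u. orb u \<in> orb ` W}" by auto
    then show ?thesis by (auto simp: openin_N)
  qed
  then have orb_open_map: "open_map euclidean N orb" by (simp add: open_map_def)
  have p_cont: "continuous_map N M p"
    unfolding continuous_map
  proof (intro conjI allI impI)
    show "p ` topspace N \<subseteq> topspace M" by (auto simp: top_N p pi_topspace)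
    fix U assume "openin M U"
    then have "open {u. \<pi> u \<in> U}"
      using openin_continuous_map_preimage[OF pi_continuous] by simp
    then show "openin N {x \<in> topspace N. p x \<in> U}"
      by (auto simp: openin_N top_N p)
  qed
  have p_open: "openin M (p ` U)" if "openin N U" for U
  proof -
    have "U \<subseteq> range orb" "open {u. orb u \<in> U}" using that by (auto simp: openin_N)
    then have "U = orb ` {u. orb u \<in> U}" by blast
    then have "p ` U = p ` orb ` {u. orb u \<in> U}" by (rule arg_cong)
    then have "p ` U = \<pi> ` {u. orb u \<in> U}" by (simp only: image_image p)
    then show ?thesis using pi_open \<open>open {u. orb u \<in> U}\<close> by (simp add: open_map_def)
  qed
  \<comment> \<open>Two points of a ball of radius 1/2 are less than 1 apart, so no nontrivial
    element of G takes one to the other.\<close>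
  define V where "V = (\<lambda>u. orb ` ball u (1/2))"
  have V_open: "openin N (V u)" for u by (simp add: V_def orb_open)
  have close: "h = \<one>" if "h \<in> carrier G" "u \<in> ball w (1/2)" "act h u \<in> ball w (1/2)" for h u w
  proof (rule act_discrete)
    have "dist (act h u) w < 1/2" "dist u w < 1/2" using that by (auto simp: dist_commute)
    then show "dist (act h u) u < 1" using dist_triangle2[of "act h u" u w] by linarith
  qed fact
  have inj_orb: "inj_on orb (ball u (1/2))" for u
  proof (rule inj_onI)
    fix x y assume x: "x \<in> ball u (1/2)" and y: "y \<in> ball u (1/2)" and "orb x = orb y"
    then obtain h where h: "h \<in> H" "y = act h x" using orb by blast
    then have "h = \<one>" using close[of h x u] x y HG by auto
    with h show "x = y" by (simp add: act_one)
  qed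
  have inj_p: "inj_on p (V u)" for u
  proof (rule inj_onI)
    fix x y assume "x \<in> V u" "y \<in> V u" and eq: "p x = p y"
    then obtain a b where ab: "a \<in> ball u (1/2)" "x = orb a" "b \<in> ball u (1/2)" "y = orb b"
      by (auto simp: V_def)
    then obtain h where h: "h \<in> carrier G" "b = act h a" using eq p pi_eq_iff by metis
    then have "h = \<one>" using close[of h a u] ab by auto
    with h ab show "x = y" by (simp add: act_one)
  qed
  have cov: "covering_map N p M"
    unfolding covering_map_def
  proof (intro conjI ballI)
    show "continuous_map N M p" by (rule p_cont)
    show "p ` topspace N = topspace M" by (simp add: top_N image_image p pi_surj)
    fix x assume "x \<in> topspace M"
    then obtain v where v: "x = \<pi> v" using pi_surj by blast
    define T where "T = \<pi> ` ball v (1/2)"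
    \<comment> \<open>Elements in one right coset of H give the same sheet. Sheets are therefore
      disjoint only when distinct as sets, and two that meet are shown to be equal.\<close>
    define \<V> where "\<V> = (\<lambda>\<gamma>. V (act \<gamma> v)) ` carrier G"
    have T_open: "openin M T" unfolding T_def using pi_open by (simp add: open_map_def)
    have union: "\<Union>\<V> = {y \<in> topspace N. p y \<in> T}"
    proof (intro equalityI subsetI)
      fix y assume "y \<in> \<Union>\<V>"
      then obtain \<gamma> where "\<gamma> \<in> carrier G" "y \<in> orb ` act \<gamma> ` ball v (1/2)"
        by (auto simp: \<V>_def V_def act_ball)
      then show "y \<in> {y \<in> topspace N. p y \<in> T}" by (auto simp: top_N p T_def pi_act)
    next
      fix y assume "y \<in> {y \<in> topspace N. p y \<in> T}"
      then obtain u w where uw: "y = orb u" "w \<in> ball v (1/2)" "\<pi> w = \<pi> u"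
        by (auto simp: top_N p T_def)
      then obtain \<gamma> where \<gamma>: "\<gamma> \<in> carrier G" "u = act \<gamma> w" using pi_eq_iff by blast
      then have "u \<in> ball (act \<gamma> v) (1/2)" using uw(2) act_dist by simp
      then have "y \<in> V (act \<gamma> v)" unfolding uw(1) V_def by (rule imageI)
      with \<gamma>(1) show "y \<in> \<Union>\<V>" by (auto simp: \<V>_def)
    qed
    have disj: "pairwise disjnt \<V>"
      unfolding pairwise_def
    proof (intro ballI impI)
      fix A B assume AB: "A \<in> \<V>" "B \<in> \<V>" "A \<noteq> B"
      then obtain \<gamma> \<delta> where \<gamma>: "\<gamma> \<in> carrier G" "A = V (act \<gamma> v)" and \<delta>: "\<delta> \<in> carrier G" "B = V (act \<delta> v)"
        by (auto simp: \<V>_def)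
      show "disjnt A B"
      proof (rule ccontr)
        assume "\<not> disjnt A B"
        then obtain a b where ab: "a \<in> ball (act \<gamma> v) (1/2)" "b \<in> ball (act \<delta> v) (1/2)" "orb a = orb b"
          by (auto simp: disjnt_iff \<gamma>(2) \<delta>(2) V_def)
        then obtain h where h: "h \<in> H" "b = act h a" using orb by blast
        then have hG: "h \<in> carrier G" using HG by blast
        have "dist (act (h \<otimes> \<gamma>) v) (act \<delta> v) < 1"
        proof -
          have "dist (act (h \<otimes> \<gamma>) v) b < 1/2"
            using ab(1) by (simp add: h(2) act_mult[OF hG \<gamma>(1)] act_dist[OF hG])
          moreover have "dist (act \<delta> v) b < 1/2" using ab(2) by simp
          ultimately show ?thesis using dist_triangle2[of "act (h \<otimes> \<gamma>) v" "act \<delta> v" b] by linarith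
        qed
        then have "h \<otimes> \<gamma> = \<delta>" using hG \<gamma>(1) \<delta>(1) by (intro act_free) auto
        then have "ball (act \<delta> v) (1/2) = act h ` ball (act \<gamma> v) (1/2)"
          using act_mult[OF hG \<gamma>(1)] act_ball[OF hG] by auto
        then have "B = orb ` act h ` ball (act \<gamma> v) (1/2)" by (simp add: \<delta>(2) V_def)
        also have "\<dots> = A" by (simp add: \<gamma>(2) V_def image_image orb_act[OF h(1)])
        finally show False using AB(3) by simp
      qed
    qed
    have homeo: "homeomorphic_map (subtopology N W) (subtopology M T) p" if W: "W \<in> \<V>" for W
    proof -
      obtain \<gamma> where \<gamma>: "\<gamma> \<in> carrier G" "W = V (act \<gamma> v)" using W by (auto simp: \<V>_def)
      have W_top: "W \<subseteq> topspace N" using V_open[of "act \<gamma> v"] by (simp add: \<gamma>(2) openin_subset)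
      have T_top: "T \<subseteq> topspace M" using T_open by (rule openin_subset)
      have img: "p ` W = T"
        unfolding \<gamma>(2) V_def act_ball[OF \<gamma>(1), symmetric] T_def
        by (simp add: image_image p pi_act[OF \<gamma>(1)])
      show ?thesis
      proof (rule bijective_open_imp_homeomorphic_map)
        show "continuous_map (subtopology N W) (subtopology M T) p"
          using p_cont img by (intro continuous_map_into_subtopology continuous_map_from_subtopology) auto
        have "open_map N M p" by (simp add: open_map_def p_open)
        then show "open_map (subtopology N W) (subtopology M T) p"
          using V_open[of "act \<gamma> v"] img
          by (intro open_map_into_subtopology open_map_from_subtopology) (auto simp: \<gamma>(2))
        show "p ` topspace (subtopology N W) = topspace (subtopology M T)"
          using W_top T_top img by (simp add: Int_absorb1)
        show "inj_on p (topspace (subtopology N W))"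
          using W_top inj_p by (simp add: Int_absorb1 \<gamma>(2))
      qed
    qed
    have "x \<in> T" by (auto simp: T_def v)
    then show "\<exists>T. x \<in> T \<and> openin M T \<and>
        (\<exists>\<V>. \<Union>\<V> = {y \<in> topspace N. p y \<in> T} \<and> (\<forall>V\<in>\<V>. openin N V) \<and> pairwise disjnt \<V> \<and>
             (\<forall>V\<in>\<V>. homeomorphic_map (subtopology N V) (subtopology M T) p))"
      using T_open union disj homeo V_open
      by (intro exI[of _ T] conjI exI[of _ \<V>] ballI) (auto simp: \<V>_def)
  qed
  have lift: "orb \<in> lifts N p" by (simp add: lifts_def orb_cont p)
  have stab: "stabilizer orb = H"
  proof (intro equalityI subsetI)
    fix \<gamma> assume \<gamma>: "\<gamma> \<in> stabilizer orb"
    then have "orb 0 = orb (act \<gamma> 0)" by (simp add: stabilizer_def)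
    \<comment> \<open>One point suffices, since the action is free.\<close>
    then obtain h where h: "h \<in> H" "act \<gamma> 0 = act h 0" using orb by blast
    then have "\<gamma> = h" using \<gamma> HG by (intro act_free[where u = 0]) (auto simp: stabilizer_def)
    with h show "\<gamma> \<in> H" by simp
  qed (use HG orb_act in \<open>auto simp: stabilizer_def\<close>)
  have hausdorff: "Hausdorff_space N"
    unfolding Hausdorff_space_def
  proof (intro allI impI)
    fix x y assume "x \<in> topspace N \<and> y \<in> topspace N \<and> x \<noteq> y"
    then obtain a b where ab: "x = orb a" "y = orb b" "orb a \<noteq> orb b" by (auto simp: top_N)
    have ne: "act h b \<noteq> a" if "h \<in> H" for h using orb_act[OF that] ab(3) by metis
    \<comment> \<open>The distance from a to the orbit of b is bounded below: at most one h brings b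
      within 1/2 of a, as two such translates would be less than 1 apart.\<close>
    obtain d where d: "d > 0" "\<And>h. h \<in> H \<Longrightarrow> dist a (act h b) \<ge> d"
    proof (cases "\<exists>h\<in>H. dist a (act h b) < 1/2")
      case True
      then obtain h0 where h0: "h0 \<in> H" "dist a (act h0 b) < 1/2" by blast
      show thesis
      proof (rule that)
        show "dist a (act h0 b) > 0" using ne[OF h0(1)] by auto
        show "dist a (act h0 b) \<le> dist a (act h b)" if h: "h \<in> H" for h
        proof (rule ccontr)
          assume "\<not> dist a (act h0 b) \<le> dist a (act h b)"
          then have lt: "dist a (act h b) < dist a (act h0 b)" by simp
          then have "dist (act h b) (act h0 b) < 1"
            using h0(2) dist_triangle3[of "act h b" "act h0 b" a] by linarith
          then have "h = h0" using h h0 HG by (intro act_free[where u = b]) auto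
          with lt show False by simp
        qed
      qed
    next
      case False
      then show thesis by (intro that[of "1/2"]) (auto simp: not_less)
    qed
    have "disjnt (orb ` ball a (d/2)) (orb ` ball b (d/2))"
    proof (rule ccontr)
      assume "\<not> disjnt (orb ` ball a (d/2)) (orb ` ball b (d/2))"
      then obtain u w where uw: "u \<in> ball a (d/2)" "w \<in> ball b (d/2)" "orb w = orb u"
        by (auto simp: disjnt_iff)
      then obtain h where h: "h \<in> H" "u = act h w" using orb by blast
      then have "dist (act h b) u < d/2" using uw(2) act_dist[of h b w] HG by auto
      moreover have "dist a u < d/2" using uw(1) by simp
      ultimately have "dist a (act h b) < d" using dist_triangle2[of a "act h b" u] by linarith
      with d(2)[OF h(1)] show False by simp
    qed
    then show "\<exists>U V. openin N U \<and> openin N V \<and> x \<in> U \<and> y \<in> V \<and> disjnt U V"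
      using d(1) ab orb_open
      by (intro exI[of _ "orb ` ball a (d/2)"] exI[of _ "orb ` ball b (d/2)"]) auto
  qed
  have "topological_manifold k N"
    unfolding topological_manifold_def
  proof (intro conjI ballI)
    show "Hausdorff_space N" by (rule hausdorff)
    show "second_countable N"
      by (rule second_countable_open_map_image[OF orb_cont orb_open_map _ second_countable_euclidean])
        (simp add: top_N)
    fix x assume "x \<in> topspace N"
    then obtain u where u: "x = orb u" by (auto simp: top_N)
    obtain W where W: "openin (Euclidean_space k) W"
      "top_of_set (ball u (1/2)) homeomorphic_space subtopology (Euclidean_space k) W"
      using open_set_homeomorphic_Euclidean[OF dim open_ball] .
    have V_top: "V u \<subseteq> topspace N" using V_open by (rule openin_subset)
    have "homeomorphic_map (top_of_set (ball u (1/2))) (subtopology N (V u)) orb"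
    proof (rule bijective_open_imp_homeomorphic_map)
      show "continuous_map (top_of_set (ball u (1/2))) (subtopology N (V u)) orb"
        using orb_cont by (intro continuous_map_into_subtopology continuous_map_from_subtopology) (auto simp: V_def)
      show "open_map (top_of_set (ball u (1/2))) (subtopology N (V u)) orb"
        using orb_open_map by (intro open_map_into_subtopology open_map_from_subtopology) (auto simp: V_def)
      show "orb ` topspace (top_of_set (ball u (1/2))) = topspace (subtopology N (V u))"
        using V_top by (simp add: Int_absorb1) (simp add: V_def)
      show "inj_on orb (topspace (top_of_set (ball u (1/2))))" using inj_orb by simp
    qed
    then have "subtopology N (V u) homeomorphic_space top_of_set (ball u (1/2))"
      using homeomorphic_space homeomorphic_space_sym by blast
    then have "subtopology N (V u) homeomorphic_space subtopology (Euclidean_space k) W"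
      using W(2) by (rule homeomorphic_space_trans)
    moreover have "x \<in> V u" by (simp add: u V_def)
    ultimately show "\<exists>U V. openin N U \<and> x \<in> U \<and> openin (Euclidean_space k) V \<and>
        subtopology N U homeomorphic_space subtopology (Euclidean_space k) V"
      using V_open W(1) by blast
  qed
  moreover have "connected_space N"
    using connectedin_continuous_map_image[OF orb_cont, of UNIV] connected_space_euclidean
    by (simp add: connectedin_def top_N[symmetric])
  moreover have "finite {y \<in> topspace N. p y = x} \<and> card {y \<in> topspace N. p y = x} = n" if x: "x \<in> topspace M" for x
  proof -
    obtain v where v: "x = \<pi> v" using x pi_surj by blast
    \<comment> \<open>\<open>orb\<close> is itself a lift with stabilizer H, so the number of sheets
      is the index of H.\<close>
    obtain F where "bij_betw F (rcosets stabilizer orb) {y \<in> topspace N. p y = \<pi> v}"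
      using fibre_bij[OF cov lift top_N[symmetric]] .
    from bij_betw_finite[OF this] bij_betw_same_card[OF this]
    show ?thesis using index by (simp add: v stab)
  qed
  ultimately have "(N, p) \<in> fold_coverings k M n"
    using cov by (simp add: fold_coverings_def)
  from that[OF this lift stab] show thesis .
qed

text \<open>A covering is related to the stabilizers of all its lifts, and this relation induces the
  bijection of classes. The cardinality assumption is what allows every quotient to be realised on
  the given type.\<close>

theorem num_coverings_eq_num_subgroup_classes:
  assumes "n > 0" and card: "(UNIV :: 'v set) \<lesssim> (UNIV :: 'c set)"
    and dim: "(euclidean :: 'v topology) homeomorphic_space Euclidean_space k"
  shows "num_coverings TYPE('c) k M n = num_subgroup_classes G n"
  unfolding num_coverings_def num_subgroup_classes_def
proof (rule card_quotient_eq[where Z = "\<lambda>C H. \<exists>g\<in>lifts (fst C) (snd C). stabilizer g = H"])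
  let ?F = "fold_coverings k M n :: ('c topology \<times> ('c \<Rightarrow> 'm)) set"
  show "equiv ?F {(C, C'). C \<in> ?F \<and> C' \<in> ?F \<and> equivalent_coverings C C'}"
    by (rule equiv_equivalent_coverings)
  show "equiv (subgroups_of_index G n) (conjugacy_on_index G n)"
    by (rule equiv_conjugacy_on_index)
  show "\<exists>H\<in>subgroups_of_index G n. \<exists>g\<in>lifts (fst C) (snd C). stabilizer g = H" if C: "C \<in> ?F" for C
  proof -
    obtain N p where Np: "C = (N, p)" by (cases C)
    have cov: "covering_map N p M" using C by (simp add: fold_coverings_def Np)
    have "\<pi> 0 \<in> p ` topspace N" using cov pi_topspace by (simp add: covering_map_def)
    then obtain y where "y \<in> topspace N" "p y = \<pi> 0" by (metis imageE)
    then obtain g where "g \<in> lifts N p" using lift_exists[OF cov] by blast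
    with C show ?thesis using stabilizer_index unfolding Np by fastforce
  qed
  obtain \<iota> :: "'v \<Rightarrow> 'c" where \<iota>: "inj \<iota>" using card by (auto simp: lepoll_def)
  show "\<exists>C\<in>?F. \<exists>g\<in>lifts (fst C) (snd C). stabilizer g = H" if H: "H \<in> subgroups_of_index G n" for H
  proof -
    have sub: "subgroup H G" and index: "finite (rcosets H)" "card (rcosets H) = n"
      using H by (auto simp: subgroups_of_index_def)
    then have HG: "H \<subseteq> carrier G" by (simp add: subgroup.subset)
    define R where "R = (\<lambda>u. {act h u |h. h \<in> H})"
    have R: "R u = R w \<longleftrightarrow> (\<exists>h\<in>H. w = act h u)" for u w
    proof
      assume "R u = R w"
      moreover have "w \<in> R w"
        using subgroup.one_closed[OF sub] act_one[of w] unfolding R_def by force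
      ultimately show "\<exists>h\<in>H. w = act h u" by (auto simp: R_def)
    next
      assume "\<exists>h\<in>H. w = act h u"
      then obtain h where h: "h \<in> H" "w = act h u" by blast
      have "R (act h u) \<subseteq> R u" if "h \<in> H" for h u
        using that HG subgroup.m_closed[OF sub] by (auto simp: R_def act_mult[symmetric] subset_iff) 
      from this[OF h(1), of u] this[OF subgroup.m_inv_closed[OF sub h(1)], of w]
      show "R u = R w" using h HG by (auto simp: subset_iff)
    qed
    have ne: "R u \<noteq> {}" for u using subgroup.one_closed[OF sub] by (auto simp: R_def)
    \<comment> \<open>A point of the total space is the code under \<open>\<iota>\<close> of a
      chosen point of the orbit.\<close>
    define orb where "orb = (\<lambda>u. \<iota> (SOME w. w \<in> R u))"
    have "orb u = orb w \<longleftrightarrow> R u = R w" for u w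
    proof
      assume "orb u = orb w"
      then have eq: "(SOME x. x \<in> R u) = (SOME x. x \<in> R w)" using \<iota> by (simp add: orb_def inj_eq)
      define x where "x = (SOME x. x \<in> R u)"
      have "x \<in> R u" "x \<in> R w"
        using someI_ex[of "\<lambda>x. x \<in> R u"] someI_ex[of "\<lambda>x. x \<in> R w"] ne eq by (auto simp: x_def ex_in_conv)
      then have "R u = R x" "R w = R x" unfolding R by (auto simp: R_def)
      then show "R u = R w" by simp
    qed (simp add: orb_def)
    then have "orb u = orb w \<longleftrightarrow> (\<exists>h\<in>H. w = act h u)" for u w using R by simp
    from quotient_covering[OF sub this index dim] show ?thesis by (metis fst_conv snd_conv)
  qed
  fix C C' H H'
  assume C: "C \<in> ?F" "C' \<in> ?F" and H: "H \<in> subgroups_of_index G n" "H' \<in> subgroups_of_index G n"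
    and g: "\<exists>g\<in>lifts (fst C) (snd C). stabilizer g = H" and g': "\<exists>g\<in>lifts (fst C') (snd C'). stabilizer g = H'"
  obtain N p N' p' where Np: "C = (N, p)" "C' = (N', p')" by (cases C; cases C')
  obtain f where f: "f \<in> lifts N p" "stabilizer f = H" using g by (auto simp: Np)
  obtain f' where f': "f' \<in> lifts N' p'" "stabilizer f' = H'" using g' by (auto simp: Np)
  have "equivalent_coverings C C' \<longleftrightarrow> conjugate_sets G H H'"
    using equivalent_iff_conjugate[of N p k n f N' p' f'] C f f' by (simp add: Np)
  with C H show "(C, C') \<in> {(C, C'). C \<in> ?F \<and> C' \<in> ?F \<and> equivalent_coverings C C'} \<longleftrightarrow>
      (H, H') \<in> conjugacy_on_index G n"
    by simp
qed

end

section \<open>The first amphicosm as a quotient of Euclidean space\<close>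

lemma klein_orbit_iff:
  "(x', y') \<in> klein_orbit (x, y) \<longleftrightarrow> (\<exists>i j. x' = x + of_int i \<and> y' = of_int (sg i) * y + of_int j)"
proof -
  have "(if even i then y else - y) = of_int (sg i) * y" for i by (simp add: sg_def)
  then show ?thesis by (simp add: klein_orbit_def)
qed

lemma klein_orbit_eq_iff:
  "klein_orbit (x, y) = klein_orbit (x', y') \<longleftrightarrow> (\<exists>i j. x' = x + of_int i \<and> y' = of_int (sg i) * y + of_int j)"
proof
  assume "klein_orbit (x, y) = klein_orbit (x', y')"
  moreover have "(x', y') \<in> klein_orbit (x', y')"
    unfolding klein_orbit_iff by (intro exI[of _ 0]) simp
  ultimately have "(x', y') \<in> klein_orbit (x, y)" by simp
  then show "\<exists>i j. x' = x + of_int i \<and> y' = of_int (sg i) * y + of_int j"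
    by (simp only: klein_orbit_iff)
next
  have sub: "klein_orbit (x + of_int i, of_int (sg i) * y + of_int j) \<subseteq> klein_orbit (x, y)" for x y :: real and i j
  proof (rule subsetI)
    fix u assume "u \<in> klein_orbit (x + of_int i, of_int (sg i) * y + of_int j)"
    then obtain i' j' where "u = (x + of_int i + of_int i', of_int (sg i') * (of_int (sg i) * y + of_int j) + of_int j')"
      by (cases u) (auto simp: klein_orbit_iff)
    then have "u = (x + of_int (i + i'), of_int (sg (i + i')) * y + of_int (sg i' * j + j'))"
      by (simp add: sg_add algebra_simps)
    then show "u \<in> klein_orbit (x, y)" by (simp only: klein_orbit_iff) blast
  qed
  assume "\<exists>i j. x' = x + of_int i \<and> y' = of_int (sg i) * y + of_int j"
  then obtain i j where ij: "x' = x + of_int i" "y' = of_int (sg i) * y + of_int j" by blast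
  \<comment> \<open>The inverse of (i, j) in the Klein bottle group is (-i, - sg i * j); it turns
    the inclusion \<open>sub\<close> around.\<close>
  have "y = of_int (sg (- i)) * y' + of_int (- sg i * j)"
  proof -
    have "of_int (sg i) * (of_int (sg i) * y) = y" by (simp add: sg_def)
    then show ?thesis by (simp add: ij(2) algebra_simps)
  qed
  moreover have "x = x' + of_int (- i)" by (simp add: ij(1))
  ultimately have "klein_orbit (x, y) \<subseteq> klein_orbit (x', y')"
    using sub[of x' "- i" y' "- sg i * j"] by simp
  with sub[of x i y j] show "klein_orbit (x, y) = klein_orbit (x', y')" by (simp add: ij)
qed

lemma topspace_klein_bottle: "topspace klein_bottle = range klein_orbit"
proof
  show "topspace klein_bottle \<subseteq> range klein_orbit"
    using openin_topspace[of klein_bottle] unfolding klein_bottle_def openin_quotient_topology by simp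
  have "openin klein_bottle (range klein_orbit)"
    unfolding klein_bottle_def openin_quotient_topology by simp
  then show "range klein_orbit \<subseteq> topspace klein_bottle" by (rule openin_subset)
qed

lemma klein_orbit_continuous: "continuous_map euclidean klein_bottle klein_orbit"
  unfolding continuous_map
  by (simp add: topspace_klein_bottle) (simp add: klein_bottle_def openin_quotient_topology)

text \<open>The saturation of an open set is the union of its preimages under the isometries of the
  group.\<close>

lemma klein_orbit_open:
  assumes "open W"
  shows "openin klein_bottle (klein_orbit ` W)"
proof -
  define t where "t = (\<lambda>i j. \<lambda>(x, y). (x + of_int i, of_int (sg i) * y + of_int j) :: real \<times> real)"
  have "{u. klein_orbit u \<in> klein_orbit ` W} = (\<Union>i. \<Union>j. t i j -` W)"
  proof (intro equalityI subsetI)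
    fix u assume "u \<in> {u. klein_orbit u \<in> klein_orbit ` W}"
    then obtain w where w: "w \<in> W" "klein_orbit u = klein_orbit w" by auto
    obtain x y x' y' where xy: "u = (x, y)" "w = (x', y')" by (cases u; cases w)
    obtain i j where "w = t i j u"
      using w(2) unfolding xy klein_orbit_eq_iff by (auto simp: t_def)
    with w show "u \<in> (\<Union>i. \<Union>j. t i j -` W)" by blast
  next
    fix u assume "u \<in> (\<Union>i. \<Union>j. t i j -` W)"
    then obtain i j where "t i j u \<in> W" by blast
    moreover have "klein_orbit u = klein_orbit (t i j u)"
      by (cases u) (auto simp: t_def klein_orbit_eq_iff)
    ultimately show "u \<in> {u. klein_orbit u \<in> klein_orbit ` W}" by blast
  qed
  moreover have "open (t i j -` W)" for i j
    unfolding t_def case_prod_unfold by (intro open_vimage[OF assms] continuous_intros)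
  then have "open (\<Union>i. \<Union>j. t i j -` W)" by (intro open_UN ballI)
  ultimately have "open {u. klein_orbit u \<in> klein_orbit ` W}" by simp
  then show ?thesis
    unfolding klein_bottle_def openin_quotient_topology by auto
qed

lemma circle_open:
  assumes "open (U :: real set)"
  shows "openin (top_of_set (sphere 0 1)) ((\<lambda>t. cis (2 * pi * t)) ` U)"
proof (subst openin_subopen, intro ballI)
  fix w0 assume "w0 \<in> (\<lambda>t. cis (2 * pi * t)) ` U"
  then obtain t0 where t0: "t0 \<in> U" "w0 = cis (2 * pi * t0)" by blast
  then have w0: "w0 \<noteq> 0" "norm w0 = 1" by auto
  \<comment> \<open>D is the plane slit along the ray opposite to \<open>w0\<close>, and h is the
    branch there of the inverse of \<open>cis (2 * pi * t)\<close> with value \<open>t0\<close> at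
    \<open>w0\<close>.\<close>
  define D where "D = {w. w / w0 \<notin> \<real>\<^sub>\<le>\<^sub>0}"
  define h where "h = (\<lambda>w. t0 + Arg (w / w0) / (2 * pi))"
  have "D = (\<lambda>w. w / w0) -` (- \<real>\<^sub>\<le>\<^sub>0)" by (auto simp: D_def)
  then have "open D" using w0(1) by (auto intro!: open_vimage continuous_intros)
  moreover have "continuous_on D h"
    unfolding h_def using w0(1) by (intro continuous_intros) (auto simp: D_def)
  ultimately have "open (D \<inter> h -` U)"
    using assms by (simp add: continuous_on_open_vimage Int_commute)
  then have "openin (top_of_set (sphere 0 1)) (sphere 0 1 \<inter> (D \<inter> h -` U))"
    by (simp add: openin_open_Int)
  moreover have "w0 \<in> sphere 0 1 \<inter> (D \<inter> h -` U)"
    using t0 w0 by (simp add: D_def h_def)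
  moreover have "sphere 0 1 \<inter> (D \<inter> h -` U) \<subseteq> (\<lambda>t. cis (2 * pi * t)) ` U"
  proof
    fix w assume w: "w \<in> sphere 0 1 \<inter> (D \<inter> h -` U)"
    then have "norm (w / w0) = 1" using w0 by (simp add: norm_divide)
    then have "cis (Arg (w / w0)) = w / w0"
      by (metis cis_Arg div_by_1 norm_zero of_real_1 scaleR_one sgn_div_norm inverse_1 zero_neq_one)
    moreover have "2 * pi * h w = 2 * pi * t0 + Arg (w / w0)"
      by (simp add: h_def field_simps)
    ultimately have "cis (2 * pi * h w) = w0 * (w / w0)"
      by (simp only: cis_mult[symmetric] t0(2))
    then have "w = cis (2 * pi * h w)" using w0 by simp
    with w show "w \<in> (\<lambda>t. cis (2 * pi * t)) ` U" by blast
  qed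
  ultimately show "\<exists>T. openin (top_of_set (sphere 0 1)) T \<and> w0 \<in> T \<and> T \<subseteq> (\<lambda>t. cis (2 * pi * t)) ` U"
    by blast
qed

text \<open>The triple acts as b^j a^i c^k: the sign of a^i is applied before the translation by j,
  as the product of \<open>amphi_group\<close> demands.\<close>

fun amphi_act :: "int \<times> int \<times> int \<Rightarrow> real \<times> real \<times> real \<Rightarrow> real \<times> real \<times> real" where
  "amphi_act (i, j, k) (x, y, z) = (x + of_int i, of_int (sg i) * y + of_int j, z + of_int k)"

fun amphi_proj :: "real \<times> real \<times> real \<Rightarrow> (real \<times> real) set \<times> complex" where
  "amphi_proj (x, y, z) = (klein_orbit (x, y), cis (2 * pi * z))"

lemma cis_eq_iff: "cis (2 * pi * s) = cis (2 * pi * t) \<longleftrightarrow> (\<exists>k::int. t = s + of_int k)"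
proof -
  have "cis (2 * pi * s) = cis (2 * pi * t) \<longleftrightarrow>
      sin (2 * pi * t) = sin (2 * pi * s) \<and> cos (2 * pi * t) = cos (2 * pi * s)"
    by (auto simp: complex_eq_iff)
  also have "\<dots> \<longleftrightarrow> (\<exists>k::int. 2 * pi * t = 2 * pi * s + 2 * pi * of_int k)"
    by (rule sin_cos_eq_iff)
  also have "\<dots> \<longleftrightarrow> (\<exists>k::int. t = s + of_int k)"
    by (simp only: distrib_left[symmetric] mult_cancel_left) simp
  finally show ?thesis .
qed

interpretation amphicosm: deck_group amphi_group amphi_act first_amphicosm amphi_proj
proof (intro deck_group.intro deck_group_axioms.intro)
  show "group amphi_group" by (rule amphi_is_group)
  fix g h :: "int \<times> int \<times> int" and u v :: "real \<times> real \<times> real"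
  show "amphi_act (g \<otimes>\<^bsub>amphi_group\<^esub> h) u = amphi_act g (amphi_act h u)"
    by (cases g; cases h; cases u) (simp add: sg_add algebra_simps)
  show "amphi_act \<one>\<^bsub>amphi_group\<^esub> u = u"
    by (cases u) simp
  show "dist (amphi_act g u) (amphi_act g v) = dist u v"
    by (cases g; cases u; cases v) (auto simp: dist_Pair_Pair dist_real_def sg_def power2_commute)
  show "g = \<one>\<^bsub>amphi_group\<^esub>" if "dist (amphi_act g u) u < 1"
  proof -
    obtain i j k where g: "g = (i, j, k)" by (cases g)
    obtain x y z where u: "u = (x, y, z)" by (cases u)
    have le: "\<bar>a - a'\<bar> \<le> dist (a, b, c) (a', b', c')" "\<bar>b - b'\<bar> \<le> dist (a, b, c) (a', b', c')"
      "\<bar>c - c'\<bar> \<le> dist (a, b, c) (a', b', c')" for a b c a' b' c' :: real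
      using dist_fst_le[of "(a, b, c)" "(a', b', c')"] dist_snd_le[of "(a, b, c)" "(a', b', c')"]
        dist_fst_le[of "(b, c)" "(b', c')"] dist_snd_le[of "(b, c)" "(b', c')"]
      by (auto simp: dist_real_def)
    have lt: "\<bar>(x + of_int i) - x\<bar> < 1" "\<bar>(of_int (sg i) * y + of_int j) - y\<bar> < 1" "\<bar>(z + of_int k) - z\<bar> < 1"
      using that le[where a = "x + of_int i" and b = "of_int (sg i) * y + of_int j" and c = "z + of_int k"
          and a' = x and b' = y and c' = z]
      unfolding g u amphi_act.simps by linarith+
    \<comment> \<open>The outer coordinates come first: only after i = 0 is the sign known to be 1,
      and then the middle coordinate yields j = 0.\<close>
    from lt(1,3) have "i = 0" "k = 0" by auto
    with lt(2) show ?thesis by (simp add: g)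
  qed
next
  show "continuous_map euclidean first_amphicosm amphi_proj"
  proof -
    have "continuous_map (euclidean :: (real \<times> real \<times> real) topology) klein_bottle
        (klein_orbit \<circ> (\<lambda>u. (fst u, fst (snd u))))"
      using klein_orbit_continuous
      by (rule continuous_map_compose[rotated]) (auto intro!: continuous_intros)
    moreover have "continuous_map euclidean (top_of_set (sphere 0 1))
        (\<lambda>u :: real \<times> real \<times> real. cis (2 * pi * snd (snd u)))"
      by (auto simp: continuous_map_in_subtopology intro!: continuous_intros)
    ultimately have "continuous_map euclidean first_amphicosm
        (\<lambda>u. (klein_orbit (fst u, fst (snd u)), cis (2 * pi * snd (snd u))))"
      unfolding first_amphicosm_def continuous_map_paired by (simp add: comp_def)
    moreover have "(\<lambda>u. (klein_orbit (fst u, fst (snd u)), cis (2 * pi * snd (snd u)))) = amphi_proj"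
      by auto
    ultimately show ?thesis by simp
  qed
next
  show "open_map euclidean first_amphicosm amphi_proj"
    unfolding open_map_def
  proof (intro allI impI)
    fix W :: "(real \<times> real \<times> real) set" assume "openin euclidean W"
    then have W: "open W" by simp
    show "openin first_amphicosm (amphi_proj ` W)"
    proof (subst openin_subopen, intro ballI)
      fix w assume "w \<in> amphi_proj ` W"
      then obtain x y z where xyz: "(x, y, z) \<in> W" "w = amphi_proj (x, y, z)" by auto
      obtain A B where AB: "open A" "open B" "x \<in> A" "(y, z) \<in> B" "A \<times> B \<subseteq> W"
        using open_prod_elim[OF W xyz(1)] by (metis mem_Sigma_iff)
      obtain C D where CD: "open C" "open D" "y \<in> C" "z \<in> D" "C \<times> D \<subseteq> B"
        using open_prod_elim[OF AB(2,4)] by (metis mem_Sigma_iff)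
      let ?T = "klein_orbit ` (A \<times> C) \<times> (\<lambda>t. cis (2 * pi * t)) ` D"
      have "openin first_amphicosm ?T"
        unfolding first_amphicosm_def openin_prod_Times_iff
        using klein_orbit_open[OF open_Times[OF AB(1) CD(1)]] circle_open[OF CD(2)] by simp
      moreover have "w \<in> ?T" using xyz AB CD by auto
      moreover have "?T \<subseteq> amphi_proj ` W"
      proof
        fix t assume "t \<in> ?T"
        then obtain a c d where "a \<in> A" "c \<in> C" "d \<in> D" "t = amphi_proj (a, c, d)" by auto
        with AB CD show "t \<in> amphi_proj ` W" by blast
      qed
      ultimately show "\<exists>T. openin first_amphicosm T \<and> w \<in> T \<and> T \<subseteq> amphi_proj ` W" by blast
    qed
  qed
next
  show "range amphi_proj = topspace first_amphicosm"
  proof -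
    have *: "\<exists>t. w = cis (2 * pi * t)" if "norm w = 1" for w
    proof -
      have "w \<noteq> 0" using that by auto
      then have "w = cis (Arg w)" using cis_Arg[of w] that by (simp add: sgn_div_norm)
      then show ?thesis by (intro exI[of _ "Arg w / (2 * pi)"]) simp
    qed
    have "v \<in> range amphi_proj" if v: "v \<in> range klein_orbit \<times> sphere 0 1" for v
    proof -
      obtain x y w where "v = (klein_orbit (x, y), w)" "norm w = 1" using v by auto
      moreover then obtain t where "w = cis (2 * pi * t)" using * by blast
      ultimately have "v = amphi_proj (x, y, t)" by simp
      then show ?thesis by blast
    qed
    moreover have "amphi_proj u \<in> range klein_orbit \<times> sphere 0 1" for u
      by (cases u) auto
    ultimately have "range amphi_proj = range klein_orbit \<times> sphere 0 1" by blast
    then show ?thesis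
      by (simp add: first_amphicosm_def topspace_klein_bottle)
  qed
next
  fix u v :: "real \<times> real \<times> real"
  obtain x y z x' y' z' where uv: "u = (x, y, z)" "v = (x', y', z')" by (cases u; cases v)
  show "amphi_proj u = amphi_proj v \<longleftrightarrow> (\<exists>g\<in>carrier amphi_group. v = amphi_act g u)"
    unfolding uv by (auto simp: klein_orbit_eq_iff cis_eq_iff)
next
  show "\<exists>K. compact K \<and> (\<forall>u. \<exists>g\<in>carrier amphi_group. amphi_act g u \<in> K)"
  proof (intro exI conjI allI)
    show "compact ({0..1::real} \<times> {0..1::real} \<times> {0..1::real})"
      by (intro compact_Times) auto
    fix u :: "real \<times> real \<times> real"
    obtain x y z where u: "u = (x, y, z)" by (cases u)
    have floor: "t + of_int (- \<lfloor>t\<rfloor>) \<in> {0..1}" for t :: real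
      unfolding atLeastAtMost_iff of_int_minus by (intro conjI; linarith)
    show "\<exists>g\<in>carrier amphi_group. amphi_act g u \<in> {0..1} \<times> {0..1} \<times> {0..1}"
      \<comment> \<open>The translation in y is computed from the value after the reflection caused
        by the reduction of x.\<close>
      using floor by (intro bexI[of _ "(- \<lfloor>x\<rfloor>, - \<lfloor>of_int (sg (- \<lfloor>x\<rfloor>)) * y\<rfloor>, - \<lfloor>z\<rfloor>)"])
        (simp_all only: u amphi_act.simps mem_Sigma_iff amphi_group_simps UNIV_I simp_thms)
  qed
qed

section \<open>Dimension, cardinality and the final count\<close>

text \<open>Points of \<open>Euclidean_space 3\<close> are sequences that vanish from index 3 on,
  hence the default 0 in f.\<close>

lemma euclidean_homeomorphic_Euclidean_space_3:
  "(euclidean :: (real \<times> real \<times> real) topology) homeomorphic_space Euclidean_space 3"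
proof -
  define c :: "nat \<Rightarrow> real \<times> real \<times> real \<Rightarrow> real"
    where "c = (\<lambda>i u. if i = 0 then fst u else if i = 1 then fst (snd u) else snd (snd u))"
  define f where "f = (\<lambda>u i. if i < 3 then c i u else 0)"
  define g where "g = (\<lambda>v :: nat \<Rightarrow> real. (v 0, v 1, v 2))"
  have "continuous_on UNIV (c i)" for i
    unfolding c_def by (cases "i = 0"; cases "i = 1") (auto intro!: continuous_intros)
  then have "continuous_map euclidean (Euclidean_space 3) f"
    unfolding f_def continuous_map_componentwise_Euclidean_space by simp
  moreover have "continuous_map (Euclidean_space 3) euclidean g"
    unfolding continuous_map_Euclidean_space_iff g_def
    by (intro continuous_intros continuous_on_subset[OF continuous_on_product_coordinates]) auto
  moreover have "g (f u) = u" for u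
    by (simp add: g_def f_def c_def)
  moreover have "f (g v) = v" if "v \<in> topspace (Euclidean_space 3)" for v
  proof
    fix i :: nat
    consider "i = 0" | "i = 1" | "i = 2" | "i \<ge> 3" by linarith
    then show "f (g v) i = v i"
      using that by cases (auto simp: f_def g_def c_def topspace_Euclidean_space)
  qed
  ultimately have "homeomorphic_maps euclidean (Euclidean_space 3) f g"
    by (simp add: homeomorphic_maps_def)
  then show ?thesis unfolding homeomorphic_space_def by blast
qed

text \<open>Squares of infinite sets do not raise the cardinality; applied twice.\<close>

lemma real3_lepoll_real: "(UNIV :: (real \<times> real \<times> real) set) \<lesssim> (UNIV :: real set)"
proof -
  have sq: "(UNIV :: real set) \<times> (UNIV :: real set) \<lesssim> (UNIV :: real set)"
    using card_of_Times_same_infinite[OF infinite_UNIV_char_0[where 'a = real]]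
    unfolding eqpoll_iff_card_of_ordIso[symmetric] by (rule eqpoll_imp_lepoll)
  then have "(UNIV :: real set) \<times> (UNIV :: real set) \<times> (UNIV :: real set) \<lesssim> (UNIV :: real set) \<times> (UNIV :: real set)"
    by (intro times_lepoll_mono) auto
  from lepoll_trans[OF this sq] show ?thesis by simp
qed

theorem theorem2:
  fixes n :: nat
  assumes "n > 0"
    and "(UNIV :: real set) \<lesssim> (UNIV :: 'a set)"
  shows "num_coverings TYPE('a) 3 first_amphicosm n = num_subgroup_classes pi1_first_amphicosm n \<and>
    real (num_subgroup_classes pi1_first_amphicosm n) =
      1 / real n * real_of_int (\<Sum>l | l dvd n. let m = n div l in
          jordan_totient 3 l * (\<Sum>k | k > 0 \<and> 2 * k dvd m. sigma1 (of_nat k) * int k)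
        + (\<Sum>d | d dvd l. moebius_mu (l div d) * int (gcd 2 d) * (int d)\<^sup>2)
          * (\<Sum>k | k dvd m.
              (sigma1 (of_nat m / of_nat k) - sigma1 (of_nat m / of_nat (2 * k))) * int k)
        + jordan_totient 2 l
          * (\<Sum>k | k > 0 \<and> 2 * k dvd m.
              (sigma1 (of_nat m / of_nat (2 * k)) - sigma1 (of_nat m / of_nat (4 * k)))
              * (2 * int k)))"
    (is "?cov \<and> _ = 1 / real n * real_of_int ?S")
proof
  show ?cov
    using amphicosm.num_coverings_eq_num_subgroup_classes[OF assms(1) lepoll_trans[OF real3_lepoll_real assms(2)]
        euclidean_homeomorphic_Euclidean_space_3]
    by (simp only: num_subgroup_classes_pi1_first_amphicosm)
  \<comment> \<open>The count is compared with the stated sum in the form multiplied by n, as an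
    identity of integers; the division comes last.\<close>
  have "int (n * num_subgroup_classes amphi_group n) = ?S"
    unfolding amphi.card_conjugacy_classes[OF assms(1) finite_subgroups_of_index_amphi_group[OF assms(1)]]
      sum_card_normalizer_cosets[OF assms(1)] coverings_sum[OF assms(1)]
    by (simp only: of_nat_sum case_prod_unfold of_nat_mult)
  then have "real n * real (num_subgroup_classes amphi_group n) = real_of_int ?S"
    by (metis of_int_of_nat_eq of_nat_mult)
  then show "real (num_subgroup_classes pi1_first_amphicosm n) = 1 / real n * real_of_int ?S"
    using assms(1) by (simp add: num_subgroup_classes_pi1_first_amphicosm field_simps)
qed

end
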